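(* (ZFC) Let $\delta$ and $\kappa$ be cardinals with $2^\delta<\kappa$, and suppose that $U$ is a $(\delta,\kappa)$-indecomposable ultrafilter over a set $I$. Let $P$ be a forcing notion of cardinality less than the critical point of the ultrapower embedding $j_U:V\to \mathrm{Ult}(V,U)$. Let $G\subseteq P$ be $V$-generic. Then, in $V[G]$, the set $U^*=\{A\subseteq I\mid \exists B\in U\ (B\subseteq A)\}$ is a $(\delta,\kappa)$-indecomposable ultrafilter over $I$.
   Context: For cardinals $\delta<\lambda$, an ultrafilter $U$ over a set $I$ is called $(\delta,\lambda)$-indecomposable if for every partition $\langle I_\nu \mid \nu<\alpha\rangle$ of $I$ with $\alpha<\lambda$ there is a subsequence $\langle I_{\nu_\xi}\mid \xi<\beta\rangle$ with $\beta<\delta$ whose union belongs to $U$. $j_U$ denotes the ultrapower embedding of $V$ by $U$ (the ultrapower need not be well-founded); its critical point is the least ordinal moved by $j_U$, equivalently the least cardinal $\mu$ such that $I$ can be partitioned into $\mu$ pieces none of which belongs to $U$. *)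

theory Defs
  imports Main
begin

text \<open>
  First-order formulas of set theory with named variables, needed for the Separation and
  Replacement schemata.
\<close>

datatype fm =
    Mem nat nat
  | Eq nat nat
  | Neg fm
  | Conj fm fm
  | All nat fm

text \<open>
  A structure for the language of set theory: a carrier \<open>A\<close> with a binary relation \<open>\<epsilon>\<close>.
  Every notion below is the usual set-theoretic one with all quantifiers relativized to \<open>A\<close>
  (except where the ultrapower, a class of the structure, is formed), so that the
  same definitions apply to the ground model and to its generic extension.
\<close>

locale eps =
  fixes A :: "'a set"
    and E :: "'a \<Rightarrow> 'a \<Rightarrow> bool" (infix "\<epsilon>" 50)
begin

fun sat :: "(nat \<Rightarrow> 'a) \<Rightarrow> fm \<Rightarrow> bool" where
  "sat e (Mem m n) = (e m \<epsilon> e n)"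
| "sat e (Eq m n) = (e m = e n)"
| "sat e (Neg f) = (\<not> sat e f)"
| "sat e (Conj f g) = (sat e f \<and> sat e g)"
| "sat e (All n f) = (\<forall>x\<in>A. sat (e(n := x)) f)"

definition sub :: "'a \<Rightarrow> 'a \<Rightarrow> bool" where
  "sub x y \<longleftrightarrow> (\<forall>z\<in>A. z \<epsilon> x \<longrightarrow> z \<epsilon> y)"

definition is_empty :: "'a \<Rightarrow> bool" where
  "is_empty x \<longleftrightarrow> (\<forall>z\<in>A. \<not> z \<epsilon> x)"

definition is_upair :: "'a \<Rightarrow> 'a \<Rightarrow> 'a \<Rightarrow> bool" where
  "is_upair z x y \<longleftrightarrow> (\<forall>w\<in>A. w \<epsilon> z \<longleftrightarrow> w = x \<or> w = y)"

definition is_pair :: "'a \<Rightarrow> 'a \<Rightarrow> 'a \<Rightarrow> bool" where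
  "is_pair z x y \<longleftrightarrow>
     (\<exists>u\<in>A. \<exists>v\<in>A. is_upair u x x \<and> is_upair v x y \<and> is_upair z u v)"

definition is_power :: "'a \<Rightarrow> 'a \<Rightarrow> bool" where
  "is_power y x \<longleftrightarrow> (\<forall>z\<in>A. z \<epsilon> y \<longleftrightarrow> sub z x)"


subsection \<open>The axioms of ZFC\<close>

definition extensionality :: bool where
  "extensionality \<longleftrightarrow>
     (\<forall>x\<in>A. \<forall>y\<in>A. (\<forall>z\<in>A. z \<epsilon> x \<longleftrightarrow> z \<epsilon> y) \<longrightarrow> x = y)"

definition foundation :: bool where
  "foundation \<longleftrightarrow>
     (\<forall>x\<in>A. \<not> is_empty x \<longrightarrow> (\<exists>y\<in>A. y \<epsilon> x \<and> (\<forall>z\<in>A. \<not> (z \<epsilon> x \<and> z \<epsilon> y))))"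

definition pairing :: bool where
  "pairing \<longleftrightarrow> (\<forall>x\<in>A. \<forall>y\<in>A. \<exists>z\<in>A. is_upair z x y)"

definition union :: bool where
  "union \<longleftrightarrow> (\<forall>x\<in>A. \<exists>u\<in>A. \<forall>z\<in>A. z \<epsilon> u \<longleftrightarrow> (\<exists>y\<in>A. y \<epsilon> x \<and> z \<epsilon> y))"

definition power_set :: bool where
  "power_set \<longleftrightarrow> (\<forall>x\<in>A. \<exists>y\<in>A. is_power y x)"

definition infinity :: bool where
  "infinity \<longleftrightarrow>
     (\<exists>w\<in>A. (\<exists>x\<in>A. x \<epsilon> w \<and> is_empty x) \<and>
       (\<forall>x\<in>A. x \<epsilon> w \<longrightarrow>
          (\<exists>y\<in>A. y \<epsilon> w \<and> (\<forall>z\<in>A. z \<epsilon> y \<longleftrightarrow> z \<epsilon> x \<or> z = x))))"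

definition separation :: bool where
  "separation \<longleftrightarrow>
     (\<forall>f e. range e \<subseteq> A \<longrightarrow>
       (\<forall>a\<in>A. \<exists>b\<in>A. \<forall>x\<in>A. x \<epsilon> b \<longleftrightarrow> x \<epsilon> a \<and> sat (e(0 := x)) f))"

definition replacement :: bool where
  "replacement \<longleftrightarrow>
     (\<forall>f e. range e \<subseteq> A \<longrightarrow>
       (\<forall>a\<in>A.
          (\<forall>x\<in>A. x \<epsilon> a \<longrightarrow>
             (\<forall>y\<in>A. \<forall>y'\<in>A. sat (e(0 := x, 1 := y)) f \<and> sat (e(0 := x, 1 := y')) f \<longrightarrow> y = y'))
          \<longrightarrow> (\<exists>b\<in>A. \<forall>y\<in>A. y \<epsilon> b \<longleftrightarrow> (\<exists>x\<in>A. x \<epsilon> a \<and> sat (e(0 := x, 1 := y)) f))))"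

definition choice :: bool where
  "choice \<longleftrightarrow>
     (\<forall>x\<in>A.
        (\<forall>y\<in>A. y \<epsilon> x \<longrightarrow> \<not> is_empty y) \<and>
        (\<forall>y\<in>A. \<forall>y'\<in>A. y \<epsilon> x \<and> y' \<epsilon> x \<and> y \<noteq> y' \<longrightarrow> (\<forall>z\<in>A. \<not> (z \<epsilon> y \<and> z \<epsilon> y')))
        \<longrightarrow> (\<exists>c\<in>A. \<forall>y\<in>A. y \<epsilon> x \<longrightarrow> (\<exists>!z. z \<in> A \<and> z \<epsilon> y \<and> z \<epsilon> c)))"

definition ZFC :: bool where
  "ZFC \<longleftrightarrow> extensionality \<and> foundation \<and> pairing \<and> union \<and> power_set \<and> infinity \<and>
     separation \<and> replacement \<and> choice"


subsection \<open>Functions, ordinals, cardinals\<close>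

definition app :: "'a \<Rightarrow> 'a \<Rightarrow> 'a \<Rightarrow> bool" where
  "app f x y \<longleftrightarrow> (\<exists>z\<in>A. z \<epsilon> f \<and> is_pair z x y)"

definition fun_on :: "'a \<Rightarrow> 'a \<Rightarrow> bool" where
  "fun_on f x \<longleftrightarrow>
     (\<forall>z\<in>A. z \<epsilon> f \<longrightarrow> (\<exists>a\<in>A. \<exists>b\<in>A. a \<epsilon> x \<and> is_pair z a b)) \<and>
     (\<forall>a\<in>A. a \<epsilon> x \<longrightarrow> (\<exists>!b. b \<in> A \<and> app f a b))"

definition fun_to :: "'a \<Rightarrow> 'a \<Rightarrow> 'a \<Rightarrow> bool" where
  "fun_to f x y \<longleftrightarrow> fun_on f x \<and> (\<forall>a\<in>A. \<forall>b\<in>A. app f a b \<longrightarrow> b \<epsilon> y)"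

definition bijection :: "'a \<Rightarrow> 'a \<Rightarrow> 'a \<Rightarrow> bool" where
  "bijection f x y \<longleftrightarrow>
     fun_to f x y \<and> (\<forall>b\<in>A. b \<epsilon> y \<longrightarrow> (\<exists>!a. a \<in> A \<and> app f a b))"

text \<open>By Foundation, a transitive set linearly ordered by membership is an ordinal.\<close>

definition ordinal :: "'a \<Rightarrow> bool" where
  "ordinal x \<longleftrightarrow>
     (\<forall>y\<in>A. y \<epsilon> x \<longrightarrow> sub y x) \<and>
     (\<forall>y\<in>A. \<forall>z\<in>A. y \<epsilon> x \<and> z \<epsilon> x \<longrightarrow> y \<epsilon> z \<or> y = z \<or> z \<epsilon> y)"

definition cardinal :: "'a \<Rightarrow> bool" where
  "cardinal k \<longleftrightarrow> ordinal k \<and> \<not> (\<exists>b\<in>A. b \<epsilon> k \<and> (\<exists>f\<in>A. bijection f b k))"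

definition has_card :: "'a \<Rightarrow> 'a \<Rightarrow> bool" where
  "has_card x k \<longleftrightarrow> cardinal k \<and> (\<exists>f\<in>A. bijection f x k)"

text \<open>\<open>2\<^sup>d < k\<close>, where \<open>2\<^sup>d\<close> is the cardinality of the power set of \<open>d\<close>.\<close>

definition two_power_less :: "'a \<Rightarrow> 'a \<Rightarrow> bool" where
  "two_power_less d k \<longleftrightarrow> (\<exists>y\<in>A. \<exists>c\<in>A. is_power y d \<and> has_card y c \<and> c \<epsilon> k)"


subsection \<open>Indecomposable ultrafilters\<close>

definition ultrafilter :: "'a \<Rightarrow> 'a \<Rightarrow> bool" where
  "ultrafilter U I \<longleftrightarrow>
     (\<forall>X\<in>A. X \<epsilon> U \<longrightarrow> sub X I) \<and>
     I \<epsilon> U \<and>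
     (\<forall>X\<in>A. X \<epsilon> U \<longrightarrow> \<not> is_empty X) \<and>
     (\<forall>X\<in>A. \<forall>Y\<in>A. X \<epsilon> U \<and> Y \<epsilon> U \<longrightarrow>
        (\<exists>Z\<in>A. Z \<epsilon> U \<and> (\<forall>i\<in>A. i \<epsilon> Z \<longleftrightarrow> i \<epsilon> X \<and> i \<epsilon> Y))) \<and>
     (\<forall>X\<in>A. \<forall>Y\<in>A. X \<epsilon> U \<and> sub X Y \<and> sub Y I \<longrightarrow> Y \<epsilon> U) \<and>
     (\<forall>X\<in>A. sub X I \<longrightarrow>
        X \<epsilon> U \<or> (\<exists>Y\<in>A. Y \<epsilon> U \<and> (\<forall>i\<in>A. i \<epsilon> Y \<longleftrightarrow> i \<epsilon> I \<and> \<not> i \<epsilon> X)))"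

text \<open>\<open>s\<close> is a sequence of length \<open>a\<close> of pairwise disjoint (possibly empty) sets with union \<open>I\<close>.\<close>

definition partition :: "'a \<Rightarrow> 'a \<Rightarrow> 'a \<Rightarrow> bool" where
  "partition s a I \<longleftrightarrow>
     fun_on s a \<and>
     (\<forall>n\<in>A. \<forall>X\<in>A. app s n X \<longrightarrow> sub X I) \<and>
     (\<forall>i\<in>A. i \<epsilon> I \<longrightarrow> (\<exists>!n. n \<in> A \<and> n \<epsilon> a \<and> (\<exists>X\<in>A. app s n X \<and> i \<epsilon> X)))"

text \<open>\<open>t\<close> is a strictly increasing sequence of length \<open>b\<close> of elements of \<open>a\<close>.\<close>

definition increasing :: "'a \<Rightarrow> 'a \<Rightarrow> 'a \<Rightarrow> bool" where
  "increasing t b a \<longleftrightarrow>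
     fun_to t b a \<and>
     (\<forall>x\<in>A. \<forall>y\<in>A. \<forall>m\<in>A. \<forall>n\<in>A. x \<epsilon> y \<and> app t x m \<and> app t y n \<longrightarrow> m \<epsilon> n)"

text \<open>
  \<open>d\<close> and \<open>k\<close> are meant to be ordinals here: cardinals of the ground model, which need not
  remain cardinals in a generic extension.
\<close>

definition indecomposable :: "'a \<Rightarrow> 'a \<Rightarrow> 'a \<Rightarrow> 'a \<Rightarrow> bool" where
  "indecomposable d k U I \<longleftrightarrow>
     (\<forall>a\<in>A. \<forall>s\<in>A. a \<epsilon> k \<and> partition s a I \<longrightarrow>
        (\<exists>b\<in>A. \<exists>t\<in>A. b \<epsilon> d \<and> increasing t b a \<and>
           (\<exists>Y\<in>A. Y \<epsilon> U \<and>
              (\<forall>i\<in>A. i \<epsilon> Y \<longleftrightarrow>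
                 (\<exists>x\<in>A. \<exists>n\<in>A. \<exists>X\<in>A. app t x n \<and> app s n X \<and> i \<epsilon> X)))))"


subsection \<open>The ultrapower embedding\<close>

text \<open>
  The ultrapower of the structure by \<open>U\<close>: its elements are the classes modulo \<open>U\<close> of the functions
  on \<open>I\<close> that belong to the structure.
\<close>

definition ult_eq :: "'a \<Rightarrow> 'a \<Rightarrow> 'a \<Rightarrow> 'a \<Rightarrow> bool" where
  "ult_eq U I f g \<longleftrightarrow>
     (\<exists>X\<in>A. X \<epsilon> U \<and> (\<forall>i\<in>A. i \<epsilon> X \<longleftrightarrow> i \<epsilon> I \<and> (\<exists>x\<in>A. app f i x \<and> app g i x)))"

definition ult_mem :: "'a \<Rightarrow> 'a \<Rightarrow> 'a \<Rightarrow> 'a \<Rightarrow> bool" where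
  "ult_mem U I f g \<longleftrightarrow>
     (\<exists>X\<in>A. X \<epsilon> U \<and>
        (\<forall>i\<in>A. i \<epsilon> X \<longleftrightarrow> i \<epsilon> I \<and> (\<exists>x\<in>A. \<exists>y\<in>A. app f i x \<and> app g i y \<and> x \<epsilon> y)))"

definition ult_class :: "'a \<Rightarrow> 'a \<Rightarrow> 'a \<Rightarrow> 'a set" where
  "ult_class U I f = {g \<in> A. fun_on g I \<and> ult_eq U I f g}"

definition Ult :: "'a \<Rightarrow> 'a \<Rightarrow> 'a set set" where
  "Ult U I = {ult_class U I f | f. f \<in> A \<and> fun_on f I}"

definition Ult_mem :: "'a \<Rightarrow> 'a \<Rightarrow> 'a set \<Rightarrow> 'a set \<Rightarrow> bool" where
  "Ult_mem U I X Y \<longleftrightarrow> (\<exists>f\<in>X. \<exists>g\<in>Y. ult_mem U I f g)"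

definition const_fun :: "'a \<Rightarrow> 'a \<Rightarrow> 'a" where
  "const_fun I x = (THE c. c \<in> A \<and> fun_on c I \<and> (\<forall>i\<in>A. i \<epsilon> I \<longrightarrow> app c i x))"

definition j :: "'a \<Rightarrow> 'a \<Rightarrow> 'a \<Rightarrow> 'a set" where
  "j U I x = ult_class U I (const_fun I x)"

text \<open>
  The well-founded part of the ultrapower is identified with its transitive collapse. Hence
  \<open>j(a) = a\<close> for an ordinal \<open>a\<close> means that the predecessors of \<open>j(a)\<close> in the ultrapower are
  order-isomorphic to \<open>a\<close>.
\<close>

definition moved :: "'a \<Rightarrow> 'a \<Rightarrow> 'a \<Rightarrow> bool" where
  "moved U I a \<longleftrightarrow>
     \<not> (\<exists>h. bij_betw h {b \<in> A. b \<epsilon> a} {X \<in> Ult U I. Ult_mem U I X (j U I a)} \<and>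
            (\<forall>b\<in>A. \<forall>c\<in>A. b \<epsilon> a \<and> c \<epsilon> a \<longrightarrow> (b \<epsilon> c \<longleftrightarrow> Ult_mem U I (h b) (h c))))"

definition critical_point :: "'a \<Rightarrow> 'a \<Rightarrow> 'a \<Rightarrow> bool" where
  "critical_point U I m \<longleftrightarrow>
     ordinal m \<and> moved U I m \<and> (\<forall>b\<in>A. b \<epsilon> m \<longrightarrow> \<not> moved U I b)"

end


subsection \<open>Forcing over a well-founded universe\<close>

text \<open>
  The whole type \<open>'v\<close> with the membership relation \<open>\<epsilon>\<close> plays the role of \<open>V\<close>. A forcing notion
  is given by its underlying set \<open>P\<close> and by its ordering \<open>L\<close>, both elements of \<open>V\<close>; the filter
  \<open>G\<close> need not belong to \<open>V\<close>.
\<close>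

locale forcing =
  fixes E :: "'v \<Rightarrow> 'v \<Rightarrow> bool" (infix "\<epsilon>" 50)
    and P L :: 'v
    and G :: "'v set"
begin

sublocale V: eps UNIV E .

definition le :: "'v \<Rightarrow> 'v \<Rightarrow> bool" where
  "le q p \<longleftrightarrow> (\<exists>z. z \<epsilon> L \<and> V.is_pair z q p)"

definition forcing_notion :: bool where
  "forcing_notion \<longleftrightarrow>
     (\<exists>p. p \<epsilon> P) \<and>
     (\<forall>p. p \<epsilon> P \<longrightarrow> le p p) \<and>
     (\<forall>p q r. p \<epsilon> P \<and> q \<epsilon> P \<and> r \<epsilon> P \<and> le p q \<and> le q r \<longrightarrow> le p r)"

definition dense :: "'v \<Rightarrow> bool" where
  "dense D \<longleftrightarrow> V.sub D P \<and> (\<forall>p. p \<epsilon> P \<longrightarrow> (\<exists>q. q \<epsilon> D \<and> le q p))"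

definition generic :: bool where
  "generic \<longleftrightarrow>
     G \<subseteq> {p. p \<epsilon> P} \<and> G \<noteq> {} \<and>
     (\<forall>p\<in>G. \<forall>q. q \<epsilon> P \<and> le p q \<longrightarrow> q \<in> G) \<and>
     (\<forall>p\<in>G. \<forall>q\<in>G. \<exists>r\<in>G. le r p \<and> le r q) \<and>
     (\<forall>D. dense D \<longrightarrow> (\<exists>p\<in>G. p \<epsilon> D))"

text \<open>
  Every element of \<open>V\<close> is regarded as a name, with interpretation
  \<open>val s = {val t | t. \<exists>p\<in>G. (t, p) \<in> s}\<close>. As this recursion has no type to take values in, \<open>val s\<close>
  is represented by the set of all names with the same interpretation as \<open>s\<close>; two names have the
  same interpretation iff they are bisimilar. The lemmas \<open>memG_val\<close>, \<open>VG_extensional\<close> and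
  \<open>VG_wf\<close> below show that the recursion equation holds, which determines \<open>V[G]\<close> up to isomorphism.
\<close>

definition elem_name :: "'v \<Rightarrow> 'v \<Rightarrow> bool" where
  "elem_name t s \<longleftrightarrow> (\<exists>p\<in>G. \<exists>z. z \<epsilon> s \<and> V.is_pair z t p)"

definition bisimulation :: "('v \<Rightarrow> 'v \<Rightarrow> bool) \<Rightarrow> bool" where
  "bisimulation R \<longleftrightarrow>
     (\<forall>s s'. R s s' \<longrightarrow>
        (\<forall>t. elem_name t s \<longrightarrow> (\<exists>t'. elem_name t' s' \<and> R t t')) \<and>
        (\<forall>t'. elem_name t' s' \<longrightarrow> (\<exists>t. elem_name t s \<and> R t t')))"

definition name_eq :: "'v \<Rightarrow> 'v \<Rightarrow> bool" where
  "name_eq s s' \<longleftrightarrow> (\<exists>R. bisimulation R \<and> R s s')"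

definition val :: "'v \<Rightarrow> 'v set" where
  "val s = {s'. name_eq s s'}"

definition VG :: "'v set set" where
  "VG = range val"

definition memG :: "'v set \<Rightarrow> 'v set \<Rightarrow> bool" where
  "memG X Y \<longleftrightarrow> (\<exists>t s. X = val t \<and> Y = val s \<and> elem_name t s)"

sublocale VG: eps VG memG .

text \<open>
  The canonical name \<open>{(check y, p) | y p. y \<in> x \<and> p \<in> P}\<close> of \<open>x\<close>; all conditions are used because
  \<open>P\<close> is not assumed to have a largest one.
\<close>

definition check :: "'v \<Rightarrow> 'v" where
  "check = wfrec {(y, x). y \<epsilon> x}
     (\<lambda>f x. THE c. \<forall>z. z \<epsilon> c \<longleftrightarrow> (\<exists>y p. y \<epsilon> x \<and> p \<epsilon> P \<and> V.is_pair z (f y) p))"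

text \<open>The element \<open>x\<close> of \<open>V\<close> as an element of \<open>V[G]\<close>.\<close>

definition ground :: "'v \<Rightarrow> 'v set" where
  "ground x = val (check x)"

text \<open>\<open>W\<close> is, in \<open>V[G]\<close>, the set of all \<open>X \<subseteq> I\<close> that include some \<open>Y \<in> U\<close>.\<close>

definition generated :: "'v set \<Rightarrow> 'v \<Rightarrow> 'v \<Rightarrow> bool" where
  "generated W U I \<longleftrightarrow>
     (\<forall>X\<in>VG. memG X W \<longleftrightarrow>
        VG.sub X (ground I) \<and> (\<exists>Y\<in>VG. memG Y (ground U) \<and> VG.sub Y X))"

lemma name_eqI: "bisimulation R \<Longrightarrow> R s s' \<Longrightarrow> name_eq s s'"
  unfolding name_eq_def by (rule exI[of _ R]) simp

lemma name_eq_left: "name_eq s s' \<Longrightarrow> elem_name t s \<Longrightarrow> \<exists>t'. elem_name t' s' \<and> name_eq t t'"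
proof -
  assume "name_eq s s'" and t: "elem_name t s"
  then obtain R where R: "bisimulation R" "R s s'" unfolding name_eq_def by auto
  then obtain u where "elem_name u s'" "R t u" using t unfolding bisimulation_def by metis
  then show ?thesis using name_eqI[OF R(1)] by auto
qed

lemma name_eq_right: "name_eq s s' \<Longrightarrow> elem_name t' s' \<Longrightarrow> \<exists>t. elem_name t s \<and> name_eq t t'"
proof -
  assume "name_eq s s'" and t: "elem_name t' s'"
  then obtain R where R: "bisimulation R" "R s s'" unfolding name_eq_def by auto
  then obtain u where "elem_name u s" "R u t'" using t unfolding bisimulation_def by metis
  then show ?thesis using name_eqI[OF R(1)] by auto
qed

lemma name_eq_refl: "name_eq s s"
proof -
  have "bisimulation (=)" by (auto simp: bisimulation_def)
  then show ?thesis by (rule name_eqI) simp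
qed

lemma name_eq_sym: "name_eq s s' \<Longrightarrow> name_eq s' s"
proof -
  have "bisimulation (\<lambda>s s'. name_eq s' s)"
    unfolding bisimulation_def using name_eq_left name_eq_right by blast
  then show "name_eq s s' \<Longrightarrow> name_eq s' s" by (rule name_eqI)
qed

lemma name_eq_trans:
  assumes "name_eq s t" "name_eq t u"
  shows "name_eq s u"
proof -
  let ?R = "\<lambda>s u. \<exists>t. name_eq s t \<and> name_eq t u"
  have "bisimulation ?R"
    unfolding bisimulation_def
  proof (intro allI impI conjI)
    fix s u x assume "?R s u" and x: "elem_name x s"
    then obtain t where st: "name_eq s t" and tu: "name_eq t u" by blast
    show "\<exists>z. elem_name z u \<and> ?R x z"
      using name_eq_left[OF st x] name_eq_left[OF tu] by blast
  next
    fix s u z assume "?R s u" and z: "elem_name z u"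
    then obtain t where st: "name_eq s t" and tu: "name_eq t u" by blast
    show "\<exists>x. elem_name x s \<and> ?R x z"
      using name_eq_right[OF tu z] name_eq_right[OF st] by blast
  qed
  then show ?thesis by (rule name_eqI) (use assms in blast)
qed

lemma val_eq_iff: "val s = val t \<longleftrightarrow> name_eq s t"
  unfolding val_def using name_eq_refl name_eq_sym name_eq_trans by blast

lemma memG_val: "memG X (val s) \<longleftrightarrow> (\<exists>t. X = val t \<and> elem_name t s)"
proof
  assume "memG X (val s)"
  then obtain t s' where X: "X = val t" and s: "name_eq s' s" and t: "elem_name t s'"
    unfolding memG_def using val_eq_iff by metis
  obtain t' where "elem_name t' s" "name_eq t t'" using name_eq_left[OF s t] by blast
  then show "\<exists>t. X = val t \<and> elem_name t s" using X val_eq_iff by blast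
qed (auto simp: memG_def)

lemma VG_extensional: "VG.extensionality"
proof -
  have "val s = val t"
    if "\<forall>z\<in>VG. memG z (val s) \<longleftrightarrow> memG z (val t)" for s t
  proof -
    have eq: "memG (val x) (val s) \<longleftrightarrow> memG (val x) (val t)" for x
      using that by (auto simp: VG_def)
    let ?R = "\<lambda>s t. (\<forall>x. memG (val x) (val s) \<longleftrightarrow> memG (val x) (val t))"
    have "bisimulation ?R"
      unfolding bisimulation_def
    proof (intro allI impI conjI)
      fix s t x assume R: "?R s t" and x: "elem_name x s"
      have "memG (val x) (val t)" using R x memG_val by blast
      then obtain x' where "elem_name x' t" "val x = val x'" using memG_val by blast
      then show "\<exists>x'. elem_name x' t \<and> ?R x x'" by auto
    next
      fix s t x' assume R: "?R s t" and x': "elem_name x' t"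
      have "memG (val x') (val s)" using R x' memG_val by blast
      then obtain x where "elem_name x s" "val x' = val x" using memG_val by blast
      then show "\<exists>x. elem_name x s \<and> ?R x x'" by auto
    qed
    then have "name_eq s t" by (rule name_eqI) (simp add: eq)
    then show ?thesis using val_eq_iff by blast
  qed
  note * = this
  show ?thesis unfolding VG.extensionality_def
  proof (intro ballI impI)
    fix X Y assume "X \<in> VG" "Y \<in> VG" and eq: "\<forall>z\<in>VG. memG z X \<longleftrightarrow> memG z Y"
    then obtain s t where X: "X = val s" and Y: "Y = val t" by (auto simp: VG_def)
    show "X = Y" unfolding X Y by (rule *) (use eq X Y in simp)
  qed
qed

lemma VG_wf:
  assumes "wfp E"
  shows "wfp memG"
proof -
  have sub: "E\<^sup>+\<^sup>+ t s" if el: "elem_name t s" for t s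
  proof -
    obtain p z u v where "z \<epsilon> s" "V.is_upair u t t" "V.is_upair z u v"
      using el unfolding elem_name_def V.is_pair_def by blast
    then have "t \<epsilon> u" "u \<epsilon> z" "z \<epsilon> s" by (auto simp: V.is_upair_def)
    then show ?thesis by (meson tranclp.r_into_trancl tranclp.trancl_into_trancl)
  qed
  have wf: "wfp (E\<^sup>+\<^sup>+)" using assms by (simp add: wfp_tranclp)
  have acc: "Wellfounded.accp memG (val s)" for s
    using wf
  proof (induction s rule: wfp_induct_rule)
    case (less s)
    show ?case
    proof (rule accp.accI)
      fix X assume "memG X (val s)"
      then obtain t where "X = val t" "elem_name t s" using memG_val by metis
      then show "Wellfounded.accp memG X" using less sub by simp
    qed
  qed
  have "Wellfounded.accp memG X" for X
  proof (rule accp.accI)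
    fix Y assume "memG Y X"
    then show "Wellfounded.accp memG Y" using acc by (auto simp: memG_def)
  qed
  then show ?thesis by (simp add: wfp_iff_accp)
qed

end

end

theory Submission
  imports Defs
begin

text \<open>
  Two properties of \<open>U\<close> drive the proof. First, since no ordinal below the critical point is moved,
  every function from \<open>I\<close> into some \<open>a < \<mu>\<close> is constant on a set in \<open>U\<close>; as \<open>P\<close> has cardinality below
  \<open>\<mu>\<close>, whenever each \<open>i \<in> I\<close> has a condition \<open>q \<le> p\<close> suitable for \<open>i\<close>, a single \<open>q \<le> p\<close> is
  suitable for almost all \<open>i\<close>. Given a name for a subset \<open>X\<close> of \<open>I\<close>, a dense set of conditions
  therefore decides \<open>i \<in> X\<close> in the same way for almost all \<open>i\<close>, which makes \<open>U\<^sup>*\<close> an ultrafilter. Given a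
  name for a partition into \<open>a < \<kappa>\<close> pieces, a dense set of conditions \<open>q\<close> decides the piece
  containing \<open>i\<close> for almost all \<open>i\<close>; the decided values partition \<open>I\<close> in the ground model, and
  indecomposability there yields fewer than \<open>\<delta>\<close> pieces that also suffice in the extension.

  The forcing relation for equality of names is not defined by recursion: a condition forces
  \<open>s = t\<close> iff some element of the ground model is a bisimulation, in the sense of forcing,
  relating \<open>s\<close> and \<open>t\<close>. This makes definability immediate; the truth lemma uses that this
  greatest fixed point meets the generic filter exactly when the values are bisimilar.
\<close>

subsection \<open>Definable predicates\<close>

text \<open>What shapes the argument is definability. HOL predicates on the carrier may mention
  \<open>G\<close>, whereas Separation and Replacement accept only formulas with parameters, and the
  filter is only known to meet dense sets that are elements of the ground model. Hence every set
  that is formed, and every dense set offered to \<open>G\<close>, comes with a proof of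
  \<open>dfn\<close>; the forcing relation turns a definable predicate of the extension into a
  definable predicate of conditions and names.

  The argument does not pass through ZFC in the extension. The sets that must exist there are
  subsets of \<open>ground I\<close> and the filter itself, and these receive explicit names built
  from the canonical names of the elements of \<open>I\<close>.

  The critical point enters through unmoved ordinals: unmovedness is witnessed by an isomorphism
  outside the model, so it has to be shown first that this isomorphism is \<open>j\<close>.
  Membership in the generated filter is phrased by \<open>ae\<close>, which asks for a set in
  \<open>U\<close> on which a predicate holds without asking that the predicate define a set of the
  ground model.\<close>

named_theorems dfn_intros

context eps begin

text \<open>Bound variables are not removed at a quantifier: the purpose is a finite set outside of
  which the assignment is irrelevant.\<close>

fun fvars :: "fm \<Rightarrow> nat set" where
  "fvars (Mem m n) = {m, n}"
| "fvars (Eq m n) = {m, n}"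
| "fvars (Neg f) = fvars f"
| "fvars (Conj f g) = fvars f \<union> fvars g"
| "fvars (All n f) = fvars f"

lemma finite_fvars: "finite (fvars f)"
  by (induction f) auto

lemma sat_cong: "(\<And>k. k \<in> fvars f \<Longrightarrow> e k = e' k) \<Longrightarrow> sat e f = sat e' f"
proof (induction f arbitrary: e e')
  case (Neg f)
  have "sat e f = sat e' f" by (rule Neg.IH) (simp add: Neg.prems)
  then show ?case by simp
next
  case (Conj f g)
  have "sat e f = sat e' f" by (rule Conj.IH(1)) (simp add: Conj.prems)
  moreover have "sat e g = sat e' g" by (rule Conj.IH(2)) (simp add: Conj.prems)
  ultimately show ?case by simp
next
  case (All n f)
  have "sat (e(n := x)) f = sat (e'(n := x)) f" for x
    by (rule All.IH) (simp add: All.prems)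
  then show ?case by simp
qed simp_all

text \<open>The renaming may be arbitrary, even non-injective, since only the quantifier case can go
  wrong; there the bound variable becomes an \<open>N\<close> that \<open>r\<close> does not hit on
  variables of the body, which avoids capture.\<close>

lemma ex_renamed: "\<exists>f'. \<forall>e. sat e f' = sat (\<lambda>k. e (r k)) f"
proof (induction f arbitrary: r)
  case (Mem m n)
  show ?case by (rule exI[of _ "Mem (r m) (r n)"]) simp
next
  case (Eq m n)
  show ?case by (rule exI[of _ "Eq (r m) (r n)"]) simp
next
  case (Neg f)
  then obtain f' where "\<forall>e. sat e f' = sat (\<lambda>k. e (r k)) f" by blast
  then show ?case by (intro exI[of _ "Neg f'"]) simp
next
  case (Conj f g)
  obtain f' g' where "\<forall>e. sat e f' = sat (\<lambda>k. e (r k)) f" "\<forall>e. sat e g' = sat (\<lambda>k. e (r k)) g"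
    using Conj by metis
  then show ?case by (intro exI[of _ "Conj f' g'"]) simp
next
  case (All n f)
  obtain N where N: "N \<notin> r ` fvars f"
    using ex_new_if_finite[OF infinite_UNIV_nat] finite_fvars by blast
  obtain f' where f': "\<forall>e. sat e f' = sat (\<lambda>k. e ((r(n := N)) k)) f" using All by blast
  have "sat (\<lambda>k. (e(N := x)) ((r(n := N)) k)) f = sat ((\<lambda>k. e (r k))(n := x)) f" for e x
    by (rule sat_cong) (use N in auto)
  then show ?case using f' by (intro exI[of _ "All N f'"]) simp
qed

text \<open>Formulas have no constants. A parameter is therefore a value assigned to a variable:
  \<open>\<rho>\<close> lets each variable of the formula read either a variable of the assignment
  (\<open>Inl\<close>) or a fixed parameter (\<open>Inr\<close>).\<close>

definition inst :: "(nat \<Rightarrow> nat + 'a) \<Rightarrow> (nat \<Rightarrow> 'a) \<Rightarrow> nat \<Rightarrow> 'a" where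
  "inst \<rho> e k = (case \<rho> k of Inl i \<Rightarrow> e i | Inr c \<Rightarrow> c)"

text \<open>
  \<open>dfn Q\<close>: the predicate \<open>Q\<close> of variable assignments is definable by a formula with parameters.
  In the rules for binders the bound variable is variable \<open>0\<close> and the other variables are
  shifted, so that definability of a HOL formula is proved by \<open>intro dfn_intros\<close>.
\<close>

definition dfn :: "((nat \<Rightarrow> 'a) \<Rightarrow> bool) \<Rightarrow> bool" where
  "dfn Q \<longleftrightarrow> (\<exists>f \<rho>. (\<forall>k c. \<rho> k = Inr c \<longrightarrow> c \<in> A) \<and> (\<forall>e. range e \<subseteq> A \<longrightarrow> Q e = sat (inst \<rho> e) f))"

text \<open>An operation is treated through its graph: variable \<open>0\<close> is the value and
  the arguments are the remaining variables shifted by one, so that a term can be eliminated by a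
  quantifier.\<close>

definition dterm :: "((nat \<Rightarrow> 'a) \<Rightarrow> 'a) \<Rightarrow> bool" where
  "dterm t \<longleftrightarrow> (\<forall>e. range e \<subseteq> A \<longrightarrow> t e \<in> A) \<and> dfn (\<lambda>e. e 0 = t (\<lambda>k. e (Suc k)))"

lemma dfnI:
  assumes "\<And>k c. \<rho> k = Inr c \<Longrightarrow> c \<in> A" "\<And>e. range e \<subseteq> A \<Longrightarrow> Q e = sat (inst \<rho> e) f"
  shows "dfn Q"
  using assms unfolding dfn_def by blast

lemma dfnE:
  assumes "dfn Q"
  obtains \<rho> f where "\<forall>k c. \<rho> k = Inr c \<longrightarrow> c \<in> A" "\<forall>e. range e \<subseteq> A \<longrightarrow> Q e = sat (inst \<rho> e) f"
  using assms unfolding dfn_def by blast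

lemma dfn_cong:
  assumes "dfn Q" "\<And>e. range e \<subseteq> A \<Longrightarrow> Q' e = Q e"
  shows "dfn Q'"
  by (rule dfnE[OF assms(1)], rule dfnI) (simp_all add: assms(2))

lemma dfn_not [dfn_intros]:
  assumes "dfn Q"
  shows "dfn (\<lambda>e. \<not> Q e)"
proof -
  obtain \<rho> f where f0: "\<forall>k c. \<rho> k = Inr c \<longrightarrow> c \<in> A" "\<forall>e. range e \<subseteq> A \<longrightarrow> Q e = sat (inst \<rho> e) f"
    using assms by (rule dfnE)
  note f = f0[rule_format]
  show ?thesis
  proof (rule dfnI[OF f(1)])
    show "(\<not> Q e) = sat (inst \<rho> e) (Neg f)" if "range e \<subseteq> A" for e
      using f(2)[OF that] by simp
  qed
qed

lemma dfn_conj [dfn_intros]: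
  assumes "dfn Q" "dfn R"
  shows "dfn (\<lambda>e. Q e \<and> R e)"
proof -
  obtain \<rho> f where f0: "\<forall>k c. \<rho> k = Inr c \<longrightarrow> c \<in> A" "\<forall>e. range e \<subseteq> A \<longrightarrow> Q e = sat (inst \<rho> e) f"
    using assms(1) by (rule dfnE)
  note f = f0[rule_format]
  obtain \<sigma> g where g0: "\<forall>k c. \<sigma> k = Inr c \<longrightarrow> c \<in> A" "\<forall>e. range e \<subseteq> A \<longrightarrow> R e = sat (inst \<sigma> e) g"
    using assms(2) by (rule dfnE)
  note g = g0[rule_format]
  obtain f' where f': "\<forall>e. sat e f' = sat (\<lambda>k. e (2 * k)) f"
    using ex_renamed[where r="\<lambda>k. 2 * k"] by blast
  obtain g' where g': "\<forall>e. sat e g' = sat (\<lambda>k. e (Suc (2 * k))) g"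
    using ex_renamed[where r="\<lambda>k. Suc (2 * k)"] by blast
  \<comment> \<open>The two formulas come with different parameter maps, so the variables of the
    first are moved to even positions and those of the second to odd positions.\<close>
  define \<tau> where "\<tau> = (\<lambda>k. if even k then \<rho> (k div 2) else \<sigma> (k div 2))"
  have 1: "(\<lambda>k. inst \<tau> e (2 * k)) = inst \<rho> e" "(\<lambda>k. inst \<tau> e (Suc (2 * k))) = inst \<sigma> e" for e
    by (auto simp: inst_def \<tau>_def)
  show ?thesis
  proof (rule dfnI)
    show "c \<in> A" if "\<tau> k = Inr c" for k c
      using that f(1) g(1) unfolding \<tau>_def by metis
    show "(Q e \<and> R e) = sat (inst \<tau> e) (Conj f' g')" if "range e \<subseteq> A" for e
      using f(2)[OF that] g(2)[OF that] f'[rule_format, of "inst \<tau> e"] g'[rule_format, of "inst \<tau> e"]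
      unfolding 1 by simp
  qed
qed

lemma dfn_disj [dfn_intros]:
  assumes "dfn Q" "dfn R"
  shows "dfn (\<lambda>e. Q e \<or> R e)"
  by (rule dfn_cong[OF dfn_not[OF dfn_conj[OF assms[THEN dfn_not]]]]) simp

lemma dfn_imp [dfn_intros]:
  assumes "dfn Q" "dfn R"
  shows "dfn (\<lambda>e. Q e \<longrightarrow> R e)"
  by (rule dfn_cong[OF dfn_disj[OF dfn_not[OF assms(1)] assms(2)]]) blast

lemma dfn_iff [dfn_intros]:
  assumes "dfn Q" "dfn R"
  shows "dfn (\<lambda>e. Q e \<longleftrightarrow> R e)"
  by (rule dfn_cong[OF dfn_conj[OF dfn_imp[OF assms] dfn_imp[OF assms(2,1)]]]) blast

lemma dfn_rename:
  assumes "dfn Q"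
  shows "dfn (\<lambda>e. Q (\<lambda>k. e (r k)))"
proof -
  obtain \<rho> f where f0: "\<forall>k c. \<rho> k = Inr c \<longrightarrow> c \<in> A" "\<forall>e. range e \<subseteq> A \<longrightarrow> Q e = sat (inst \<rho> e) f"
    using assms by (rule dfnE)
  note f = f0[rule_format]
  define \<sigma> where "\<sigma> = (\<lambda>k. map_sum r id (\<rho> k))"
  have 1: "inst \<sigma> e = inst \<rho> (\<lambda>k. e (r k))" for e
    unfolding \<sigma>_def by (rule ext) (auto simp: inst_def split: sum.splits)
  show ?thesis
  proof (rule dfnI)
    show "c \<in> A" if "\<sigma> k = Inr c" for k c
      using that f(1)[of k c] by (cases "\<rho> k") (auto simp: \<sigma>_def)
    show "Q (\<lambda>k. e (r k)) = sat (inst \<sigma> e) f" if "range e \<subseteq> A" for e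
      unfolding 1 by (rule f(2)) (use that in auto)
  qed
qed

lemma dfn_ball [dfn_intros]:
  assumes "dfn (\<lambda>e. Q (e 0) (\<lambda>k. e (Suc k)))"
  shows "dfn (\<lambda>e. \<forall>x\<in>A. Q x e)"
proof -
  obtain \<rho> f where f0: "\<forall>k c. \<rho> k = Inr c \<longrightarrow> c \<in> A"
    "\<forall>e. range e \<subseteq> A \<longrightarrow> Q (e 0) (\<lambda>k. e (Suc k)) = sat (inst \<rho> e) f"
    using assms by (rule dfnE)
  note f = f0[rule_format]
  \<comment> \<open>All variables that read the quantified one are collapsed to \<open>0\<close>;
    the others move up by one, so that \<open>0\<close> is free to be bound. In
    \<open>\<sigma>\<close>, \<open>k - 1\<close> undoes this move and \<open>i - 1\<close> removes
    the quantified variable from the assignment.\<close>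
  obtain f' where f': "\<forall>e. sat e f' = sat (\<lambda>k. e (if \<rho> k = Inl 0 then 0 else Suc k)) f"
    using ex_renamed[where r="\<lambda>k. if \<rho> k = Inl 0 then 0 else Suc k"] by blast
  define \<sigma> where "\<sigma> = (\<lambda>k. map_sum (\<lambda>i. i - 1) id (\<rho> (k - 1)))"
  have 1: "(\<lambda>k. ((inst \<sigma> e)(0 := x)) (if \<rho> k = Inl 0 then 0 else Suc k)) = inst \<rho> (case_nat x e)" for e x
    by (rule ext) (auto simp: inst_def \<sigma>_def split: sum.splits nat.splits)
  show ?thesis
  proof (rule dfnI)
    show "c \<in> A" if "\<sigma> k = Inr c" for k c
      using that f(1)[of "k - 1" c] by (cases "\<rho> (k - 1)") (auto simp: \<sigma>_def)
    fix e :: "nat \<Rightarrow> 'a" assume e: "range e \<subseteq> A"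
    have "sat (inst \<sigma> e) (All 0 f') = (\<forall>x\<in>A. sat (inst \<rho> (case_nat x e)) f)"
      using f' 1 by simp
    also have "\<dots> = (\<forall>x\<in>A. Q x e)"
    proof (intro ball_cong refl)
      fix x assume x: "x \<in> A"
      have "case_nat x e k \<in> A" for k using e x by (cases k) auto
      then have "range (case_nat x e) \<subseteq> A" by blast
      from f(2)[OF this] show "sat (inst \<rho> (case_nat x e)) f = Q x e" by simp
    qed
    finally show "(\<forall>x\<in>A. Q x e) = sat (inst \<sigma> e) (All 0 f')" by simp
  qed
qed

lemma dfn_bex [dfn_intros]:
  assumes "dfn (\<lambda>e. Q (e 0) (\<lambda>k. e (Suc k)))"
  shows "dfn (\<lambda>e. \<exists>x\<in>A. Q x e)"
  using dfn_not[OF dfn_ball[where Q="\<lambda>x e. \<not> Q x e", OF dfn_not[OF assms]]] by simp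

lemma dfn_eq_var: "dfn (\<lambda>e. e m = e n)"
  by (rule dfnI[of "Inl" _ "Eq m n"]) (auto simp: inst_def)

lemma dfn_mem_var: "dfn (\<lambda>e. E (e m) (e n))"
  by (rule dfnI[of "Inl" _ "Mem m n"]) (auto simp: inst_def)

text \<open>\<open>Q (t e) e\<close> is equivalent to the existence of an \<open>x\<close> with
  \<open>x = t e\<close> and \<open>Q x e\<close>, and the graph of \<open>t\<close> is
  definable.\<close>

lemma dfn_subst:
  assumes "dfn (\<lambda>e. Q (e 0) (\<lambda>k. e (Suc k)))" "dterm t"
  shows "dfn (\<lambda>e. Q (t e) e)"
proof (rule dfn_cong)
  show "dfn (\<lambda>e. \<exists>x\<in>A. x = t e \<and> Q x e)"
    using assms unfolding dterm_def by (intro dfn_bex dfn_conj) auto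
  show "\<And>e. range e \<subseteq> A \<Longrightarrow> Q (t e) e = (\<exists>x\<in>A. x = t e \<and> Q x e)"
    using assms(2) unfolding dterm_def by auto
qed

lemma dterm_var [dfn_intros]: "dterm (\<lambda>e. e n)"
  unfolding dterm_def by (auto intro: dfn_eq_var)

lemma dterm_const [dfn_intros]: "c \<in> A \<Longrightarrow> dterm (\<lambda>e. c)"
  unfolding dterm_def
  by (auto intro!: dfnI[of "\<lambda>k. if k = 0 then Inl 0 else Inr c" _ "Eq 0 1"] simp: inst_def split: if_splits)

lemma dterm_rename:
  assumes "dterm t"
  shows "dterm (\<lambda>e. t (\<lambda>k. e (r k)))"
  unfolding dterm_def
proof (intro conjI allI impI)
  fix e :: "nat \<Rightarrow> 'a" assume "range e \<subseteq> A"
  then show "t (\<lambda>k. e (r k)) \<in> A" using assms by (auto simp: dterm_def image_subset_iff)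
next
  have "dfn (\<lambda>e. e 0 = t (\<lambda>k. e (Suc k)))" using assms by (simp add: dterm_def)
  from dfn_rename[OF this, of "case_nat 0 (\<lambda>k. Suc (r k))"]
  show "dfn (\<lambda>e. e 0 = t (\<lambda>k. e (Suc (r k))))" by simp
qed

lemma dfn_subst1:
  assumes "dfn (\<lambda>e. Q (e 0))" "dterm a"
  shows "dfn (\<lambda>e. Q (a e))"
  using dfn_subst[of "\<lambda>x e. Q x"] assms by simp

lemma dfn_subst2:
  assumes "dfn (\<lambda>e. Q (e 0) (e 1))" "dterm a" "dterm b"
  shows "dfn (\<lambda>e. Q (a e) (b e))"
proof (rule dfn_subst[OF _ assms(2)])
  show "dfn (\<lambda>e. Q (e 0) (b (\<lambda>k. e (Suc k))))"
    by (rule dfn_subst[OF _ dterm_rename[OF assms(3)]])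
      (use dfn_rename[OF assms(1), of "(\<lambda>k. 0)(0 := 1)"] in simp)
qed

lemma dfn_subst3:
  assumes "dfn (\<lambda>e. Q (e 0) (e 1) (e 2))" "dterm a" "dterm b" "dterm c"
  shows "dfn (\<lambda>e. Q (a e) (b e) (c e))"
proof (rule dfn_subst[OF _ assms(2)])
  \<comment> \<open>Each substitution introduces a new variable \<open>0\<close>, so the three
    arguments appear in reverse order; hence the renaming \<open>\<lambda>k. 2 - k\<close>.\<close>
  have 1: "dfn (\<lambda>e. Q (e 1) (e 0) (c (\<lambda>k. e (Suc (Suc k)))))"
    by (rule dfn_subst[OF _ dterm_rename[OF assms(4)]])
      (use dfn_rename[OF assms(1), of "\<lambda>k. 2 - k"] in \<open>simp add: numeral_2_eq_2\<close>)
  show "dfn (\<lambda>e. Q (e 0) (b (\<lambda>k. e (Suc k))) (c (\<lambda>k. e (Suc k))))"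
    by (rule dfn_subst[OF _ dterm_rename[OF assms(3)]]) (use 1 in simp)
qed

lemma dfn_eq [dfn_intros]: "dterm a \<Longrightarrow> dterm b \<Longrightarrow> dfn (\<lambda>e. a e = b e)"
  by (rule dfn_subst2[where Q="(=)"]) (rule dfn_eq_var)

lemma dfn_mem [dfn_intros]: "dterm a \<Longrightarrow> dterm b \<Longrightarrow> dfn (\<lambda>e. E (a e) (b e))"
  by (rule dfn_subst2[where Q=E]) (rule dfn_mem_var)

lemma dfn_bex1 [dfn_intros]:
  assumes "dfn (\<lambda>e. Q (e 0) (\<lambda>k. e (Suc k)))"
  shows "dfn (\<lambda>e. \<exists>!x. x \<in> A \<and> Q x e)"
proof -
  have *: "(\<exists>!x. x \<in> A \<and> Q x e) \<longleftrightarrow> (\<exists>x\<in>A. Q x e \<and> (\<forall>y\<in>A. Q y e \<longrightarrow> y = x))" for e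
    by blast
  have 2: "dfn (\<lambda>e. Q (e 0) (\<lambda>k. e (Suc (Suc k))))"
    using dfn_rename[OF assms, of "case_nat 0 (\<lambda>k. Suc (Suc k))"] by simp
  show ?thesis
    unfolding * by (intro dfn_intros assms 2)
qed

section \<open>Definability of relations between sets and functions\<close>

lemma dfn_sub [dfn_intros]: "dterm a \<Longrightarrow> dterm b \<Longrightarrow> dfn (\<lambda>e. sub (a e) (b e))"
  by (rule dfn_subst2[where Q=sub]) (unfold sub_def, intro dfn_intros)

lemma dfn_is_upair [dfn_intros]:
  "dterm a \<Longrightarrow> dterm b \<Longrightarrow> dterm c \<Longrightarrow> dfn (\<lambda>e. is_upair (a e) (b e) (c e))"
  by (rule dfn_subst3[where Q=is_upair]) (unfold is_upair_def, intro dfn_intros)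

lemma dfn_is_pair [dfn_intros]:
  "dterm a \<Longrightarrow> dterm b \<Longrightarrow> dterm c \<Longrightarrow> dfn (\<lambda>e. is_pair (a e) (b e) (c e))"
  by (rule dfn_subst3[where Q=is_pair]) (unfold is_pair_def, intro dfn_intros)

lemma dfn_app [dfn_intros]:
  "dterm a \<Longrightarrow> dterm b \<Longrightarrow> dterm c \<Longrightarrow> dfn (\<lambda>e. app (a e) (b e) (c e))"
  by (rule dfn_subst3[where Q=app]) (unfold app_def, intro dfn_intros)

lemma dfn_fun_on [dfn_intros]: "dterm a \<Longrightarrow> dterm b \<Longrightarrow> dfn (\<lambda>e. fun_on (a e) (b e))"
  by (rule dfn_subst2[where Q=fun_on]) (unfold fun_on_def, intro dfn_intros)

lemma dfn_fun_to [dfn_intros]: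
  "dterm a \<Longrightarrow> dterm b \<Longrightarrow> dterm c \<Longrightarrow> dfn (\<lambda>e. fun_to (a e) (b e) (c e))"
  by (rule dfn_subst3[where Q=fun_to]) (unfold fun_to_def, intro dfn_intros)

lemma dfn_increasing [dfn_intros]:
  "dterm a \<Longrightarrow> dterm b \<Longrightarrow> dterm c \<Longrightarrow> dfn (\<lambda>e. increasing (a e) (b e) (c e))"
  by (rule dfn_subst3[where Q=increasing]) (unfold increasing_def, intro dfn_intros)

end

subsection \<open>Set theory in the ground model\<close>

declare UNIV_I [dfn_intros]

locale ground_model = eps UNIV E for E :: "'v \<Rightarrow> 'v \<Rightarrow> bool" (infix "\<epsilon>" 50) +
  assumes wf: "wfp E" and zfc: ZFC
begin

lemma dfn_All [dfn_intros]: "dfn (\<lambda>e. Q (e 0) (\<lambda>k. e (Suc k))) \<Longrightarrow> dfn (\<lambda>e. \<forall>x. Q x e)"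
  using dfn_ball[of Q] by simp

lemma dfn_Ex [dfn_intros]: "dfn (\<lambda>e. Q (e 0) (\<lambda>k. e (Suc k))) \<Longrightarrow> dfn (\<lambda>e. \<exists>x. Q x e)"
  using dfn_bex[of Q] by simp

lemma set_eqI: "(\<And>z. z \<epsilon> x \<longleftrightarrow> z \<epsilon> y) \<Longrightarrow> x = y"
  using zfc by (simp add: ZFC_def extensionality_def)

lemma not_mem_self: "\<not> x \<epsilon> x"
  using wf by (simp add: wfp_def wf_not_refl[to_pred])

lemma mem_asym: "x \<epsilon> y \<Longrightarrow> \<not> y \<epsilon> x"
  using wf by (meson wfp_imp_asymp asympD)

lemma ex_minimal: "Q x \<Longrightarrow> \<exists>y. Q y \<and> (\<forall>z. z \<epsilon> y \<longrightarrow> \<not> Q z)"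
  using wfp_eq_minimal[THEN iffD1, OF wf, rule_format, of x "{x. Q x}"] by blast

section \<open>Separation and Replacement for definable predicates\<close>

lemma ex_Sep:
  assumes "dfn (\<lambda>e. Q (e 0))"
  shows "\<exists>b. \<forall>x. x \<epsilon> b \<longleftrightarrow> x \<epsilon> a \<and> Q x"
proof -
  obtain \<rho> f where f: "\<forall>k c. \<rho> k = Inr c \<longrightarrow> c \<in> UNIV"
    "\<forall>e. range e \<subseteq> UNIV \<longrightarrow> Q (e 0) = sat (inst \<rho> e) f"
    using assms by (rule dfnE)
  \<comment> \<open>The axiom substitutes for variable \<open>0\<close>, which therefore must not
    carry a parameter: parameters go to \<open>Suc k\<close>. Since \<open>Q (e 0)\<close> ignores
    the rest of the assignment, it is evaluated at constant assignments, and every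
    \<open>Inl i\<close> may read variable \<open>0\<close>.\<close>
  define r where "r k = (case \<rho> k of Inl i \<Rightarrow> 0 | Inr c \<Rightarrow> Suc k)" for k
  define e where "e = case_nat a (\<lambda>k. case \<rho> k of Inl i \<Rightarrow> a | Inr c \<Rightarrow> c)"
  obtain f' where f': "\<forall>e. sat e f' = sat (\<lambda>k. e (r k)) f" using ex_renamed[where r=r] by blast
  have 1: "(\<lambda>k. (e(0 := x)) (r k)) = inst \<rho> (\<lambda>_. x)" for x
    by (rule ext) (auto simp: inst_def r_def e_def split: sum.splits)
  have "sat (e(0 := x)) f' = Q x" for x
    using f(2)[rule_format, of "\<lambda>_. x"] f'[rule_format, of "e(0 := x)"] unfolding 1 by simp
  moreover have "\<forall>f e a. \<exists>b. \<forall>x. x \<epsilon> b \<longleftrightarrow> x \<epsilon> a \<and> sat (e(0 := x)) f"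
    using zfc by (simp add: ZFC_def separation_def)
  ultimately show ?thesis by metis
qed

lemma ex_Repl:
  assumes "dfn (\<lambda>e. R (e 0) (e 1))" "\<And>x y y'. x \<epsilon> a \<Longrightarrow> R x y \<Longrightarrow> R x y' \<Longrightarrow> y = y'"
  shows "\<exists>b. \<forall>y. y \<epsilon> b \<longleftrightarrow> (\<exists>x. x \<epsilon> a \<and> R x y)"
proof -
  obtain \<rho> f where f: "\<forall>k c. \<rho> k = Inr c \<longrightarrow> c \<in> UNIV"
    "\<forall>e. range e \<subseteq> UNIV \<longrightarrow> R (e 0) (e 1) = sat (inst \<rho> e) f"
    using assms(1) by (rule dfnE)
  define r where "r k = (case \<rho> k of Inl i \<Rightarrow> if i = 0 then 0 else 1 | Inr c \<Rightarrow> Suc (Suc k))" for k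
  define e where "e = case_nat a (case_nat a (\<lambda>k. case \<rho> k of Inl i \<Rightarrow> a | Inr c \<Rightarrow> c))"
  obtain f' where f': "\<forall>e. sat e f' = sat (\<lambda>k. e (r k)) f" using ex_renamed[where r=r] by blast
  have 1: "(\<lambda>k. (e(0 := x, 1 := y)) (r k)) = inst \<rho> (\<lambda>i. if i = 0 then x else y)" for x y
    by (rule ext) (auto simp: inst_def r_def e_def split: sum.splits)
  have 2: "sat (e(0 := x, 1 := y)) f' = R x y" for x y
    using f(2)[rule_format, of "\<lambda>i. if i = 0 then x else y"] f'[rule_format, of "e(0 := x, 1 := y)"]
    unfolding 1 by simp
  have "\<forall>x y y'. x \<epsilon> a \<and> sat (e(0 := x, 1 := y)) f' \<and> sat (e(0 := x, 1 := y')) f' \<longrightarrow> y = y'"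
    unfolding 2 using assms(2) by blast
  then have "\<exists>b. \<forall>y. y \<epsilon> b \<longleftrightarrow> (\<exists>x. x \<epsilon> a \<and> sat (e(0 := x, 1 := y)) f')"
    using zfc unfolding ZFC_def replacement_def by simp
  then show ?thesis unfolding 2 .
qed

definition Sep :: "'v \<Rightarrow> ('v \<Rightarrow> bool) \<Rightarrow> 'v" where
  "Sep a Q = (THE b. \<forall>x. x \<epsilon> b \<longleftrightarrow> x \<epsilon> a \<and> Q x)"

lemma mem_Sep:
  assumes "dfn (\<lambda>e. Q (e 0))"
  shows "x \<epsilon> Sep a Q \<longleftrightarrow> x \<epsilon> a \<and> Q x"
proof -
  have "\<exists>!b. \<forall>x. x \<epsilon> b \<longleftrightarrow> x \<epsilon> a \<and> Q x"
    using ex_Sep[OF assms, of a] by (auto intro!: set_eqI)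
  from theI'[OF this] show ?thesis unfolding Sep_def by blast
qed

section \<open>Pairs, unions, power sets and products\<close>

definition pair :: "'v \<Rightarrow> 'v \<Rightarrow> 'v" where
  "pair x y = (THE z. is_pair z x y)"

lemma ex_upair: "\<exists>z. is_upair z x y"
  using zfc by (simp add: ZFC_def pairing_def)

lemma is_upair_unique: "is_upair z x y \<Longrightarrow> is_upair z' x y \<Longrightarrow> z = z'"
  by (rule set_eqI) (simp add: is_upair_def)

lemma is_pair_unique: "is_pair z x y \<Longrightarrow> is_pair z' x y \<Longrightarrow> z = z'"
  unfolding is_pair_def by (metis is_upair_unique)

lemma is_pair_iff: "is_pair z x y \<longleftrightarrow> z = pair x y"
proof -
  have "\<exists>z. is_pair z x y"
    unfolding is_pair_def using ex_upair by blast
  then have "is_pair (pair x y) x y"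
    unfolding pair_def using is_pair_unique by (metis theI')
  then show ?thesis using is_pair_unique by blast
qed

lemma pair_inject [simp]: "pair x y = pair x' y' \<longleftrightarrow> x = x' \<and> y = y'"
proof
  assume eq: "pair x y = pair x' y'"
  obtain u v where u: "is_upair u x x" "is_upair v x y" "is_upair (pair x y) u v"
    using is_pair_iff[of "pair x y" x y] by (auto simp: is_pair_def)
  obtain u' v' where u': "is_upair u' x' x'" "is_upair v' x' y'" "is_upair (pair x y) u' v'"
    using is_pair_iff[of "pair x y" x' y'] eq by (auto simp: is_pair_def)
  have "(w = u \<or> w = v) = (w = u' \<or> w = v')" for w
    using u(3) u'(3) by (simp add: is_upair_def)
  then have w: "u = u' \<and> v = v' \<or> u = v' \<and> v = u'" by metis
  then have "x = x'"
    using u u' unfolding is_upair_def by (metis UNIV_I)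
  moreover have "y = y'"
    using w u u' \<open>x = x'\<close> unfolding is_upair_def by (metis UNIV_I)
  ultimately show "x = x' \<and> y = y'" ..
qed simp

lemma mem_mem_pair: "\<exists>u. x \<epsilon> u \<and> y \<epsilon> u \<and> u \<epsilon> pair x y"
proof -
  have "is_pair (pair x y) x y" by (simp add: is_pair_iff)
  then obtain u v where "is_upair v x y" "is_upair (pair x y) u v" unfolding is_pair_def by blast
  then have "x \<epsilon> v" "y \<epsilon> v" "v \<epsilon> pair x y" by (simp_all add: is_upair_def)
  then show ?thesis by blast
qed

lemma dterm_pair [dfn_intros]:
  assumes "dterm a" "dterm b"
  shows "dterm (\<lambda>e. pair (a e) (b e))"
proof -
  have "dfn (\<lambda>e. is_pair (e 0) (a (\<lambda>k. e (Suc k))) (b (\<lambda>k. e (Suc k))))"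
    by (rule dfn_is_pair) (rule dterm_var dterm_rename[OF assms(1), of Suc] dterm_rename[OF assms(2), of Suc])+
  then show ?thesis unfolding dterm_def is_pair_iff by simp
qed

lemma app_iff: "app f x y \<longleftrightarrow> pair x y \<epsilon> f"
  by (simp add: app_def is_pair_iff)

lemma ex_Union: "\<exists>u. \<forall>z. z \<epsilon> u \<longleftrightarrow> (\<exists>y. y \<epsilon> x \<and> z \<epsilon> y)"
  using zfc by (simp add: ZFC_def union_def)

lemma ex_Un: "\<exists>u. \<forall>z. z \<epsilon> u \<longleftrightarrow> z \<epsilon> x \<or> z \<epsilon> y"
proof -
  obtain p where "is_upair p x y" using ex_upair by blast
  then have p: "w \<epsilon> p \<longleftrightarrow> w = x \<or> w = y" for w by (simp add: is_upair_def)
  obtain u where "\<forall>z. z \<epsilon> u \<longleftrightarrow> (\<exists>y. y \<epsilon> p \<and> z \<epsilon> y)" using ex_Union by blast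
  then have "\<forall>z. z \<epsilon> u \<longleftrightarrow> z \<epsilon> x \<or> z \<epsilon> y" unfolding p by blast
  then show ?thesis ..
qed

lemma ex_insert: "\<exists>u. \<forall>z. z \<epsilon> u \<longleftrightarrow> z \<epsilon> x \<or> z = y"
proof -
  obtain p where "is_upair p y y" using ex_upair by blast
  then have p: "w \<epsilon> p \<longleftrightarrow> w = y" for w by (simp add: is_upair_def)
  from ex_Un[of x p] show ?thesis unfolding p .
qed

definition pow :: "'v \<Rightarrow> 'v" where
  "pow a = (THE b. \<forall>x. x \<epsilon> b \<longleftrightarrow> sub x a)"

lemma mem_pow: "x \<epsilon> pow a \<longleftrightarrow> sub x a"
proof -
  have "\<exists>b. \<forall>x. x \<epsilon> b \<longleftrightarrow> sub x a"
    using zfc by (simp add: ZFC_def power_set_def is_power_def)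
  then have "\<exists>!b. \<forall>x. x \<epsilon> b \<longleftrightarrow> sub x a"
    by (auto intro!: set_eqI)
  from theI'[OF this] show ?thesis unfolding pow_def by blast
qed

definition prod :: "'v \<Rightarrow> 'v \<Rightarrow> 'v" where
  "prod a b = (THE c. \<forall>z. z \<epsilon> c \<longleftrightarrow> (\<exists>x y. x \<epsilon> a \<and> y \<epsilon> b \<and> z = pair x y))"

lemma mem_prod: "z \<epsilon> prod a b \<longleftrightarrow> (\<exists>x y. x \<epsilon> a \<and> y \<epsilon> b \<and> z = pair x y)"
proof -
  obtain u where u: "\<And>z. z \<epsilon> u \<longleftrightarrow> z \<epsilon> a \<or> z \<epsilon> b" using ex_Un[of a b] by blast
  have "pair x y \<epsilon> pow (pow u)" if "x \<epsilon> a" "y \<epsilon> b" for x y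
  proof -
    have "is_pair (pair x y) x y" by (simp add: is_pair_iff)
    then obtain v w where v: "is_upair v x x" "is_upair w x y" "is_upair (pair x y) v w"
      unfolding is_pair_def by blast
    then have "sub v u" "sub w u" using that u by (simp_all add: is_upair_def sub_def)
    then show ?thesis using v(3) by (simp add: mem_pow is_upair_def sub_def[of "pair x y"])
  qed
  moreover have "dfn (\<lambda>e. \<exists>x y. x \<epsilon> a \<and> y \<epsilon> b \<and> e 0 = pair x y)"
    by (intro dfn_intros)
  note mem_Sep[OF this, of _ "pow (pow u)"]
  ultimately have "\<exists>c. \<forall>z. z \<epsilon> c \<longleftrightarrow> (\<exists>x y. x \<epsilon> a \<and> y \<epsilon> b \<and> z = pair x y)"
    by blast
  then have "\<exists>!c. \<forall>z. z \<epsilon> c \<longleftrightarrow> (\<exists>x y. x \<epsilon> a \<and> y \<epsilon> b \<and> z = pair x y)"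
    by (auto intro!: set_eqI)
  from theI'[OF this] show ?thesis unfolding prod_def by blast
qed

lemma pair_mem_prod [simp]: "pair x y \<epsilon> prod a b \<longleftrightarrow> x \<epsilon> a \<and> y \<epsilon> b"
  by (auto simp: mem_prod)

section \<open>Transitive closures\<close>

definition transitive :: "'v \<Rightarrow> bool" where
  "transitive t \<longleftrightarrow> (\<forall>y z. y \<epsilon> t \<and> z \<epsilon> y \<longrightarrow> z \<epsilon> t)"

definition is_closure :: "'v \<Rightarrow> 'v \<Rightarrow> bool" where
  "is_closure t x \<longleftrightarrow> transitive t \<and> sub x t \<and> (\<forall>w. transitive w \<and> sub x w \<longrightarrow> sub t w)"

lemma dfn_transitive [dfn_intros]: "dterm a \<Longrightarrow> dfn (\<lambda>e. transitive (a e))"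
  by (rule dfn_subst1[where Q=transitive]) (unfold transitive_def, intro dfn_intros)

text \<open>By \<in>-induction: the closures of the elements of \<open>x\<close>, collected by
  Replacement and joined with \<open>x\<close>, form a transitive set. Replacement needs a
  functional relation, which is why \<open>is_closure\<close> demands the least transitive
  superset.\<close>

lemma ex_closure: "\<exists>t. is_closure t x"
  using wf
proof (induction x rule: wfp_induct_rule)
  case (less x)
  have "dfn (\<lambda>e. is_closure (e 1) (e 0))"
    unfolding is_closure_def by (intro dfn_intros)
  moreover have "t = t'" if "is_closure t y" "is_closure t' y" for y t t'
  proof (rule set_eqI)
    have "sub t t'" "sub t' t" using that by (simp_all add: is_closure_def)
    then show "z \<epsilon> t \<longleftrightarrow> z \<epsilon> t'" for z by (auto simp: sub_def)
  qed
  ultimately have "\<exists>b. \<forall>t. t \<epsilon> b \<longleftrightarrow> (\<exists>y. y \<epsilon> x \<and> is_closure t y)"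
    by (rule ex_Repl[of "\<lambda>y t. is_closure t y" x])
  then obtain b where b: "\<And>t. t \<epsilon> b \<longleftrightarrow> (\<exists>y. y \<epsilon> x \<and> is_closure t y)" by blast
  obtain b' where b': "\<And>z. z \<epsilon> b' \<longleftrightarrow> (\<exists>t. t \<epsilon> b \<and> z \<epsilon> t)" using ex_Union[of b] by blast
  obtain u where u: "\<And>z. z \<epsilon> u \<longleftrightarrow> z \<epsilon> x \<or> z \<epsilon> b'" using ex_Un[of x b'] by blast
  have 1: "z \<epsilon> u" if "y \<epsilon> u" "z \<epsilon> y" for y z
  proof -
    have "y \<epsilon> x \<or> y \<epsilon> b'" using that(1) unfolding u .
    then consider "y \<epsilon> x" | "y \<epsilon> b'" by blast
    then have "\<exists>t. t \<epsilon> b \<and> z \<epsilon> t"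
    proof cases
      case 1
      obtain t where t: "is_closure t y" using less[OF 1] by blast
      then have "sub y t" unfolding is_closure_def by blast
      then have "z \<epsilon> t" using that(2) unfolding sub_def by blast
      moreover have "t \<epsilon> b" unfolding b using 1 t by blast
      ultimately show ?thesis by blast
    next
      case 2
      then obtain t where t: "t \<epsilon> b" "y \<epsilon> t" unfolding b' by blast
      moreover obtain v where "is_closure t v" using t(1) unfolding b by blast
      ultimately have "z \<epsilon> t" using that(2) unfolding is_closure_def transitive_def by blast
      then show ?thesis using t by blast
    qed
    then show ?thesis unfolding u b' by blast
  qed
  have 2: "sub u w" if "transitive w" "sub x w" for w
  proof -
    have t: "sub t w" if tb: "t \<epsilon> b" for t
    proof -
      obtain y where "y \<epsilon> x" "is_closure t y" using tb unfolding b by blast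
      moreover from this have "sub y w" using \<open>transitive w\<close> \<open>sub x w\<close>
        unfolding transitive_def sub_def by blast
      ultimately show ?thesis using \<open>transitive w\<close> by (simp add: is_closure_def)
    qed
    show ?thesis unfolding sub_def
    proof (intro ballI impI)
      fix z assume "z \<epsilon> u"
      then have "z \<epsilon> x \<or> (\<exists>t. t \<epsilon> b \<and> z \<epsilon> t)" unfolding u b' .
      then consider "z \<epsilon> x" | t where "t \<epsilon> b" "z \<epsilon> t" by blast
      then show "z \<epsilon> w"
      proof cases
        case 1
        then show ?thesis using that(2) by (simp add: sub_def)
      next
        case (2 v)
        then show ?thesis using t[of v] by (simp add: sub_def)
      qed
    qed
  qed
  have "sub x u" using u by (simp add: sub_def)
  moreover have "transitive u" unfolding transitive_def using 1 by blast
  ultimately have "is_closure u x" using 2 by (simp add: is_closure_def)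
  then show ?case ..
qed

lemma ex_transitive: "\<exists>t. transitive t \<and> sub x t"
  using ex_closure[of x] by (auto simp: is_closure_def)

lemma transitive_pairD:
  assumes "transitive t" "s \<epsilon> t" "pair x y \<epsilon> s"
  shows "x \<epsilon> t" "y \<epsilon> t"
  using assms mem_mem_pair[of x y] unfolding transitive_def by blast+

lemma pair_mem_tranclp:
  assumes "pair x y \<epsilon> s"
  shows "E\<^sup>+\<^sup>+ x s" "E\<^sup>+\<^sup>+ y s"
  using assms mem_mem_pair[of x y] by (meson tranclp.r_into_trancl tranclp.trancl_into_trancl)+

section \<open>Ordinals\<close>

lemma ordinal_transitive: "ordinal x \<Longrightarrow> z \<epsilon> y \<Longrightarrow> y \<epsilon> x \<Longrightarrow> z \<epsilon> x"
  by (auto simp: ordinal_def sub_def)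

lemma ordinal_linear: "ordinal x \<Longrightarrow> y \<epsilon> x \<Longrightarrow> z \<epsilon> x \<Longrightarrow> y \<epsilon> z \<or> y = z \<or> z \<epsilon> y"
  by (simp add: ordinal_def)

lemma mem_no_3cycle: "x \<epsilon> y \<Longrightarrow> y \<epsilon> z \<Longrightarrow> \<not> z \<epsilon> x"
proof
  assume "x \<epsilon> y" "y \<epsilon> z" "z \<epsilon> x"
  then have "E\<^sup>+\<^sup>+ x x" by (meson tranclp.r_into_trancl tranclp.trancl_into_trancl)
  moreover have "wfp (E\<^sup>+\<^sup>+)" using wf by (simp add: wfp_tranclp)
  ultimately show False by (meson wfp_imp_asymp asympD)
qed

lemma ordinal_mem:
  assumes "ordinal x" "y \<epsilon> x"
  shows "ordinal y"
  unfolding ordinal_def sub_def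
proof (intro conjI ballI impI)
  fix z w assume "z \<epsilon> y" "w \<epsilon> z"
  moreover from this have "w \<epsilon> x" using assms ordinal_transitive by metis
  ultimately show "w \<epsilon> y"
    using ordinal_linear[OF assms(1) assms(2)] mem_no_3cycle mem_asym by metis
next
  fix z w assume "z \<epsilon> y \<and> w \<epsilon> y"
  then show "z \<epsilon> w \<or> z = w \<or> w \<epsilon> z"
    using ordinal_linear[OF assms(1)] ordinal_transitive[OF assms(1) _ assms(2)] by blast
qed

end

subsection \<open>The ultrapower below its critical point\<close>

context ground_model begin

definition ap :: "'v \<Rightarrow> 'v \<Rightarrow> 'v" where
  "ap f i = (THE y. app f i y)"

lemma app_ap:
  assumes "fun_on f x" "i \<epsilon> x"
  shows "app f i y \<longleftrightarrow> y = ap f i"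
proof -
  have "\<exists>!y. app f i y" using assms by (simp add: fun_on_def)
  then show ?thesis unfolding ap_def by (metis theI')
qed

lemma fun_onI:
  assumes "\<And>z. z \<epsilon> f \<Longrightarrow> \<exists>a b. a \<epsilon> x \<and> z = pair a b" "\<And>a. a \<epsilon> x \<Longrightarrow> \<exists>!b. pair a b \<epsilon> f"
  shows "fun_on f x"
  unfolding fun_on_def is_pair_iff app_iff using assms by simp

text \<open>\<open>const_fun\<close> is a definite description, so it has its intended value only
  once \<open>I \<times> {x}\<close> is seen to be a set of the model and the only function of this
  kind.\<close>

lemma const_fun:
  shows fun_on_const_fun: "fun_on (const_fun I x) I"
    and app_const_fun: "i \<epsilon> I \<Longrightarrow> app (const_fun I x) i x"
proof -
  obtain s where s: "\<forall>z. z \<epsilon> s \<longleftrightarrow> (\<exists>y. is_upair y x x \<and> z \<epsilon> y)"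
    using ex_upair[of x x] is_upair_unique by blast
  then have s: "z \<epsilon> s \<longleftrightarrow> z = x" for z
    using ex_upair[of x x] by (auto simp: is_upair_def)
  let ?c = "prod I s"
  have c: "fun_on ?c I" "\<forall>i. i \<epsilon> I \<longrightarrow> app ?c i x"
  proof (rule fun_onI)
    show "\<exists>a b. a \<epsilon> I \<and> z = pair a b" if "z \<epsilon> ?c" for z
      using that unfolding mem_prod by blast
  qed (simp_all add: app_iff s)
  have u: "c' = ?c" if c': "fun_on c' I" "\<forall>i. i \<epsilon> I \<longrightarrow> app c' i x" for c'
  proof (rule set_eqI)
    fix z
    have "z \<epsilon> c' \<longleftrightarrow> (\<exists>i. i \<epsilon> I \<and> z = pair i x)"
    proof
      assume z: "z \<epsilon> c'"
      then obtain i y where iy: "i \<epsilon> I" "z = pair i y"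
        using c'(1) unfolding fun_on_def is_pair_iff by blast
      then have "app c' i y" "app c' i x" using z c'(2) by (simp_all add: app_iff)
      then have "y = x" using app_ap[OF c'(1) iy(1)] by simp
      then show "\<exists>i. i \<epsilon> I \<and> z = pair i x" using iy by blast
    next
      assume "\<exists>i. i \<epsilon> I \<and> z = pair i x"
      then show "z \<epsilon> c'" using c'(2) unfolding app_iff by blast
    qed
    then show "z \<epsilon> c' \<longleftrightarrow> z \<epsilon> ?c" by (simp add: mem_prod s)
  qed
  have "\<exists>!c. c \<in> UNIV \<and> fun_on c I \<and> (\<forall>i\<in>UNIV. i \<epsilon> I \<longrightarrow> app c i x)"
  proof (rule ex1I[of _ ?c])
    show "?c \<in> UNIV \<and> fun_on ?c I \<and> (\<forall>i\<in>UNIV. i \<epsilon> I \<longrightarrow> app ?c i x)" using c by blast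
    show "c' = ?c" if "c' \<in> UNIV \<and> fun_on c' I \<and> (\<forall>i\<in>UNIV. i \<epsilon> I \<longrightarrow> app c' i x)" for c'
      by (rule u) (use that in blast)+
  qed
  note * = theI'[OF this, folded const_fun_def]
  from * show "fun_on (const_fun I x) I" by blast
  from * show "i \<epsilon> I \<Longrightarrow> app (const_fun I x) i x" by blast
qed

lemma ap_const_fun: "i \<epsilon> I \<Longrightarrow> ap (const_fun I x) i = x"
  using app_ap[OF fun_on_const_fun] app_const_fun by metis

end

section \<open>Quantification over almost all indices\<close>

locale ground_ultrafilter = ground_model +
  fixes U I :: 'a
  assumes ultra: "ultrafilter U I"
begin

lemma U_nonempty: "X \<epsilon> U \<Longrightarrow> \<exists>i. i \<epsilon> X"
  using ultra[unfolded ultrafilter_def, THEN conjunct2, THEN conjunct2, THEN conjunct1] unfolding is_empty_def by blast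

lemma U_Int: "X \<epsilon> U \<Longrightarrow> Y \<epsilon> U \<Longrightarrow> \<exists>Z. Z \<epsilon> U \<and> (\<forall>i. i \<epsilon> Z \<longleftrightarrow> i \<epsilon> X \<and> i \<epsilon> Y)"
  using ultra[unfolded ultrafilter_def, THEN conjunct2, THEN conjunct2, THEN conjunct2, THEN conjunct1] by simp

lemma U_upward: "X \<epsilon> U \<Longrightarrow> sub X Y \<Longrightarrow> sub Y I \<Longrightarrow> Y \<epsilon> U"
  using ultra[unfolded ultrafilter_def, THEN conjunct2, THEN conjunct2, THEN conjunct2, THEN conjunct2, THEN conjunct1] by blast

lemma U_Compl: "sub X I \<Longrightarrow> \<not> X \<epsilon> U \<Longrightarrow> \<exists>Y. Y \<epsilon> U \<and> (\<forall>i. i \<epsilon> Y \<longleftrightarrow> i \<epsilon> I \<and> \<not> i \<epsilon> X)"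
  using ultra[unfolded ultrafilter_def, THEN conjunct2, THEN conjunct2, THEN conjunct2, THEN conjunct2, THEN conjunct2, rule_format, of X] by simp

text \<open>No definability is asked of \<open>\<phi>\<close>: some set in \<open>U\<close> must lie
  inside the possibly undefinable collection of all \<open>i\<close> with \<open>\<phi> i\<close>.
  For this reason \<open>\<phi>\<close> may speak about a set of the extension, and
  \<open>ae\<close> can express membership in the generated filter. The price is that
  \<open>ae_not\<close> and \<open>ae_disj\<close> carry a definability hypothesis.\<close>

definition ae :: "('a \<Rightarrow> bool) \<Rightarrow> bool" where
  "ae \<phi> \<longleftrightarrow> (\<exists>X. X \<epsilon> U \<and> (\<forall>i. i \<epsilon> X \<longrightarrow> i \<epsilon> I \<and> \<phi> i))"

lemma ae_mono: "ae \<phi> \<Longrightarrow> (\<And>i. i \<epsilon> I \<Longrightarrow> \<phi> i \<Longrightarrow> \<psi> i) \<Longrightarrow> ae \<psi>"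
  unfolding ae_def by blast

lemma ae_cong: "(\<And>i. i \<epsilon> I \<Longrightarrow> \<phi> i \<longleftrightarrow> \<psi> i) \<Longrightarrow> ae \<phi> \<longleftrightarrow> ae \<psi>"
  unfolding ae_def by blast

lemma ae_conj:
  assumes "ae \<phi>" "ae \<psi>"
  shows "ae (\<lambda>i. \<phi> i \<and> \<psi> i)"
proof -
  obtain X where X: "X \<epsilon> U" "\<forall>i. i \<epsilon> X \<longrightarrow> i \<epsilon> I \<and> \<phi> i" using assms(1) unfolding ae_def by blast
  obtain Y where Y: "Y \<epsilon> U" "\<forall>i. i \<epsilon> Y \<longrightarrow> i \<epsilon> I \<and> \<psi> i" using assms(2) unfolding ae_def by blast
  obtain Z where Z: "Z \<epsilon> U" "\<forall>i. i \<epsilon> Z \<longleftrightarrow> i \<epsilon> X \<and> i \<epsilon> Y" using U_Int[OF X(1) Y(1)] by blast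
  then have "\<forall>i. i \<epsilon> Z \<longrightarrow> i \<epsilon> I \<and> \<phi> i \<and> \<psi> i" using X(2) Y(2) by simp
  then show ?thesis using Z(1) unfolding ae_def by blast
qed

lemma ae_ex:
  assumes "ae \<phi>"
  shows "\<exists>i. i \<epsilon> I \<and> \<phi> i"
proof -
  obtain X where X: "X \<epsilon> U" "\<forall>i. i \<epsilon> X \<longrightarrow> i \<epsilon> I \<and> \<phi> i" using assms unfolding ae_def by blast
  then show ?thesis using U_nonempty[OF X(1)] by blast
qed

lemma mem_U_iff:
  assumes "\<forall>i. i \<epsilon> X \<longleftrightarrow> i \<epsilon> I \<and> \<phi> i"
  shows "X \<epsilon> U \<longleftrightarrow> ae \<phi>"
proof
  assume "ae \<phi>"
  then obtain Y where Y: "Y \<epsilon> U" "\<forall>i. i \<epsilon> Y \<longrightarrow> i \<epsilon> I \<and> \<phi> i" unfolding ae_def by blast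
  then have "sub Y X" "sub X I" using assms by (simp_all add: sub_def)
  then show "X \<epsilon> U" using Y(1) U_upward by blast
next
  assume "X \<epsilon> U"
  then show "ae \<phi>" using assms unfolding ae_def by blast
qed

lemma ae_True: "ae (\<lambda>_. True)"
  using mem_U_iff[of I] ultra by (simp add: ultrafilter_def)

lemma ae_not:
  assumes "dfn (\<lambda>e. \<phi> (e 0))" "\<not> ae \<phi>"
  shows "ae (\<lambda>i. \<not> \<phi> i)"
proof -
  have X: "\<forall>i. i \<epsilon> Sep I \<phi> \<longleftrightarrow> i \<epsilon> I \<and> \<phi> i" using mem_Sep[OF assms(1)] by blast
  then have "\<not> Sep I \<phi> \<epsilon> U" using assms(2) mem_U_iff[OF X] by simp
  moreover have "sub (Sep I \<phi>) I" using X by (simp add: sub_def)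
  ultimately obtain Y where "Y \<epsilon> U" and Y: "\<forall>i. i \<epsilon> Y \<longleftrightarrow> i \<epsilon> I \<and> \<not> i \<epsilon> Sep I \<phi>"
    using U_Compl by blast
  have Y': "\<forall>i. i \<epsilon> Y \<longleftrightarrow> i \<epsilon> I \<and> \<not> \<phi> i" using X Y by (simp, blast)
  show ?thesis using mem_U_iff[OF Y'] \<open>Y \<epsilon> U\<close> by simp
qed

text \<open>Definability of one disjunct suffices: if it fails to hold almost everywhere, its
  negation holds almost everywhere and leaves the other disjunct.\<close>

lemma ae_disj:
  assumes "dfn (\<lambda>e. \<phi> (e 0))" "ae (\<lambda>i. \<phi> i \<or> \<psi> i)"
  shows "ae \<phi> \<or> ae \<psi>"
proof (rule disjCI)
  assume "\<not> ae \<psi>"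
  show "ae \<phi>"
  proof (rule ccontr)
    assume "\<not> ae \<phi>"
    from ae_conj[OF ae_not[OF assms(1) this] assms(2)] have "ae \<psi>" by (rule ae_mono) blast
    with \<open>\<not> ae \<psi>\<close> show False by blast
  qed
qed

section \<open>Equality and membership in the ultrapower\<close>

lemma ult_eq_iff:
  assumes "fun_on f I" "fun_on g I"
  shows "ult_eq U I f g \<longleftrightarrow> ae (\<lambda>i. ap f i = ap g i)"
proof -
  let ?\<phi> = "\<lambda>i. \<exists>x. app f i x \<and> app g i x"
  have "dfn (\<lambda>e. ?\<phi> (e 0))" by (intro dfn_intros)
  note X = mem_Sep[OF this, of _ I]
  have "ult_eq U I f g \<longleftrightarrow> ae ?\<phi>"
  proof
    assume "ult_eq U I f g"
    then obtain X where "X \<epsilon> U" and X': "\<forall>i. i \<epsilon> X \<longleftrightarrow> i \<epsilon> I \<and> ?\<phi> i"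
      unfolding ult_eq_def by (simp only: ball_UNIV bex_UNIV) blast
    then show "ae ?\<phi>" using mem_U_iff[OF X'] by blast
  next
    assume "ae ?\<phi>"
    moreover have X': "\<forall>i. i \<epsilon> Sep I ?\<phi> \<longleftrightarrow> i \<epsilon> I \<and> ?\<phi> i" using X by blast
    ultimately have "Sep I ?\<phi> \<epsilon> U" using mem_U_iff[OF X'] by blast
    then show "ult_eq U I f g" unfolding ult_eq_def ball_UNIV bex_UNIV using X' by blast
  qed
  also have "\<dots> \<longleftrightarrow> ae (\<lambda>i. ap f i = ap g i)"
    by (rule ae_cong) (use app_ap[OF assms(1)] app_ap[OF assms(2)] in auto)
  finally show ?thesis .
qed

lemma ult_mem_iff:
  assumes "fun_on f I" "fun_on g I"
  shows "ult_mem U I f g \<longleftrightarrow> ae (\<lambda>i. ap f i \<epsilon> ap g i)"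
proof -
  let ?\<phi> = "\<lambda>i. \<exists>x y. app f i x \<and> app g i y \<and> x \<epsilon> y"
  have "dfn (\<lambda>e. ?\<phi> (e 0))" by (intro dfn_intros)
  note X = mem_Sep[OF this, of _ I]
  have "ult_mem U I f g \<longleftrightarrow> ae ?\<phi>"
  proof
    assume "ult_mem U I f g"
    then obtain X where "X \<epsilon> U" and X': "\<forall>i. i \<epsilon> X \<longleftrightarrow> i \<epsilon> I \<and> ?\<phi> i"
      unfolding ult_mem_def by (simp only: ball_UNIV bex_UNIV) blast
    then show "ae ?\<phi>" using mem_U_iff[OF X'] by blast
  next
    assume "ae ?\<phi>"
    moreover have X': "\<forall>i. i \<epsilon> Sep I ?\<phi> \<longleftrightarrow> i \<epsilon> I \<and> ?\<phi> i" using X by blast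
    ultimately have "Sep I ?\<phi> \<epsilon> U" using mem_U_iff[OF X'] by blast
    then show "ult_mem U I f g" unfolding ult_mem_def ball_UNIV bex_UNIV using X' by blast
  qed
  also have "\<dots> \<longleftrightarrow> ae (\<lambda>i. ap f i \<epsilon> ap g i)"
    by (rule ae_cong) (use app_ap[OF assms(1)] app_ap[OF assms(2)] in auto)
  finally show ?thesis .
qed

lemma mem_ult_class: "fun_on f I \<Longrightarrow> g \<in> ult_class U I f \<longleftrightarrow> fun_on g I \<and> ae (\<lambda>i. ap f i = ap g i)"
  unfolding ult_class_def using ult_eq_iff by auto

lemma ult_class_eq_iff:
  assumes "fun_on f I" "fun_on g I"
  shows "ult_class U I f = ult_class U I g \<longleftrightarrow> ae (\<lambda>i. ap f i = ap g i)"
proof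
  have "ae (\<lambda>i. ap g i = ap g i)" by (rule ae_mono[OF ae_True]) simp
  then have "g \<in> ult_class U I g" using mem_ult_class assms by blast
  moreover assume "ult_class U I f = ult_class U I g"
  ultimately show "ae (\<lambda>i. ap f i = ap g i)" using mem_ult_class assms by blast
next
  assume fg: "ae (\<lambda>i. ap f i = ap g i)"
  have "ae (\<lambda>i. ap f i = ap h i) \<longleftrightarrow> ae (\<lambda>i. ap g i = ap h i)" for h
  proof
    assume "ae (\<lambda>i. ap f i = ap h i)"
    from ae_conj[OF this fg] show "ae (\<lambda>i. ap g i = ap h i)" by (rule ae_mono) metis
  next
    assume "ae (\<lambda>i. ap g i = ap h i)"
    from ae_conj[OF this fg] show "ae (\<lambda>i. ap f i = ap h i)" by (rule ae_mono) metis
  qed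
  then show "ult_class U I f = ult_class U I g"
    using mem_ult_class[OF assms(1)] mem_ult_class[OF assms(2)] by blast
qed

lemma Ult_mem_iff:
  assumes f: "fun_on f I" and g: "fun_on g I"
  shows "Ult_mem U I (ult_class U I f) (ult_class U I g) \<longleftrightarrow> ae (\<lambda>i. ap f i \<epsilon> ap g i)"
proof
  assume "Ult_mem U I (ult_class U I f) (ult_class U I g)"
  then obtain f' where f': "f' \<in> ult_class U I f" and "\<exists>g'\<in>ult_class U I g. ult_mem U I f' g'"
    unfolding Ult_mem_def by (rule bexE)
  from this(2) obtain g' where g': "g' \<in> ult_class U I g" and mem: "ult_mem U I f' g'" by (rule bexE)
  have f'': "fun_on f' I" "ae (\<lambda>i. ap f i = ap f' i)" using f' unfolding mem_ult_class[OF f] by simp_all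
  have g'': "fun_on g' I" "ae (\<lambda>i. ap g i = ap g' i)" using g' unfolding mem_ult_class[OF g] by simp_all
  have "ae (\<lambda>i. ap f' i \<epsilon> ap g' i)" using mem unfolding ult_mem_iff[OF f''(1) g''(1)] .
  from ae_conj[OF ae_conj[OF f''(2) g''(2)] this]
   show "ae (\<lambda>i. ap f i \<epsilon> ap g i)" by (rule ae_mono) simp
next
  have refl: "h \<in> ult_class U I h" if "fun_on h I" for h
  proof -
    have "ae (\<lambda>i. ap h i = ap h i)" by (rule ae_mono[OF ae_True]) simp
    then show ?thesis unfolding mem_ult_class[OF that] using that by simp
  qed
  assume "ae (\<lambda>i. ap f i \<epsilon> ap g i)"
  then have "ult_mem U I f g" unfolding ult_mem_iff[OF f g] .
  then show "Ult_mem U I (ult_class U I f) (ult_class U I g)"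
    unfolding Ult_mem_def using refl[OF f] refl[OF g] by blast
qed

lemma j_eq_iff: "fun_on f I \<Longrightarrow> ult_class U I f = j U I b \<longleftrightarrow> ae (\<lambda>i. ap f i = b)"
  unfolding j_def by (subst ult_class_eq_iff[OF _ fun_on_const_fun], assumption) (rule ae_cong, simp add: ap_const_fun)

lemma Ult_mem_j_iff: "fun_on f I \<Longrightarrow> Ult_mem U I (ult_class U I f) (j U I b) \<longleftrightarrow> ae (\<lambda>i. ap f i \<epsilon> b)"
  unfolding j_def by (subst Ult_mem_iff[OF _ fun_on_const_fun], assumption) (rule ae_cong, simp add: ap_const_fun)

lemma j_Ult_mem_iff: "fun_on f I \<Longrightarrow> Ult_mem U I (j U I b) (ult_class U I f) \<longleftrightarrow> ae (\<lambda>i. b \<epsilon> ap f i)"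
  unfolding j_def by (subst Ult_mem_iff[OF fun_on_const_fun], assumption) (rule ae_cong, simp add: ap_const_fun)

lemma ae_const: "ae (\<lambda>i. p) \<longleftrightarrow> p"
  using ae_ex ae_True by (cases p) auto

lemma j_inject: "j U I a = j U I b \<longleftrightarrow> a = b"
proof -
  have "j U I a = j U I b \<longleftrightarrow> ae (\<lambda>i. ap (const_fun I a) i = b)"
    using j_eq_iff[OF fun_on_const_fun, of a b] unfolding j_def .
  also have "\<dots> \<longleftrightarrow> ae (\<lambda>i. a = b)" by (rule ae_cong) (simp add: ap_const_fun)
  finally show ?thesis by (simp add: ae_const)
qed

lemma j_mem_j: "Ult_mem U I (j U I a) (j U I b) \<longleftrightarrow> a \<epsilon> b"
proof -
  have "Ult_mem U I (j U I a) (j U I b) \<longleftrightarrow> ae (\<lambda>i. ap (const_fun I a) i \<epsilon> b)"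
    using Ult_mem_j_iff[OF fun_on_const_fun, of a b] unfolding j_def .
  also have "\<dots> \<longleftrightarrow> ae (\<lambda>i. a \<epsilon> b)" by (rule ae_cong) (simp add: ap_const_fun)
  finally show ?thesis by (simp add: ae_const)
qed

lemma ae_trichotomy:
  assumes "fun_on g I" "ae (\<lambda>i. ap g i \<epsilon> a)" "ordinal a" "b \<epsilon> a"
  shows "ae (\<lambda>i. ap g i \<epsilon> b) \<or> ae (\<lambda>i. ap g i = b) \<or> ae (\<lambda>i. b \<epsilon> ap g i)"
proof -
  \<comment> \<open>\<open>ap\<close> is a description without a definability rule; the graph
    \<open>app\<close> stands for it while \<open>ae_disj\<close> is applied.\<close>
  let ?\<phi> = "\<lambda>i. \<exists>y. app g i y \<and> y \<epsilon> b" and ?\<psi> = "\<lambda>i. app g i b"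
  have ap: "?\<phi> i \<longleftrightarrow> ap g i \<epsilon> b" "?\<psi> i \<longleftrightarrow> ap g i = b" if "i \<epsilon> I" for i
    using app_ap[OF assms(1) that] by auto
  have "dfn (\<lambda>e. ?\<phi> (e 0))" by (intro dfn_intros)
  moreover have "ae (\<lambda>i. ?\<phi> i \<or> ?\<psi> i \<or> b \<epsilon> ap g i)"
    by (rule ae_mono[OF assms(2)]) (use ap ordinal_linear[OF assms(3) assms(4)] in metis)
  ultimately have "ae ?\<phi> \<or> ae (\<lambda>i. ?\<psi> i \<or> b \<epsilon> ap g i)" by (rule ae_disj)
  moreover have d2: "dfn (\<lambda>e. ?\<psi> (e 0))" by (intro dfn_intros)
  ultimately have "ae ?\<phi> \<or> ae ?\<psi> \<or> ae (\<lambda>i. b \<epsilon> ap g i)"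
    using ae_disj[OF d2, of "\<lambda>i. b \<epsilon> ap g i"] by blast
  moreover have "ae ?\<phi> \<longleftrightarrow> ae (\<lambda>i. ap g i \<epsilon> b)" "ae ?\<psi> \<longleftrightarrow> ae (\<lambda>i. ap g i = b)"
    by (intro ae_cong ap; assumption)+
  ultimately show ?thesis by metis
qed

text \<open>
  The isomorphism \<open>h\<close> witnessing that \<open>a\<close> is not moved must agree with \<open>j\<close> below \<open>a\<close>, hence every
  predecessor of \<open>j(a)\<close> is the class of a constant function.
\<close>

lemma ae_const_below_unmoved:
  assumes \<mu>: "ordinal \<mu>" "\<And>b. b \<epsilon> \<mu> \<Longrightarrow> \<not> moved U I b"
    and "a \<epsilon> \<mu>" "fun_on f I" "ae (\<lambda>i. ap f i \<epsilon> a)"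
  shows "\<exists>b. b \<epsilon> a \<and> ae (\<lambda>i. ap f i = b)"
  using wf assms(3-5)
proof (induction a arbitrary: f rule: wfp_induct_rule)
  case (less a)
  have a: "ordinal a" using ordinal_mem[OF \<mu>(1) less.prems(1)] .
  let ?Z = "{X \<in> Ult U I. Ult_mem U I X (j U I a)}"
  have "\<exists>h. bij_betw h {b. b \<epsilon> a} ?Z \<and> (\<forall>b. b \<epsilon> a \<longrightarrow> (\<forall>c. c \<epsilon> a \<longrightarrow> (b \<epsilon> c \<longleftrightarrow> Ult_mem U I (h b) (h c))))"
    using \<mu>(2)[OF less.prems(1)] unfolding moved_def by simp
  then obtain h where bij: "bij_betw h {b. b \<epsilon> a} ?Z"
    and h': "\<forall>b. b \<epsilon> a \<longrightarrow> (\<forall>c. c \<epsilon> a \<longrightarrow> (b \<epsilon> c \<longleftrightarrow> Ult_mem U I (h b) (h c)))"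
    by blast
  note h = h'[rule_format]
  have inj: "b = c" if "h b = h c" "b \<epsilon> a" "c \<epsilon> a" for b c
    using bij_betw_imp_inj_on[OF bij] that by (simp add: inj_on_def)
  have surj: "\<exists>c. c \<epsilon> a \<and> X = h c" if "X \<in> ?Z" for X
    using bij_betw_imp_surj_on[OF bij] that by (metis (mono_tags, lifting) imageE mem_Collect_eq)
  have "b \<epsilon> a \<longrightarrow> h b = j U I b" for b
    using wf
  proof (induction b rule: wfp_induct_rule)
    case (less b)
    show ?case
    proof
      assume b: "b \<epsilon> a"
      have IH: "h c = j U I c" if "c \<epsilon> b" for c
        using less[OF that] ordinal_transitive[OF a that b] by blast
      have "h b \<in> ?Z" using bij_betwE[OF bij] b by blast
      then obtain g where g: "h b = ult_class U I g" "fun_on g I" and "Ult_mem U I (h b) (j U I a)"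
        unfolding Ult_def by blast
      then have ga: "ae (\<lambda>i. ap g i \<epsilon> a)" using Ult_mem_j_iff[OF g(2)] by simp
      \<comment> \<open>Only the middle case is possible. If the values of \<open>g\<close> lie
        below \<open>b\<close>, the outer induction hypothesis makes \<open>g\<close> constant with
        some value \<open>c\<close> in \<open>b\<close>, so \<open>h b = j U I c = h c\<close>
        against injectivity of \<open>h\<close>. If they lie above \<open>b\<close>, then
        \<open>j U I b\<close> precedes \<open>h b\<close>, so it is \<open>h c\<close> for some
        \<open>c\<close> in \<open>b\<close>, hence equal to \<open>j U I c\<close>, against
        injectivity of \<open>j\<close>.\<close>
      consider "ae (\<lambda>i. ap g i \<epsilon> b)" | "ae (\<lambda>i. ap g i = b)" | "ae (\<lambda>i. b \<epsilon> ap g i)"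
        using ae_trichotomy[OF g(2) ga a b] by argo
      then show "h b = j U I b"
      proof cases
        case 1
        have "b \<epsilon> \<mu>" using ordinal_transitive[OF \<mu>(1) b \<open>a \<epsilon> \<mu>\<close>] .
        from \<open>\<And>y f. \<lbrakk>y \<epsilon> a; y \<epsilon> \<mu>; fun_on f I; ae (\<lambda>i. ap f i \<epsilon> y)\<rbrakk> \<Longrightarrow> \<exists>b. b \<epsilon> y \<and> ae (\<lambda>i. ap f i = b)\<close>[OF b this g(2) 1]
        obtain c where c: "c \<epsilon> b" "ae (\<lambda>i. ap g i = c)" by blast
        then have "h b = h c" using j_eq_iff[OF g(2)] g(1) IH by simp
        then have "b = c" using inj b ordinal_transitive[OF a c(1) b] by blast
        then show ?thesis using c(1) not_mem_self by blast
      next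
        case 2
        then show ?thesis using j_eq_iff[OF g(2)] g(1) by simp
      next
        case 3
        have "j U I b \<in> ?Z" using j_mem_j b fun_on_const_fun unfolding j_def Ult_def by blast
        then obtain c where c: "c \<epsilon> a" "j U I b = h c" using surj by blast
        have "Ult_mem U I (h c) (h b)" using 3 j_Ult_mem_iff[OF g(2)] unfolding g(1) c(2)[symmetric] by simp
        then have "c \<epsilon> b" using h[OF c(1) b] by blast
        then have "j U I b = j U I c" using IH c(2) by simp
        then show ?thesis using j_inject \<open>c \<epsilon> b\<close> not_mem_self by metis
      qed
    qed
  qed
  moreover have "ult_class U I f \<in> ?Z"
    using less.prems(2,3) Ult_mem_j_iff unfolding Ult_def by blast
  ultimately obtain b where "b \<epsilon> a" "ult_class U I f = j U I b" using surj by metis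
  then show ?case using j_eq_iff[OF less.prems(2)] by metis
qed

text \<open>A bijection of \<open>P\<close> with \<pi> replaces conditions by ordinals. Sending each
  \<open>i\<close> to the least index of a suitable condition needs no choice and, \<open>R\<close>
  being definable, gives a function of the ground model into \<pi>. As \<pi> lies below the critical
  point, this function is constant almost everywhere, and its value indexes the required
  condition.\<close>

lemma ae_uniform_condition:
  assumes crit: "critical_point U I \<mu>" and P: "has_card P \<pi>" and "\<pi> \<epsilon> \<mu>"
    and R: "dfn (\<lambda>e. R (e 0) (e 1))" and ex: "\<And>i. i \<epsilon> I \<Longrightarrow> \<exists>q. q \<epsilon> P \<and> R i q"
  shows "\<exists>q. q \<epsilon> P \<and> ae (\<lambda>i. R i q)"
proof -
  obtain g where g: "bijection g P \<pi>" using P unfolding has_card_def by blast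
  have g1: "\<exists>\<gamma>. app g q \<gamma> \<and> \<gamma> \<epsilon> \<pi>" if "q \<epsilon> P" for q
    using g that unfolding bijection_def fun_to_def fun_on_def by blast
  have g2: "q = q'" if "app g q \<gamma>" "app g q' \<gamma>" for q q' \<gamma>
  proof -
    have "q \<epsilon> P"
      using g that unfolding bijection_def fun_to_def fun_on_def app_iff is_pair_iff by (metis UNIV_I pair_inject)
    then have "\<gamma> \<epsilon> \<pi>" using g that(1) unfolding bijection_def fun_to_def by blast
    then show ?thesis using g that unfolding bijection_def by blast
  qed
  define Q where "Q i \<gamma> \<longleftrightarrow> \<gamma> \<epsilon> \<pi> \<and> (\<exists>q. q \<epsilon> P \<and> app g q \<gamma> \<and> R i q)" for i \<gamma>
  have Q: "dfn (\<lambda>e. Q (a e) (b e))" if "dterm a" "dterm b" for a b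
    by (rule dfn_subst2[where Q=Q, OF _ that]) (unfold Q_def, intro dfn_intros dfn_subst2[where Q=R, OF R])
  define M where "M i \<gamma> \<longleftrightarrow> Q i \<gamma> \<and> (\<forall>\<gamma>'. \<gamma>' \<epsilon> \<gamma> \<longrightarrow> \<not> Q i \<gamma>')" for i \<gamma>
  have M: "dfn (\<lambda>e. M (a e) (b e))" if "dterm a" "dterm b" for a b
    by (rule dfn_subst2[where Q=M, OF _ that]) (unfold M_def, intro dfn_intros Q)
  define f where "f = Sep (prod I \<pi>) (\<lambda>z. \<exists>i \<gamma>. z = pair i \<gamma> \<and> M i \<gamma>)"
  have "dfn (\<lambda>e. \<exists>i \<gamma>. e 0 = pair i \<gamma> \<and> M i \<gamma>)" by (intro dfn_intros M)
  note f = mem_Sep[OF this, of _ "prod I \<pi>", folded f_def]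
  have \<mu>: "ordinal \<mu>" "\<And>b. b \<epsilon> \<mu> \<Longrightarrow> \<not> moved U I b"
    using crit unfolding critical_point_def by simp_all
  have \<pi>: "ordinal \<pi>" using ordinal_mem[OF \<mu>(1) \<open>\<pi> \<epsilon> \<mu>\<close>] .
  have app_f: "app f i \<gamma> \<longleftrightarrow> i \<epsilon> I \<and> M i \<gamma>" for i \<gamma>
    unfolding app_iff f M_def Q_def by auto
  have M_ex1: "\<exists>!\<gamma>. M i \<gamma>" if i: "i \<epsilon> I" for i
  proof -
    obtain q where q: "q \<epsilon> P" "R i q" using ex[OF i] by blast
    obtain \<gamma> where "app g q \<gamma>" "\<gamma> \<epsilon> \<pi>" using g1[OF q(1)] by blast
    then have "Q i \<gamma>" unfolding Q_def using q by blast
    then have "\<exists>\<gamma>. M i \<gamma>" unfolding M_def by (rule ex_minimal)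
    moreover have "\<gamma> = \<gamma>'" if "M i \<gamma>" "M i \<gamma>'" for \<gamma> \<gamma>'
      using that ordinal_linear[OF \<pi>, of \<gamma> \<gamma>'] unfolding M_def Q_def by metis
    ultimately show ?thesis by blast
  qed
  have fun_f: "fun_on f I"
  proof (rule fun_onI)
    show "\<exists>a b. a \<epsilon> I \<and> z = pair a b" if "z \<epsilon> f" for z
      using that unfolding f mem_prod by blast
    show "\<exists>!b. pair a b \<epsilon> f" if "a \<epsilon> I" for a
      using M_ex1[OF that] app_f[unfolded app_iff] that by simp
  qed
  have M_ap: "M i (ap f i)" if "i \<epsilon> I" for i
    using app_f[of i "ap f i"] app_ap[OF fun_f that] by simp
  have "ae (\<lambda>i. ap f i \<epsilon> \<pi>)"
    by (rule ae_mono[OF ae_True]) (use M_ap in \<open>simp add: M_def Q_def\<close>)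
  from ae_const_below_unmoved[OF \<mu> \<open>\<pi> \<epsilon> \<mu>\<close> fun_f this]
  obtain b where "ae (\<lambda>i. ap f i = b)" by blast
  then have Qb: "ae (\<lambda>i. Q i b)" by (rule ae_mono) (use M_ap in \<open>auto simp: M_def\<close>)
  then obtain q where q: "q \<epsilon> P" "app g q b" using ae_ex unfolding Q_def by blast
  have "ae (\<lambda>i. R i q)" by (rule ae_mono[OF Qb]) (use g2 q in \<open>unfold Q_def, blast\<close>)
  then show ?thesis using q(1) by blast
qed

text \<open>Adapts indecomposability to a definable relation that may hold of several
  \<open>n\<close>: putting \<open>i\<close> into the piece of its least \<open>n\<close> yields a
  partition in the ground model, some pieces of which may be empty.\<close>

lemma indecomposable_ae:
  assumes ind: "indecomposable d k U I" and k: "ordinal k" and a: "a \<epsilon> k"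
    and R: "dfn (\<lambda>e. R (e 0) (e 1))" and ex: "\<And>i. i \<epsilon> I \<Longrightarrow> \<exists>n. n \<epsilon> a \<and> R i n"
  shows "\<exists>b t. b \<epsilon> d \<and> increasing t b a \<and> ae (\<lambda>i. \<exists>x n. app t x n \<and> R i n)"
proof -
  have a': "ordinal a" using ordinal_mem[OF k a] .
  define M where "M i n \<longleftrightarrow> (n \<epsilon> a \<and> R i n) \<and> (\<forall>m. m \<epsilon> n \<longrightarrow> \<not> (m \<epsilon> a \<and> R i m))" for i n
  have M: "dfn (\<lambda>e. M (b e) (c e))" if "dterm b" "dterm c" for b c
    by (rule dfn_subst2[where Q=M, OF _ that])
      (unfold M_def, intro dfn_intros dfn_subst2[where Q=R, OF R])
  have M_ex1: "\<exists>!n. M i n" if i: "i \<epsilon> I" for i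
  proof -
    have "\<exists>n. M i n" unfolding M_def using ex_minimal[of "\<lambda>n. n \<epsilon> a \<and> R i n"] ex[OF i] by blast
    moreover have "n = n'" if "M i n" "M i n'" for n n'
      using that ordinal_linear[OF a', of n n'] unfolding M_def by metis
    ultimately show ?thesis by blast
  qed
  define s where "s = Sep (prod a (pow I)) (\<lambda>z. \<exists>n X. z = pair n X \<and> (\<forall>i. i \<epsilon> X \<longleftrightarrow> i \<epsilon> I \<and> M i n))"
  have "dfn (\<lambda>e. \<exists>n X. e 0 = pair n X \<and> (\<forall>i. i \<epsilon> X \<longleftrightarrow> i \<epsilon> I \<and> M i n))" by (intro dfn_intros M)
  note s = mem_Sep[OF this, of _ "prod a (pow I)", folded s_def]
  have app_s: "app s n X \<longleftrightarrow> n \<epsilon> a \<and> (\<forall>i. i \<epsilon> X \<longleftrightarrow> i \<epsilon> I \<and> M i n)" for n X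
  proof -
    have "app s n X \<longleftrightarrow> (n \<epsilon> a \<and> X \<epsilon> pow I) \<and> (\<forall>i. i \<epsilon> X \<longleftrightarrow> i \<epsilon> I \<and> M i n)"
      unfolding app_iff s by simp
    moreover have "X \<epsilon> pow I" if "\<forall>i. i \<epsilon> X \<longleftrightarrow> i \<epsilon> I \<and> M i n" using that by (simp add: mem_pow sub_def)
    ultimately show ?thesis by argo
  qed
  have piece: "\<exists>X. app s n X" if "n \<epsilon> a" for n
    unfolding app_s using that ex_Sep[of "\<lambda>i. M i n" I] M[OF dterm_var dterm_const] by blast
  have s_unique: "X = Y" if "app s n X" "app s n Y" for n X Y
    by (rule set_eqI) (use that in \<open>simp add: app_s\<close>)
  have mem: "(\<exists>X. app s n X \<and> i \<epsilon> X) \<longleftrightarrow> i \<epsilon> I \<and> M i n" if "n \<epsilon> a" for i n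
    using piece[OF that] app_s by metis
  have "partition s a I"
    unfolding partition_def
  proof (intro conjI ballI impI)
    show "fun_on s a"
    proof (rule fun_onI)
      show "\<exists>a' b. a' \<epsilon> a \<and> z = pair a' b" if "z \<epsilon> s" for z
        using that unfolding s mem_prod by blast
      show "\<exists>!X. pair n X \<epsilon> s" if "n \<epsilon> a" for n
        using piece[OF that] s_unique unfolding app_iff by blast
    qed
    show "sub X I" if "app s n X" for n X
      using that unfolding app_s sub_def by blast
    fix i assume i: "i \<epsilon> I"
    have "(n \<in> UNIV \<and> n \<epsilon> a \<and> (\<exists>X\<in>UNIV. app s n X \<and> i \<epsilon> X)) \<longleftrightarrow> M i n" for n
      using mem[of n i] i unfolding bex_UNIV by (auto simp: M_def)
    then show "\<exists>!n. n \<in> UNIV \<and> n \<epsilon> a \<and> (\<exists>X\<in>UNIV. app s n X \<and> i \<epsilon> X)"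
      using M_ex1[OF i] by presburger
  qed
  then obtain b t Y where bt: "b \<epsilon> d" "increasing t b a" and Y: "Y \<epsilon> U"
    "\<forall>i. i \<epsilon> Y \<longleftrightarrow> (\<exists>x n X. app t x n \<and> app s n X \<and> i \<epsilon> X)"
    using ind a unfolding indecomposable_def ball_UNIV bex_UNIV by blast
  have "ae (\<lambda>i. \<exists>x n. app t x n \<and> R i n)"
  proof -
    have "i \<epsilon> I \<and> (\<exists>x n. app t x n \<and> R i n)" if i: "i \<epsilon> Y" for i
    proof -
      obtain x n X where x: "app t x n" "app s n X" "i \<epsilon> X" using i Y(2) by blast
      then have "i \<epsilon> I \<and> M i n" unfolding app_s by blast
      then show ?thesis using x(1) unfolding M_def by blast
    qed
    then show ?thesis unfolding ae_def using Y(1) by blast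
  qed
  then show ?thesis using bt by blast
qed

end

subsection \<open>Forcing equality of names\<close>

locale generic_extension = forcing E P L G
  for E :: "'v \<Rightarrow> 'v \<Rightarrow> bool" (infix "\<epsilon>" 50) and P L :: 'v and G :: "'v set" +
  assumes wf: "wfp E" and zfc: "V.ZFC" and notion: forcing_notion and generic: generic
begin

sublocale V: ground_model E
  by unfold_locales (rule wf zfc)+

section \<open>Conditions and the generic filter\<close>

lemma le_refl: "p \<epsilon> P \<Longrightarrow> le p p"
  using notion unfolding forcing_notion_def by blast

lemma le_trans: "le p q \<Longrightarrow> le q r \<Longrightarrow> p \<epsilon> P \<Longrightarrow> q \<epsilon> P \<Longrightarrow> r \<epsilon> P \<Longrightarrow> le p r"
  using notion unfolding forcing_notion_def by blast

lemma G_P: "p \<in> G \<Longrightarrow> p \<epsilon> P"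
  using generic unfolding generic_def by blast

lemma G_nonempty: "\<exists>p. p \<in> G"
  using generic unfolding generic_def by blast

lemma G_upward: "p \<in> G \<Longrightarrow> le p q \<Longrightarrow> q \<epsilon> P \<Longrightarrow> q \<in> G"
  using generic unfolding generic_def by blast

lemma G_directed: "p \<in> G \<Longrightarrow> q \<in> G \<Longrightarrow> \<exists>r\<in>G. le r p \<and> le r q"
  using generic unfolding generic_def by blast

lemma G_dense: "dense D \<Longrightarrow> \<exists>p\<in>G. p \<epsilon> D"
  using generic unfolding generic_def by blast

lemma dfn_le [dfn_intros]:
  assumes "V.dterm a" "V.dterm b"
  shows "V.dfn (\<lambda>e. le (a e) (b e))"
  by (rule V.dfn_subst2[where Q=le, OF _ assms]) (unfold le_def, intro dfn_intros)

text \<open>Density below \<open>p\<close> becomes density by adding all conditions incompatible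
  with \<open>p\<close>; two members of \<open>G\<close> are compatible, so \<open>G\<close> meets
  the original part. Definability of \<open>\<phi>\<close> makes the dense set an element of the
  ground model.\<close>

lemma generic_below:
  assumes \<phi>: "V.dfn (\<lambda>e. \<phi> (e 0))" and p: "p \<in> G"
    and dense: "\<And>q. q \<epsilon> P \<Longrightarrow> le q p \<Longrightarrow> \<exists>r. r \<epsilon> P \<and> le r q \<and> \<phi> r"
  shows "\<exists>q\<in>G. \<phi> q"
proof -
  let ?\<psi> = "\<lambda>q. \<phi> q \<or> \<not> (\<exists>r. r \<epsilon> P \<and> le r q \<and> le r p)"
  have "V.dfn (\<lambda>e. ?\<psi> (e 0))" by (intro dfn_intros \<phi>)
  note D = V.mem_Sep[OF this, of _ P]
  have "\<exists>r. r \<epsilon> P \<and> ?\<psi> r \<and> le r q" if q: "q \<epsilon> P" for q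
  proof (cases "\<exists>r. r \<epsilon> P \<and> le r q \<and> le r p")
    case True
    then obtain r where r: "r \<epsilon> P" "le r q" "le r p" by blast
    then obtain r' where r': "r' \<epsilon> P" "le r' r" "\<phi> r'" using dense by blast
    then have "le r' q" using le_trans r q by blast
    then show ?thesis using r' by blast
  next
    case False
    then show ?thesis using q le_refl by blast
  qed
  then have "dense (V.Sep P ?\<psi>)"
    unfolding dense_def V.sub_def D by blast
  from G_dense[OF this] obtain q where q: "q \<in> G" "?\<psi> q" unfolding D by blast
  obtain r where r: "r \<in> G" "le r q" "le r p" using G_directed[OF q(1) p] by blast
  have "\<phi> q" using q(2) r G_P[OF r(1)] by blast
  then show ?thesis using q(1) by blast
qed

lemma generic_dense:
  assumes "V.dfn (\<lambda>e. \<phi> (e 0))" "\<And>q. q \<epsilon> P \<Longrightarrow> \<exists>r. r \<epsilon> P \<and> le r q \<and> \<phi> r"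
  shows "\<exists>q\<in>G. \<phi> q"
  using generic_below[OF assms(1)] assms(2) G_nonempty by blast

text \<open>With forced equality for \<open>F\<close> this is the usual recursive clause for
  \<open>p\<close> forcing that \<open>s\<close> is included in \<open>t\<close>; leaving
  \<open>F\<close> open allows any candidate for a bisimulation in its place.\<close>

definition matched :: "('v \<Rightarrow> 'v \<Rightarrow> 'v \<Rightarrow> bool) \<Rightarrow> 'v \<Rightarrow> 'v \<Rightarrow> 'v \<Rightarrow> bool" where
  "matched F p s t \<longleftrightarrow>
     (\<forall>x r q. V.pair x r \<epsilon> s \<and> r \<epsilon> P \<and> q \<epsilon> P \<and> le q p \<and> le q r \<longrightarrow>
        (\<exists>q' y r'. q' \<epsilon> P \<and> le q' q \<and> V.pair y r' \<epsilon> t \<and> r' \<epsilon> P \<and> le q' r' \<and> F q' x y))"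

text \<open>\<open>R\<close> is a set, so that \<open>forces_eq\<close> quantifies over elements of
  the model and is given by a formula. Closure under exchanging \<open>s\<close> and
  \<open>t\<close> provides the inclusion in the other direction.\<close>

definition forced_bisimulation :: "'v \<Rightarrow> bool" where
  "forced_bisimulation R \<longleftrightarrow>
     (\<forall>p s t. V.pair p (V.pair s t) \<epsilon> R \<longrightarrow>
        p \<epsilon> P \<and> V.pair p (V.pair t s) \<epsilon> R \<and> matched (\<lambda>p s t. V.pair p (V.pair s t) \<epsilon> R) p s t)"

definition forces_eq :: "'v \<Rightarrow> 'v \<Rightarrow> 'v \<Rightarrow> bool" where
  "forces_eq p s t \<longleftrightarrow> (\<exists>R. forced_bisimulation R \<and> V.pair p (V.pair s t) \<epsilon> R)"

lemma dfn_forces_eq [dfn_intros]: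
  assumes "V.dterm a" "V.dterm b" "V.dterm c"
  shows "V.dfn (\<lambda>e. forces_eq (a e) (b e) (c e))"
  by (rule V.dfn_subst3[where Q=forces_eq, OF _ assms])
    (unfold forces_eq_def forced_bisimulation_def matched_def, intro dfn_intros)

lemma matched_mono:
  assumes "matched F p s t" "\<And>q x r y r'. V.pair x r \<epsilon> s \<Longrightarrow> V.pair y r' \<epsilon> t \<Longrightarrow> F q x y \<Longrightarrow> F' q x y"
  shows "matched F' p s t"
  unfolding matched_def
proof (intro allI impI)
  fix x r q assume *: "V.pair x r \<epsilon> s \<and> r \<epsilon> P \<and> q \<epsilon> P \<and> le q p \<and> le q r"
  then obtain q' y r' where "q' \<epsilon> P" "le q' q" "V.pair y r' \<epsilon> t" "r' \<epsilon> P" "le q' r'" "F q' x y"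
    using assms(1) unfolding matched_def by blast
  moreover from this have "F' q' x y" using assms(2) * by blast
  ultimately show "\<exists>q' y r'. q' \<epsilon> P \<and> le q' q \<and> V.pair y r' \<epsilon> t \<and> r' \<epsilon> P \<and> le q' r' \<and> F' q' x y"
    by blast
qed

lemma forces_eq_sym: "forces_eq p s t \<Longrightarrow> forces_eq p t s"
  unfolding forces_eq_def forced_bisimulation_def by blast

text \<open>The recursion equation, obtained from the greatest fixed point. For the converse a
  single set must witness \<open>forces_eq p s t\<close>: the two triples in question are added to
  the restriction of \<open>forces_eq\<close> itself to a set of names, which Separation provides
  since \<open>forces_eq\<close> is definable.\<close>

lemma forces_eq_iff: "forces_eq p s t \<longleftrightarrow> p \<epsilon> P \<and> matched forces_eq p s t \<and> matched forces_eq p t s"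
proof
  have 1: "p \<epsilon> P \<and> matched forces_eq p s t" if feq: "forces_eq p s t" for s t
  proof -
    obtain R where R: "forced_bisimulation R" "V.pair p (V.pair s t) \<epsilon> R"
      using feq unfolding forces_eq_def by blast
    then have "p \<epsilon> P" "matched (\<lambda>p s t. V.pair p (V.pair s t) \<epsilon> R) p s t"
      unfolding forced_bisimulation_def by blast+
    moreover have "forces_eq q x y" if "V.pair q (V.pair x y) \<epsilon> R" for q x y
      using that R(1) unfolding forces_eq_def by blast
    ultimately show ?thesis using matched_mono by (metis (no_types, lifting))
  qed
  assume "forces_eq p s t"
  then show "p \<epsilon> P \<and> matched forces_eq p s t \<and> matched forces_eq p t s"
    using 1 forces_eq_sym by blast
next
  assume *: "p \<epsilon> P \<and> matched forces_eq p s t \<and> matched forces_eq p t s"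
  obtain st where st: "V.is_upair st s t" using V.ex_upair by blast
  \<comment> \<open>Transitivity of \<open>M\<close> keeps all names occurring inside members of
    \<open>M\<close> within \<open>M\<close>, so the restriction of \<open>forces_eq\<close> to
    \<open>M\<close> is still closed under matching.\<close>
  obtain M where M: "V.transitive M" "V.sub st M" using V.ex_transitive by blast
  have stM: "s \<epsilon> M" "t \<epsilon> M" using st M(2) by (simp_all add: V.is_upair_def V.sub_def)
  define \<phi> where "\<phi> z \<longleftrightarrow> (\<exists>q x y. z = V.pair q (V.pair x y) \<and>
    (forces_eq q x y \<or> q = p \<and> x = s \<and> y = t \<or> q = p \<and> x = t \<and> y = s))" for z
  have "V.dfn (\<lambda>e. \<phi> (e 0))" unfolding \<phi>_def by (intro dfn_intros)
  note R = V.mem_Sep[OF this, of _ "V.prod P (V.prod M M)"]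
  let ?R = "V.Sep (V.prod P (V.prod M M)) \<phi>"
  have R': "V.pair q (V.pair x y) \<epsilon> ?R \<longleftrightarrow> q \<epsilon> P \<and> x \<epsilon> M \<and> y \<epsilon> M \<and>
    (forces_eq q x y \<or> q = p \<and> x = s \<and> y = t \<or> q = p \<and> x = t \<and> y = s)" for q x y
    unfolding R \<phi>_def V.pair_mem_prod V.pair_inject by blast
  have eq: "matched forces_eq q x y" if feq: "forces_eq q x y" for q x y
  proof -
    obtain R where R: "forced_bisimulation R" "V.pair q (V.pair x y) \<epsilon> R"
      using feq unfolding forces_eq_def by blast
    then have "matched (\<lambda>p s t. V.pair p (V.pair s t) \<epsilon> R) q x y"
      unfolding forced_bisimulation_def by blast
    then show ?thesis
      by (rule matched_mono) (use R(1) in \<open>unfold forces_eq_def, blast\<close>)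
  qed
  have "forced_bisimulation ?R"
    unfolding forced_bisimulation_def
  proof (intro allI impI conjI)
    fix q x y assume mem: "V.pair q (V.pair x y) \<epsilon> ?R"
    then have xy: "q \<epsilon> P" "x \<epsilon> M" "y \<epsilon> M"
      and c: "forces_eq q x y \<or> q = p \<and> x = s \<and> y = t \<or> q = p \<and> x = t \<and> y = s"
      unfolding R' by blast+
    show "q \<epsilon> P" by fact
    show "V.pair q (V.pair y x) \<epsilon> ?R"
      unfolding R' using xy c forces_eq_sym by blast
    have "matched forces_eq q x y" using c * eq by blast
    then show "matched (\<lambda>p s t. V.pair p (V.pair s t) \<epsilon> ?R) q x y"
      unfolding matched_def R' using V.transitive_pairD[OF M(1)] xy by (metis (no_types, lifting))
  qed
  moreover have "V.pair p (V.pair s t) \<epsilon> ?R" unfolding R' using * stM by blast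
  ultimately show "forces_eq p s t" unfolding forces_eq_def by blast
qed

lemma matched_le: "matched F p s t \<Longrightarrow> le q p \<Longrightarrow> q \<epsilon> P \<Longrightarrow> p \<epsilon> P \<Longrightarrow> matched F q s t"
  unfolding matched_def using le_trans by blast

lemma forces_eq_le: "forces_eq p s t \<Longrightarrow> le q p \<Longrightarrow> q \<epsilon> P \<Longrightarrow> forces_eq q s t"
  using matched_le forces_eq_iff by metis

lemma forces_eq_dense:
  assumes p: "p \<epsilon> P" and dense: "\<And>q. q \<epsilon> P \<Longrightarrow> le q p \<Longrightarrow> \<exists>r. r \<epsilon> P \<and> le r q \<and> forces_eq r s t"
  shows "forces_eq p s t"
proof -
  have "matched forces_eq p s t"
    if dense: "\<And>q. q \<epsilon> P \<Longrightarrow> le q p \<Longrightarrow> \<exists>r. r \<epsilon> P \<and> le r q \<and> forces_eq r s t" for s t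
    unfolding matched_def
  proof (intro allI impI)
    fix x r q assume *: "V.pair x r \<epsilon> s \<and> r \<epsilon> P \<and> q \<epsilon> P \<and> le q p \<and> le q r"
    then obtain q1 where q1: "q1 \<epsilon> P" "le q1 q" "forces_eq q1 s t" using dense by blast
    then have "matched forces_eq q1 s t" using forces_eq_iff by blast
    moreover have "le q1 q1" "le q1 r" using le_refl le_trans q1 * by blast+
    ultimately obtain q' y r' where q': "q' \<epsilon> P" "le q' q1" "V.pair y r' \<epsilon> t" "r' \<epsilon> P" "le q' r'" "forces_eq q' x y"
      using * q1 unfolding matched_def by blast
    then have "le q' q" using le_trans q1 * by blast
    then show "\<exists>q' y r'. q' \<epsilon> P \<and> le q' q \<and> V.pair y r' \<epsilon> t \<and> r' \<epsilon> P \<and> le q' r' \<and> forces_eq q' x y"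
      using q' by blast
  qed
  moreover have "\<exists>r. r \<epsilon> P \<and> le r q \<and> forces_eq r t s" if "q \<epsilon> P" "le q p" for q
    using dense[OF that] forces_eq_sym by blast
  ultimately show ?thesis using forces_eq_iff p dense by blast
qed

lemma elem_name_iff: "elem_name t s \<longleftrightarrow> (\<exists>p\<in>G. V.pair t p \<epsilon> s)"
  unfolding elem_name_def V.is_pair_iff by blast

text \<open>Being forced equal by some member of \<open>G\<close> is itself a bisimulation: below a
  condition in \<open>G\<close> that puts \<open>x\<close> into \<open>s\<close>, conditions with a
  partner for \<open>x\<close> are dense, and \<open>G\<close> contains one of them.\<close>

lemma forces_eq_sound:
  assumes "p \<in> G" "forces_eq p s t"
  shows "name_eq s t"
proof -
  let ?R = "\<lambda>s t. \<exists>p\<in>G. forces_eq p s t"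
  have 1: "\<exists>y. elem_name y t \<and> ?R x y" if R: "?R s t" and x: "elem_name x s" for s t x
  proof -
    obtain p where p: "p \<in> G" "forces_eq p s t" using R by blast
    obtain r where r: "r \<in> G" "V.pair x r \<epsilon> s" using x elem_name_iff by blast
    obtain q where q: "q \<in> G" "le q p" "le q r" using G_directed[OF p(1) r(1)] by blast
    have m: "matched forces_eq p s t" using p(2) forces_eq_iff by blast
    have "\<exists>q'\<in>G. \<exists>y r'. V.pair y r' \<epsilon> t \<and> r' \<epsilon> P \<and> le q' r' \<and> forces_eq q' x y"
    proof (rule generic_below[OF _ q(1)])
      show "V.dfn (\<lambda>e. \<exists>y r'. V.pair y r' \<epsilon> t \<and> r' \<epsilon> P \<and> le (e 0) r' \<and> forces_eq (e 0) x y)"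
        by (intro dfn_intros)
      fix q1 assume q1: "q1 \<epsilon> P" "le q1 q"
      then have "le q1 p" "le q1 r" using le_trans q p r G_P by blast+
      then have "V.pair x r \<epsilon> s \<and> r \<epsilon> P \<and> q1 \<epsilon> P \<and> le q1 p \<and> le q1 r" using r q1 G_P by blast
      from m[unfolded matched_def, rule_format, OF this]
      show "\<exists>ra. ra \<epsilon> P \<and> le ra q1 \<and> (\<exists>y r'. V.pair y r' \<epsilon> t \<and> r' \<epsilon> P \<and> le ra r' \<and> forces_eq ra x y)"
        by blast
    qed
    then obtain q' y r' where "q' \<in> G" "V.pair y r' \<epsilon> t" "r' \<epsilon> P" "le q' r'" "forces_eq q' x y" by blast
    moreover from this have "r' \<in> G" using G_upward by blast
    ultimately show ?thesis using elem_name_iff by blast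
  qed
  have "bisimulation ?R"
    unfolding bisimulation_def
  proof (intro allI impI conjI)
    fix s t x assume "?R s t" "elem_name x s"
    then show "\<exists>y. elem_name y t \<and> ?R x y" by (rule 1)
  next
    fix s t y assume "?R s t" and y: "elem_name y t"
    then have "?R t s" using forces_eq_sym by blast
    from 1[OF this y] show "\<exists>x. elem_name x s \<and> ?R x y" using forces_eq_sym by blast
  qed
  then show ?thesis by (rule name_eqI) (use assms in blast)
qed

text \<open>Densely many conditions force the equality or are \<open>bad\<close>, that is, put a
  member into one name for which no stronger condition has a partner in the other. A bad condition
  in \<open>G\<close> is refuted by bisimilarity: the member has an actual partner, equality with it
  is forced by induction, and a common strengthening in \<open>G\<close> contradicts
  badness.\<close>

lemma forces_eq_complete:
  assumes "name_eq s t"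
  shows "\<exists>p\<in>G. forces_eq p s t"
proof -
  have "wfp (E\<^sup>+\<^sup>+)" using wf by (simp add: wfp_tranclp)
  then show ?thesis using assms
  proof (induction s arbitrary: t rule: wfp_induct_rule)
    case (less s)
    define bad where "bad q s t \<longleftrightarrow> (\<exists>x r. V.pair x r \<epsilon> s \<and> r \<epsilon> P \<and> le q r \<and>
      (\<forall>q' y r'. q' \<epsilon> P \<and> le q' q \<and> V.pair y r' \<epsilon> t \<and> r' \<epsilon> P \<and> le q' r' \<longrightarrow> \<not> forces_eq q' x y))" for q s t
    have bad: "V.dfn (\<lambda>e. bad (a e) (b e) (c e))" if "V.dterm a" "V.dterm b" "V.dterm c" for a b c
      by (rule V.dfn_subst3[where Q=bad, OF _ that]) (unfold bad_def, intro dfn_intros)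
    have "\<exists>q\<in>G. forces_eq q s t \<or> bad q s t \<or> bad q t s"
    proof (rule generic_dense)
      show "V.dfn (\<lambda>e. forces_eq (e 0) s t \<or> bad (e 0) s t \<or> bad (e 0) t s)" by (intro dfn_intros bad)
      fix p assume p: "p \<epsilon> P"
      have unmatched: "\<exists>q. q \<epsilon> P \<and> le q p \<and> bad q s t" if "\<not> matched forces_eq p s t" for s t
        using that unfolding matched_def bad_def by blast
      show "\<exists>q. q \<epsilon> P \<and> le q p \<and> (forces_eq q s t \<or> bad q s t \<or> bad q t s)"
      proof (cases "forces_eq p s t")
        case True
        then show ?thesis using p le_refl by blast
      next
        case False
        then have "\<not> matched forces_eq p s t \<or> \<not> matched forces_eq p t s" using forces_eq_iff p by blast
        then show ?thesis using unmatched by blast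
      qed
    qed
    then obtain q where q: "q \<in> G" "forces_eq q s t \<or> bad q s t \<or> bad q t s" by blast
    have not_bad: "\<not> bad q s t"
      if eq: "name_eq s t" and IH: "\<And>x r y. V.pair x r \<epsilon> s \<Longrightarrow> elem_name y t \<Longrightarrow> name_eq x y \<Longrightarrow> \<exists>p\<in>G. forces_eq p x y" for s t
    proof
      assume "bad q s t"
      then obtain x r where x: "V.pair x r \<epsilon> s" "r \<epsilon> P" "le q r"
        and no: "\<forall>q' y r'. q' \<epsilon> P \<and> le q' q \<and> V.pair y r' \<epsilon> t \<and> r' \<epsilon> P \<and> le q' r' \<longrightarrow> \<not> forces_eq q' x y"
        unfolding bad_def by blast
      have "r \<in> G" using G_upward q(1) x by blast
      then have "elem_name x s" using x elem_name_iff by blast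
      then obtain y where y: "elem_name y t" "name_eq x y" using name_eq_left[OF eq] by blast
      then obtain p where p: "p \<in> G" "forces_eq p x y" using IH[OF x(1)] by blast
      obtain r' where r': "r' \<in> G" "V.pair y r' \<epsilon> t" using y(1) elem_name_iff by blast
      obtain q1 where q1: "q1 \<in> G" "le q1 q" "le q1 p" using G_directed[OF q(1) p(1)] by blast
      obtain q2 where q2: "q2 \<in> G" "le q2 q1" "le q2 r'" using G_directed[OF q1(1) r'(1)] by blast
      have "le q2 q" "le q2 p" using le_trans q1 q2 G_P q(1) p(1) by blast+
      then have "forces_eq q2 x y" using forces_eq_le p(2) G_P q2(1) by blast
      then show False using no G_P q2 r' \<open>le q2 q\<close> by blast
    qed
    have "\<not> bad q s t"
      by (rule not_bad[OF less.prems]) (use less.IH V.pair_mem_tranclp in blast)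
    \<comment> \<open>The induction is on \<open>s\<close> alone, so with the names exchanged its
      hypothesis is applied to the second component and turned around by symmetry.\<close>
    moreover have "\<not> bad q t s"
    proof (rule not_bad[OF name_eq_sym[OF less.prems]])
      fix x r y assume "elem_name y s" "name_eq x y"
      then have "E\<^sup>+\<^sup>+ y s" "name_eq y x" using V.pair_mem_tranclp name_eq_sym unfolding elem_name_iff by blast+
      from less.IH[OF this] show "\<exists>p\<in>G. forces_eq p x y" using forces_eq_sym by blast
    qed
    ultimately show ?case using q by blast
  qed
qed

lemma name_eq_iff: "name_eq s t \<longleftrightarrow> (\<exists>p\<in>G. forces_eq p s t)"
  using forces_eq_sound forces_eq_complete by blast

end

subsection \<open>The forcing theorem\<close>

context generic_extension
begin

section \<open>Forcing membership\<close>

definition forces_mem :: "'v \<Rightarrow> 'v \<Rightarrow> 'v \<Rightarrow> bool" where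
  "forces_mem p s t \<longleftrightarrow>
     (\<forall>q. q \<epsilon> P \<and> le q p \<longrightarrow>
        (\<exists>q'. q' \<epsilon> P \<and> le q' q \<and> (\<exists>y r. V.pair y r \<epsilon> t \<and> r \<epsilon> P \<and> le q' r \<and> forces_eq q' s y)))"

lemma dfn_forces_mem [dfn_intros]:
  assumes "V.dterm a" "V.dterm b" "V.dterm c"
  shows "V.dfn (\<lambda>e. forces_mem (a e) (b e) (c e))"
  by (rule V.dfn_subst3[where Q=forces_mem, OF _ assms]) (unfold forces_mem_def, intro dfn_intros)

lemma forces_mem_truth: "memG (val s) (val t) \<longleftrightarrow> (\<exists>p\<in>G. forces_mem p s t)"
proof
  assume "memG (val s) (val t)"
  then obtain y where y: "val s = val y" "elem_name y t" unfolding memG_val by blast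
  then obtain p where p: "p \<in> G" "forces_eq p s y" unfolding val_eq_iff name_eq_iff by blast
  obtain r where r: "r \<in> G" "V.pair y r \<epsilon> t" using y(2) elem_name_iff by blast
  obtain q where q: "q \<in> G" "le q p" "le q r" using G_directed[OF p(1) r(1)] by blast
  have "forces_mem q s t"
    unfolding forces_mem_def
  proof (intro allI impI)
    fix q1 assume q1: "q1 \<epsilon> P \<and> le q1 q"
    then have "le q1 p" "le q1 r" using le_trans q p r G_P by blast+
    then have "q1 \<epsilon> P \<and> le q1 q1 \<and> V.pair y r \<epsilon> t \<and> r \<epsilon> P \<and> le q1 r \<and> forces_eq q1 s y"
      using q1 r forces_eq_le[OF p(2)] le_refl G_P by blast
    then show "\<exists>q'. q' \<epsilon> P \<and> le q' q1 \<and> (\<exists>y r. V.pair y r \<epsilon> t \<and> r \<epsilon> P \<and> le q' r \<and> forces_eq q' s y)"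
      by blast
  qed
  then show "\<exists>p\<in>G. forces_mem p s t" using q(1) by blast
next
  assume "\<exists>p\<in>G. forces_mem p s t"
  then obtain p where p: "p \<in> G" "forces_mem p s t" by blast
  have "\<exists>q\<in>G. \<exists>y r. V.pair y r \<epsilon> t \<and> r \<epsilon> P \<and> le q r \<and> forces_eq q s y"
  proof (rule generic_below[OF _ p(1)])
    show "V.dfn (\<lambda>e. \<exists>y r. V.pair y r \<epsilon> t \<and> r \<epsilon> P \<and> le (e 0) r \<and> forces_eq (e 0) s y)"
      by (intro dfn_intros)
  qed (use p(2) in \<open>unfold forces_mem_def, blast\<close>)
  then obtain q y r where q: "q \<in> G" "V.pair y r \<epsilon> t" "r \<epsilon> P" "le q r" "forces_eq q s y" by blast
  have "r \<in> G" using G_upward[OF q(1,4,3)] .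
  then have "elem_name y t" using q(2) elem_name_iff by blast
  moreover have "val s = val y" unfolding val_eq_iff name_eq_iff using q by blast
  ultimately show "memG (val s) (val t)" unfolding memG_val by blast
qed

lemma forces_mem_le: "forces_mem p s t \<Longrightarrow> le q p \<Longrightarrow> q \<epsilon> P \<Longrightarrow> p \<epsilon> P \<Longrightarrow> forces_mem q s t"
  unfolding forces_mem_def using le_trans by blast

lemma forces_mem_dense:
  assumes "p \<epsilon> P" "\<And>q. q \<epsilon> P \<Longrightarrow> le q p \<Longrightarrow> \<exists>r. r \<epsilon> P \<and> le r q \<and> forces_mem r s t"
  shows "forces_mem p s t"
  unfolding forces_mem_def
proof (intro allI impI)
  fix q assume q: "q \<epsilon> P \<and> le q p"
  then obtain r where r: "r \<epsilon> P" "le r q" "forces_mem r s t" using assms(2) by blast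
  have "r \<epsilon> P \<and> le r r" using r le_refl by blast
  from r(3)[unfolded forces_mem_def, rule_format, OF this]
  obtain q' where q': "q' \<epsilon> P" "le q' r" "\<exists>y ra. V.pair y ra \<epsilon> t \<and> ra \<epsilon> P \<and> le q' ra \<and> forces_eq q' s y"
    by blast
  have "le q' q" using le_trans q' r q by blast
  then show "\<exists>q'. q' \<epsilon> P \<and> le q' q \<and> (\<exists>y r. V.pair y r \<epsilon> t \<and> r \<epsilon> P \<and> le q' r \<and> forces_eq q' s y)"
    using q' by blast
qed

section \<open>Forcing arbitrary formulas\<close>

fun forces :: "'v \<Rightarrow> (nat \<Rightarrow> 'v) \<Rightarrow> fm \<Rightarrow> bool" where
  "forces p e (Mem m n) = forces_mem p (e m) (e n)"
| "forces p e (Eq m n) = forces_eq p (e m) (e n)"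
| "forces p e (Neg f) = (\<forall>q. q \<epsilon> P \<and> le q p \<longrightarrow> \<not> forces q e f)"
| "forces p e (Conj f g) = (forces p e f \<and> forces p e g)"
| "forces p e (All n f) = (\<forall>x. forces p (e(n := x)) f)"

lemma forces_le: "forces p e f \<Longrightarrow> le q p \<Longrightarrow> q \<epsilon> P \<Longrightarrow> p \<epsilon> P \<Longrightarrow> forces q e f"
proof (induction f arbitrary: e)
  case (Neg f)
  then show ?case using le_trans unfolding forces.simps by blast
next
  case (Conj f g)
  then show ?case unfolding forces.simps by blast
next
  case (All n f)
  then show ?case unfolding forces.simps by blast
qed (simp_all add: forces_mem_le forces_eq_le)

text \<open>Read contrapositively, this serves the quantifier case of the truth lemma: if
  \<open>p\<close> does not force an instance, some \<open>q\<close> below \<open>p\<close> has no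
  extension forcing it.\<close>

lemma forces_dense:
  assumes "p \<epsilon> P" "\<And>q. q \<epsilon> P \<Longrightarrow> le q p \<Longrightarrow> \<exists>r. r \<epsilon> P \<and> le r q \<and> forces r e f"
  shows "forces p e f"
  using assms(2)
proof (induction f arbitrary: e)
  case (Mem m n)
  show ?case unfolding forces.simps
    by (rule forces_mem_dense[OF assms(1)]) (use Mem[unfolded forces.simps] in blast)
next
  case (Eq m n)
  show ?case unfolding forces.simps
    by (rule forces_eq_dense[OF assms(1)]) (use Eq[unfolded forces.simps] in blast)
next
  case (Neg f)
  show ?case unfolding forces.simps
  proof (intro allI impI notI)
    fix q assume q: "q \<epsilon> P \<and> le q p" and f: "forces q e f"
    obtain r where r: "r \<epsilon> P" "le r q" "forces r e (Neg f)" using Neg.prems q by blast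
    then have "\<not> forces r e f" using le_refl unfolding forces.simps by blast
    then show False using forces_le[OF f r(2,1)] q by blast
  qed
next
  case (Conj f g)
  have "forces p e f" by (rule Conj.IH(1)) (use Conj.prems[unfolded forces.simps] in blast)
  moreover have "forces p e g" by (rule Conj.IH(2)) (use Conj.prems[unfolded forces.simps] in blast)
  ultimately show ?case by simp
next
  case (All n f)
  have "forces p (e(n := x)) f" for x
    by (rule All.IH) (use All.prems[unfolded forces.simps] in blast)
  then show ?case by simp
qed

lemma dterm_inst: "V.dterm (\<lambda>e. V.inst \<rho> e k)"
  by (cases "\<rho> k") (simp_all add: V.inst_def V.dterm_var V.dterm_const)

text \<open>An induction outside the model, which gives one definition for each formula
  \<open>f\<close>. The variable \<open>j\<close> of the condition and the parameter map
  \<open>\<rho>\<close> are general because the quantifiers in the clauses for \<open>Neg\<close>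
  and \<open>All\<close> shift the assignment.\<close>

lemma dfn_forces: "V.dfn (\<lambda>e. forces (e j) (V.inst \<rho> e) f)"
proof (induction f arbitrary: j \<rho>)
  case (Mem m n)
  show ?case unfolding forces.simps by (intro dfn_intros dterm_inst)
next
  case (Eq m n)
  show ?case unfolding forces.simps by (intro dfn_intros dterm_inst)
next
  case (Neg f)
  have "V.dfn (\<lambda>e. forces (e 0) (V.inst \<rho> (\<lambda>k. e (Suc k))) f)"
  proof -
    have "V.inst \<rho> (\<lambda>k. e (Suc k)) = V.inst (\<lambda>k. map_sum Suc id (\<rho> k)) e" for e
      by (rule ext) (auto simp: V.inst_def split: sum.splits)
    then show ?thesis using Neg by simp
  qed
  then show ?case unfolding forces.simps by (intro dfn_intros)
next
  case (Conj f g)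
  then show ?case unfolding forces.simps by (intro dfn_intros)
next
  case (All n f)
  have "V.dfn (\<lambda>e. forces (e (Suc j)) ((V.inst \<rho> (\<lambda>k. e (Suc k)))(n := e 0)) f)"
  proof -
    have "(V.inst \<rho> (\<lambda>k. e (Suc k)))(n := e 0) =
      V.inst (\<lambda>k. if k = n then Inl 0 else map_sum Suc id (\<rho> k)) e" for e
      by (rule ext) (auto simp: V.inst_def split: sum.splits)
    then show ?thesis using All by simp
  qed
  then show ?case unfolding forces.simps by (rule V.dfn_All)
qed

lemma dfn_forces_const: "V.dfn (\<lambda>e. forces (e 0) e' f)"
proof -
  have "V.inst (\<lambda>k. Inr (e' k)) e = e'" for e by (rule ext) (simp add: V.inst_def)
  then show ?thesis using dfn_forces[of 0 "\<lambda>k. Inr (e' k)" f] by simp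
qed

lemma val_in_VG: "val s \<in> VG"
  by (simp add: VG_def)

lemma ball_VG: "(\<forall>X\<in>VG. \<phi> X) \<longleftrightarrow> (\<forall>x. \<phi> (val x))"
  by (simp add: VG_def)

lemma forces_truth: "VG.sat (\<lambda>k. val (e k)) f \<longleftrightarrow> (\<exists>p\<in>G. forces p e f)"
proof (induction f arbitrary: e)
  case (Mem m n)
  show ?case by (simp add: forces_mem_truth)
next
  case (Eq m n)
  show ?case by (simp add: val_eq_iff name_eq_iff)
next
  case (Neg f)
  have "\<exists>p\<in>G. forces p e f \<or> forces p e (Neg f)"
  proof (rule generic_dense)
    show "V.dfn (\<lambda>x. forces (x 0) e f \<or> forces (x 0) e (Neg f))" by (intro dfn_intros dfn_forces_const)
    fix p assume "p \<epsilon> P"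
    then show "\<exists>r. r \<epsilon> P \<and> le r p \<and> (forces r e f \<or> forces r e (Neg f))"
      using le_refl unfolding forces.simps by blast
  qed
  moreover have False if f: "forces p e f" "p \<in> G" and n: "forces q e (Neg f)" "q \<in> G" for p q
  proof -
    obtain r where r: "r \<in> G" "le r p" "le r q" using G_directed[OF f(2) n(2)] by blast
    then have "forces r e f" using forces_le[OF f(1)] f(2) G_P by blast
    then show False using n(1) r G_P unfolding forces.simps by blast
  qed
  ultimately have "(\<exists>p\<in>G. forces p e (Neg f)) \<longleftrightarrow> \<not> (\<exists>p\<in>G. forces p e f)" by blast
  then show ?case using Neg by simp
next
  case (Conj f g)
  have "(\<exists>p\<in>G. forces p e (Conj f g)) \<longleftrightarrow> (\<exists>p\<in>G. forces p e f) \<and> (\<exists>p\<in>G. forces p e g)"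
  proof
    assume "(\<exists>p\<in>G. forces p e f) \<and> (\<exists>p\<in>G. forces p e g)"
    then obtain p q where p: "p \<in> G" "forces p e f" and q: "q \<in> G" "forces q e g" by blast
    obtain r where r: "r \<in> G" "le r p" "le r q" using G_directed[OF p(1) q(1)] by blast
    have "forces r e f" "forces r e g" using forces_le p q r G_P by blast+
    then show "\<exists>p\<in>G. forces p e (Conj f g)" using r(1) by auto
  qed auto
  then show ?case using Conj by simp
next
  case (All n f)
  have upd: "(\<lambda>k. val (e k))(n := val x) = (\<lambda>k. val ((e(n := x)) k))" for x
    by (rule ext) simp
  have "VG.sat (\<lambda>k. val (e k)) (All n f) \<longleftrightarrow> (\<forall>x. VG.sat (\<lambda>k. val ((e(n := x)) k)) f)"
    unfolding VG.sat.simps upd[symmetric] ball_VG ..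
  also have "\<dots> \<longleftrightarrow> (\<forall>x. \<exists>p\<in>G. forces p (e(n := x)) f)" unfolding All ..
  also have "\<dots> \<longleftrightarrow> (\<exists>p\<in>G. forces p e (All n f))"
  proof
    assume *: "\<forall>x. \<exists>p\<in>G. forces p (e(n := x)) f"
    \<comment> \<open>Each instance is forced by a condition of its own. A single condition is found
      because every condition either forces the universal formula or has an extension that excludes
      one instance \<open>x\<close> for good; the latter cannot happen in \<open>G\<close>.\<close>
    have "\<exists>p\<in>G. forces p e (All n f) \<or> (\<exists>x. \<forall>q. q \<epsilon> P \<and> le q p \<longrightarrow> \<not> forces q (e(n := x)) f)"
    proof (rule generic_dense)
      have "V.dfn (\<lambda>x. forces (x 0) (e(n := x 1)) f)"
      proof -
        have "(e(n := x 1)) = V.inst (\<lambda>k. if k = n then Inl 1 else Inr (e k)) x" for x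
          by (rule ext) (simp add: V.inst_def)
        then show ?thesis using dfn_forces[of 0 "\<lambda>k. if k = n then Inl 1 else Inr (e k)" f] by simp
      qed
      then have dfn: "V.dfn (\<lambda>y. forces (a y) (e(n := b y)) f)" if "V.dterm a" "V.dterm b" for a b
        by (rule V.dfn_subst2[where Q="\<lambda>p x. forces p (e(n := x)) f", OF _ that])
      show "V.dfn (\<lambda>y. forces (y 0) e (All n f) \<or>
          (\<exists>x. \<forall>q. q \<epsilon> P \<and> le q (y 0) \<longrightarrow> \<not> forces q (e(n := x)) f))"
        by (intro dfn_intros dfn_forces_const dfn)
      fix p assume p: "p \<epsilon> P"
      show "\<exists>r. r \<epsilon> P \<and> le r p \<and> (forces r e (All n f) \<or>
          (\<exists>x. \<forall>q. q \<epsilon> P \<and> le q r \<longrightarrow> \<not> forces q (e(n := x)) f))"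
      proof (cases "forces p e (All n f)")
        case True
        then show ?thesis using p le_refl by blast
      next
        case False
        then obtain x where "\<not> forces p (e(n := x)) f" by auto
        then have "\<exists>q. q \<epsilon> P \<and> le q p \<and> \<not> (\<exists>r. r \<epsilon> P \<and> le r q \<and> forces r (e(n := x)) f)"
          using forces_dense[OF p] by blast
        then show ?thesis by blast
      qed
    qed
    then obtain p where p: "p \<in> G" "forces p e (All n f) \<or> (\<exists>x. \<forall>q. q \<epsilon> P \<and> le q p \<longrightarrow> \<not> forces q (e(n := x)) f)"
      by blast
    have False if x: "\<forall>q. q \<epsilon> P \<and> le q p \<longrightarrow> \<not> forces q (e(n := x)) f" for x
    proof -
      obtain q where q: "q \<in> G" "forces q (e(n := x)) f" using * by blast
      obtain r where r: "r \<in> G" "le r p" "le r q" using G_directed[OF p(1) q(1)] by blast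
      then have "forces r (e(n := x)) f" using forces_le[OF q(2)] G_P q(1) by blast
      then show False using x r G_P by blast
    qed
    then show "\<exists>p\<in>G. forces p e (All n f)" using p by blast
  qed auto
  finally show ?case .
qed

text \<open>Hides formulas, assignments and parameters: a definable predicate of the extension is
  traded for a relation \<open>F\<close> definable in the ground model. Unary predicates are treated
  with a dummy second argument.\<close>

theorem forcing_relation:
  assumes "VG.dfn (\<lambda>e. Q (e 0) (e 1))"
  shows "\<exists>F. V.dfn (\<lambda>e. F (e 0) (e 1) (e 2)) \<and>
    (\<forall>p q x y. F p x y \<longrightarrow> le q p \<longrightarrow> q \<epsilon> P \<longrightarrow> p \<epsilon> P \<longrightarrow> F q x y) \<and>
    (\<forall>x y. Q (val x) (val y) \<longleftrightarrow> (\<exists>p\<in>G. F p x y))"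
proof -
  obtain \<rho> f where \<rho>: "\<forall>k c. \<rho> k = Inr c \<longrightarrow> c \<in> VG"
    and f: "\<forall>e. range e \<subseteq> VG \<longrightarrow> Q (e 0) (e 1) = VG.sat (VG.inst \<rho> e) f"
    using assms by (rule VG.dfnE)
  have "\<forall>c. \<exists>s. c \<in> VG \<longrightarrow> c = val s" unfolding VG_def by blast
  \<comment> \<open>Parameters of the formula are sets of the extension; a name is chosen for each,
    so that they become parameters of \<open>F\<close> in the ground model.\<close>
  then obtain nm where nm: "\<forall>c. c \<in> VG \<longrightarrow> c = val (nm c)" by metis
  define e where "e x y k = (case \<rho> k of Inl i \<Rightarrow> if i = 0 then x else y | Inr c \<Rightarrow> nm c)" for x y k
  define F where "F p x y \<longleftrightarrow> forces p (e x y) f" for p x y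
  show ?thesis
  proof (intro exI[of _ F] conjI allI impI)
    let ?\<sigma> = "\<lambda>k. case \<rho> k of Inl i \<Rightarrow> Inl (if i = 0 then 1 else 2) | Inr c \<Rightarrow> Inr (nm c)"
    have "e (x 1) (x 2) = V.inst ?\<sigma> x" for x
      by (rule ext) (auto simp: V.inst_def e_def split: sum.splits)
    then show "V.dfn (\<lambda>e. F (e 0) (e 1) (e 2))"
      unfolding F_def using dfn_forces[of 0 ?\<sigma> f] by simp
    show "F q x y" if "F p x y" "le q p" "q \<epsilon> P" "p \<epsilon> P" for p q x y
      using forces_le that unfolding F_def by blast
    show "Q (val x) (val y) \<longleftrightarrow> (\<exists>p\<in>G. F p x y)" for x y
    proof -
      let ?e = "\<lambda>i::nat. if i = 0 then val x else val y"
      have "range ?e \<subseteq> VG" using val_in_VG by auto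
      from f[rule_format, OF this] have "Q (val x) (val y) = VG.sat (VG.inst \<rho> ?e) f" by simp
      also have "VG.inst \<rho> ?e = (\<lambda>k. val (e x y k))"
        by (rule ext) (use \<rho> nm in \<open>auto simp: VG.inst_def e_def split: sum.splits\<close>)
      finally show ?thesis unfolding forces_truth F_def .
    qed
  qed
qed

end

subsection \<open>Ground model sets in the extension\<close>

context generic_extension
begin

text \<open>
  \<open>check\<close> is defined by recursion outside the ground model; \<open>is_check\<close> describes its graph by
  elements of the ground model, which makes it definable there.
\<close>

definition check_approx :: "'v \<Rightarrow> bool" where
  "check_approx g \<longleftrightarrow>
     (\<forall>y c. V.pair y c \<epsilon> g \<longrightarrow>
        (\<forall>x. x \<epsilon> y \<longrightarrow> (\<exists>d. V.pair x d \<epsilon> g)) \<and>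
        (\<forall>z. z \<epsilon> c \<longleftrightarrow> (\<exists>x d p. x \<epsilon> y \<and> V.pair x d \<epsilon> g \<and> p \<epsilon> P \<and> z = V.pair d p)))"

definition is_check :: "'v \<Rightarrow> 'v \<Rightarrow> bool" where
  "is_check x c \<longleftrightarrow> (\<exists>g. check_approx g \<and> V.pair x c \<epsilon> g)"

lemma dfn_is_check [dfn_intros]:
  assumes "V.dterm a" "V.dterm b"
  shows "V.dfn (\<lambda>e. is_check (a e) (b e))"
  by (rule V.dfn_subst2[where Q=is_check, OF _ assms])
    (unfold is_check_def check_approx_def, intro dfn_intros)

lemma check_approxD:
  assumes "check_approx g" "V.pair y c \<epsilon> g"
  shows "x \<epsilon> y \<Longrightarrow> \<exists>d. V.pair x d \<epsilon> g"
    and "z \<epsilon> c \<longleftrightarrow> (\<exists>x d p. x \<epsilon> y \<and> V.pair x d \<epsilon> g \<and> p \<epsilon> P \<and> z = V.pair d p)"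
  using assms unfolding check_approx_def by simp_all

lemma check_approx_unique:
  assumes g: "check_approx g" and g': "check_approx g'"
  shows "V.pair x c \<epsilon> g \<Longrightarrow> V.pair x c' \<epsilon> g' \<Longrightarrow> c = c'"
  using wf
proof (induction x arbitrary: c c' rule: wfp_induct_rule)
  case (less x)
  have "V.pair y d \<epsilon> g \<longleftrightarrow> V.pair y d \<epsilon> g'" if y: "y \<epsilon> x" for y d
  proof -
    obtain a where a: "V.pair y a \<epsilon> g" using check_approxD(1)[OF g less.prems(1) y] by blast
    obtain b where b: "V.pair y b \<epsilon> g'" using check_approxD(1)[OF g' less.prems(2) y] by blast
    have "a = b" using less.IH[OF y a b] .
    show ?thesis
    proof
      assume d: "V.pair y d \<epsilon> g"
      then have "d = b" using less.IH[OF y d b] by blast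
      then show "V.pair y d \<epsilon> g'" using b by simp
    next
      assume d: "V.pair y d \<epsilon> g'"
      then have "a = d" using less.IH[OF y a d] by blast
      then show "V.pair y d \<epsilon> g" using a by simp
    qed
  qed
  then have *: "(y \<epsilon> x \<and> V.pair y d \<epsilon> g \<and> r) \<longleftrightarrow> (y \<epsilon> x \<and> V.pair y d \<epsilon> g' \<and> r)" for y d r by blast
  show ?case
    by (rule V.set_eqI) (unfold check_approxD(2)[OF g less.prems(1)] check_approxD(2)[OF g' less.prems(2)] *, rule refl)
qed

lemma is_check_unique: "is_check x c \<Longrightarrow> is_check x c' \<Longrightarrow> c = c'"
  unfolding is_check_def using check_approx_unique by blast

text \<open>Replacement collects the graph of \<open>is_check\<close> on a transitive set
  \<open>M\<close> including \<open>x\<close>. Existence is not yet known on all of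
  \<open>M\<close>, so \<open>g\<close> may cover only part of it; it is still an approximation,
  because an approximation defined at \<open>y\<close> is defined at all elements of
  \<open>y\<close>. By induction \<open>g\<close> covers the elements of \<open>x\<close>, and a
  value at \<open>x\<close> can be added.\<close>

lemma ex_is_check: "\<exists>c. is_check x c"
  using wf
proof (induction x rule: wfp_induct_rule)
  case (less x)
  obtain M where M: "V.transitive M" "V.sub x M" using V.ex_transitive by blast
  have "\<exists>g. \<forall>z. z \<epsilon> g \<longleftrightarrow> (\<exists>y. y \<epsilon> M \<and> (\<exists>c. is_check y c \<and> z = V.pair y c))"
  proof (rule V.ex_Repl)
    show "V.dfn (\<lambda>e. \<exists>c. is_check (e 0) c \<and> e 1 = V.pair (e 0) c)" by (intro dfn_intros)
  qed (use is_check_unique in blast)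
  then obtain g where g: "\<forall>z. z \<epsilon> g \<longleftrightarrow> (\<exists>y. y \<epsilon> M \<and> (\<exists>c. is_check y c \<and> z = V.pair y c))" ..
  have mem_g: "V.pair y c \<epsilon> g \<longleftrightarrow> y \<epsilon> M \<and> is_check y c" for y c
    using g[rule_format, of "V.pair y c"] by auto
  have approx_g: "check_approx g"
    unfolding check_approx_def
  proof (intro allI impI conjI)
    fix y c x assume y: "V.pair y c \<epsilon> g" and x: "x \<epsilon> y"
    then obtain g0 where g0: "check_approx g0" "V.pair y c \<epsilon> g0" unfolding mem_g is_check_def by blast
    obtain d where "V.pair x d \<epsilon> g0" using check_approxD(1)[OF g0 x] by blast
    then have "is_check x d" using g0(1) unfolding is_check_def by blast
    moreover have "x \<epsilon> M" using M(1) x y unfolding mem_g V.transitive_def by blast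
    ultimately show "\<exists>d. V.pair x d \<epsilon> g" unfolding mem_g by blast
  next
    fix y c z assume y: "V.pair y c \<epsilon> g"
    then obtain g0 where g0: "check_approx g0" "V.pair y c \<epsilon> g0" unfolding mem_g is_check_def by blast
    have "V.pair x d \<epsilon> g0 \<longleftrightarrow> V.pair x d \<epsilon> g" if x: "x \<epsilon> y" for x d
    proof -
      have xM: "x \<epsilon> M" using M(1) x y unfolding mem_g V.transitive_def by blast
      obtain d' where d': "V.pair x d' \<epsilon> g0" using check_approxD(1)[OF g0 x] by blast
      then have ck: "is_check x d'" using g0(1) unfolding is_check_def by blast
      show ?thesis
      proof
        assume "V.pair x d \<epsilon> g0"
        then show "V.pair x d \<epsilon> g" using g0(1) xM unfolding mem_g is_check_def by blast
      next
        assume "V.pair x d \<epsilon> g"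
        then have "d = d'" using is_check_unique ck unfolding mem_g by blast
        then show "V.pair x d \<epsilon> g0" using d' by simp
      qed
    qed
    then have *: "(x \<epsilon> y \<and> V.pair x d \<epsilon> g0 \<and> r) \<longleftrightarrow> (x \<epsilon> y \<and> V.pair x d \<epsilon> g \<and> r)" for x d r by blast
    show "z \<epsilon> c \<longleftrightarrow> (\<exists>x d p. x \<epsilon> y \<and> V.pair x d \<epsilon> g \<and> p \<epsilon> P \<and> z = V.pair d p)"
      using check_approxD(2)[OF g0, of z] unfolding * .
  qed
  have dom_g: "\<exists>d. V.pair y d \<epsilon> g" if "y \<epsilon> x" for y
    using less[OF that] M(2) that unfolding mem_g V.sub_def by blast
  show ?case
  proof (cases "\<exists>c. V.pair x c \<epsilon> g")
    case True
    then show ?thesis using approx_g unfolding is_check_def by blast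
  next
    case False
    have "\<exists>c. \<forall>z. z \<epsilon> c \<longleftrightarrow> (\<exists>w. w \<epsilon> V.prod x P \<and> (\<exists>y d p. w = V.pair y p \<and> V.pair y d \<epsilon> g \<and> z = V.pair d p))"
    proof (rule V.ex_Repl)
      show "V.dfn (\<lambda>e. \<exists>y d p. e 0 = V.pair y p \<and> V.pair y d \<epsilon> g \<and> e 1 = V.pair d p)" by (intro dfn_intros)
      fix w z z' assume "\<exists>y d p. w = V.pair y p \<and> V.pair y d \<epsilon> g \<and> z = V.pair d p"
        "\<exists>y d p. w = V.pair y p \<and> V.pair y d \<epsilon> g \<and> z' = V.pair d p"
      then obtain y d p y' d' p' where "w = V.pair y p" "V.pair y d \<epsilon> g" "z = V.pair d p"
        "w = V.pair y' p'" "V.pair y' d' \<epsilon> g" "z' = V.pair d' p'" by blast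
      moreover from this have "y' = y" "p' = p" by simp_all
      ultimately show "z = z'" using check_approx_unique[OF approx_g approx_g] by blast
    qed
    then obtain c where "\<forall>z. z \<epsilon> c \<longleftrightarrow> (\<exists>w. w \<epsilon> V.prod x P \<and> (\<exists>y d p. w = V.pair y p \<and> V.pair y d \<epsilon> g \<and> z = V.pair d p))" ..
    then have c: "z \<epsilon> c \<longleftrightarrow> (\<exists>y d p. y \<epsilon> x \<and> V.pair y d \<epsilon> g \<and> p \<epsilon> P \<and> z = V.pair d p)" for z
      unfolding V.mem_prod by (metis V.pair_inject)
    obtain g' where "\<forall>z. z \<epsilon> g' \<longleftrightarrow> z \<epsilon> g \<or> z = V.pair x c" using V.ex_insert by blast
    then have g': "V.pair y d \<epsilon> g' \<longleftrightarrow> V.pair y d \<epsilon> g \<or> y = x \<and> d = c" for y d by simp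
    \<comment> \<open>The new pair does not disturb the clauses of the old ones: \<open>x\<close> is
      outside the domain of \<open>g\<close>, hence not an element of any member of that domain, and
      it is not an element of itself.\<close>
    have same: "V.pair u d \<epsilon> g' \<longleftrightarrow> V.pair u d \<epsilon> g" if "u \<epsilon> y" "y = x \<or> V.pair y b \<epsilon> g" for u d y b
    proof -
      have "u \<noteq> x"
        using that V.not_mem_self check_approxD(1)[OF approx_g] False by blast
      then show ?thesis unfolding g' by simp
    qed
    have "check_approx g'"
      unfolding check_approx_def
    proof (intro allI impI conjI)
      fix y b u assume y: "V.pair y b \<epsilon> g'" and u: "u \<epsilon> y"
      have "\<exists>d. V.pair u d \<epsilon> g"
      proof (cases "V.pair y b \<epsilon> g")
        case True
        then show ?thesis using check_approxD(1)[OF approx_g _ u] by blast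
      next
        case False
        then have "y = x" using y unfolding g' by simp
        then show ?thesis using dom_g u by simp
      qed
      then show "\<exists>d. V.pair u d \<epsilon> g'" unfolding g' by blast
    next
      fix y b z assume y: "V.pair y b \<epsilon> g'"
      then have "y = x \<or> V.pair y b \<epsilon> g" unfolding g' by blast
      then have *: "(u \<epsilon> y \<and> V.pair u d \<epsilon> g' \<and> r) \<longleftrightarrow> (u \<epsilon> y \<and> V.pair u d \<epsilon> g \<and> r)" for u d r
        using same[of u y b d] by blast
      show "z \<epsilon> b \<longleftrightarrow> (\<exists>x d p. x \<epsilon> y \<and> V.pair x d \<epsilon> g' \<and> p \<epsilon> P \<and> z = V.pair d p)"
      proof (cases "V.pair y b \<epsilon> g")
        case True
        show ?thesis unfolding * by (rule check_approxD(2)[OF approx_g True])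
      next
        case False
        then have "y = x" "b = c" using y unfolding g' by simp_all
        then show ?thesis unfolding * using c by simp
      qed
    qed
    moreover have "V.pair x c \<epsilon> g'" unfolding g' by simp
    ultimately show ?thesis unfolding is_check_def by blast
  qed
qed

lemma check_unfold: "check x = (THE c. \<forall>z. z \<epsilon> c \<longleftrightarrow> (\<exists>y p. y \<epsilon> x \<and> p \<epsilon> P \<and> z = V.pair (check y) p))"
proof -
  have "wf {(y, x). y \<epsilon> x}" using wf by (simp add: wfp_def)
  from def_wfrec[OF eq_reflection[OF check_def] this, of x] show ?thesis
    unfolding V.is_pair_iff by (simp add: cut_def cong: conj_cong)
qed

text \<open>The description in \<open>check_unfold\<close> denotes only if the described set exists;
  the value of an approximation at \<open>x\<close> is such a set.\<close>

lemma is_check_check: "is_check x (check x)"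
  using wf
proof (induction x rule: wfp_induct_rule)
  case (less x)
  obtain c where c: "is_check x c" using ex_is_check by blast
  then obtain g where g: "check_approx g" "V.pair x c \<epsilon> g" unfolding is_check_def by blast
  have "V.pair y d \<epsilon> g \<longleftrightarrow> d = check y" if y: "y \<epsilon> x" for y d
  proof -
    have *: "d = check y" if "V.pair y d \<epsilon> g" for d
      using is_check_unique[OF _ less[OF y]] g(1) that unfolding is_check_def by blast
    obtain d' where "V.pair y d' \<epsilon> g" using check_approxD(1)[OF g y] by blast
    then show ?thesis using * by blast
  qed
  then have *: "(y \<epsilon> x \<and> V.pair y d \<epsilon> g \<and> r) \<longleftrightarrow> (y \<epsilon> x \<and> d = check y \<and> r)" for y d r by blast
  have spec: "\<forall>z. z \<epsilon> c \<longleftrightarrow> (\<exists>y p. y \<epsilon> x \<and> p \<epsilon> P \<and> z = V.pair (check y) p)"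
    unfolding check_approxD(2)[OF g] * by blast
  have "check x = c"
    unfolding check_unfold[of x]
  proof (rule the_equality)
    fix c' assume "\<forall>z. z \<epsilon> c' \<longleftrightarrow> (\<exists>y p. y \<epsilon> x \<and> p \<epsilon> P \<and> z = V.pair (check y) p)"
    then show "c' = c" using spec by (intro V.set_eqI) simp
  qed (rule spec)
  then show ?case using c by simp
qed

lemma mem_check: "z \<epsilon> check x \<longleftrightarrow> (\<exists>y p. y \<epsilon> x \<and> p \<epsilon> P \<and> z = V.pair (check y) p)"
proof -
  obtain g where g: "check_approx g" "V.pair x (check x) \<epsilon> g"
    using is_check_check unfolding is_check_def by blast
  have "V.pair y d \<epsilon> g \<longleftrightarrow> d = check y" if y: "y \<epsilon> x" for y d
  proof -
    have *: "d = check y" if "V.pair y d \<epsilon> g" for d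
      using is_check_unique[OF _ is_check_check] g(1) that unfolding is_check_def by blast
    obtain d' where "V.pair y d' \<epsilon> g" using check_approxD(1)[OF g y] by blast
    then show ?thesis using * by blast
  qed
  then have *: "(y \<epsilon> x \<and> V.pair y d \<epsilon> g \<and> r) \<longleftrightarrow> (y \<epsilon> x \<and> d = check y \<and> r)" for y d r by blast
  show ?thesis unfolding check_approxD(2)[OF g] * by blast
qed

lemma dterm_check [dfn_intros]:
  assumes "V.dterm a"
  shows "V.dterm (\<lambda>e. check (a e))"
proof -
  have "is_check x c \<longleftrightarrow> c = check x" for x c
    using is_check_unique is_check_check by blast
  moreover have "V.dfn (\<lambda>e. is_check (a (\<lambda>k. e (Suc k))) (e 0))"
    by (rule dfn_is_check) (rule V.dterm_rename[OF assms, of Suc] V.dterm_var)+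
  ultimately show ?thesis unfolding V.dterm_def by simp
qed

section \<open>The ground model as a transitive part of the extension\<close>

lemma ground_in_VG [simp]: "ground x \<in> VG"
  by (simp add: ground_def VG_def)

lemma memG_in_VG: "memG X Y \<Longrightarrow> X \<in> VG"
  by (auto simp: memG_def VG_def)

lemma mem_ground: "memG X (ground x) \<longleftrightarrow> (\<exists>y. y \<epsilon> x \<and> X = ground y)"
  unfolding ground_def memG_val elem_name_iff mem_check V.pair_inject using G_P G_nonempty by blast

lemma ground_inject [simp]: "ground x = ground y \<longleftrightarrow> x = y"
proof
  show "ground x = ground y \<Longrightarrow> x = y"
    using wf
  proof (induction x arbitrary: y rule: wfp_induct_rule)
    case (less x)
    show ?case
    proof (rule V.set_eqI)
      fix z
      have "memG (ground z) (ground x) \<longleftrightarrow> memG (ground z) (ground y)" using less.prems by simp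
      then have *: "(\<exists>w. w \<epsilon> x \<and> ground z = ground w) \<longleftrightarrow> (\<exists>w. w \<epsilon> y \<and> ground z = ground w)"
        unfolding mem_ground .
      show "z \<epsilon> x \<longleftrightarrow> z \<epsilon> y"
      proof
        assume z: "z \<epsilon> x"
        then obtain w where "w \<epsilon> y" "ground z = ground w" using * by blast
        then show "z \<epsilon> y" using less.IH[OF z] by blast
      next
        assume z: "z \<epsilon> y"
        then obtain w where w: "w \<epsilon> x" "ground w = ground z" using * by metis
        then have "w = z" using less.IH[OF w] by blast
        then show "z \<epsilon> x" using w(1) by simp
      qed
    qed
  qed
qed simp

lemma ground_mem_ground [simp]: "memG (ground x) (ground y) \<longleftrightarrow> x \<epsilon> y"
  unfolding mem_ground by auto

lemma is_upair_ground: "VG.is_upair (ground z) (ground x) (ground y) \<longleftrightarrow> V.is_upair z x y"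
proof
  assume "VG.is_upair (ground z) (ground x) (ground y)"
  then have "memG (ground w) (ground z) \<longleftrightarrow> ground w = ground x \<or> ground w = ground y" for w
    unfolding VG.is_upair_def by (rule bspec[OF _ ground_in_VG])
  then show "V.is_upair z x y" unfolding V.is_upair_def by simp
next
  assume "V.is_upair z x y"
  then show "VG.is_upair (ground z) (ground x) (ground y)"
    unfolding V.is_upair_def VG.is_upair_def mem_ground by simp metis
qed

text \<open>Elements of ground sets are ground sets by \<open>mem_ground\<close>, so a pair that is
  a ground set has ground components; this is why \<open>X\<close> and \<open>Y\<close> range over
  all of \<open>VG\<close>.\<close>

lemma is_pair_ground:
  assumes "X \<in> VG" "Y \<in> VG"
  shows "VG.is_pair (ground z) X Y \<longleftrightarrow> (\<exists>x y. X = ground x \<and> Y = ground y \<and> z = V.pair x y)"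
proof
  assume "VG.is_pair (ground z) X Y"
  then obtain A B where A: "A \<in> VG" "VG.is_upair A X X" and B: "B \<in> VG" "VG.is_upair B X Y"
    and AB: "VG.is_upair (ground z) A B" unfolding VG.is_pair_def by blast
  have "memG A (ground z)" "memG B (ground z)" using AB A B unfolding VG.is_upair_def by blast+
  then obtain a b where ab: "A = ground a" "B = ground b" unfolding mem_ground by blast
  have XY: "X = ground x \<longrightarrow> Y = ground y \<longrightarrow> z = V.pair x y" for x y
  proof (intro impI)
    assume "X = ground x" "Y = ground y"
    then have "V.is_upair a x x" "V.is_upair b x y" "V.is_upair z a b"
      using A B AB unfolding ab by (simp_all add: is_upair_ground)
    then show "z = V.pair x y" unfolding V.is_pair_iff[symmetric] V.is_pair_def by blast
  qed
  have "memG X B" "memG Y B" using B assms unfolding VG.is_upair_def by blast+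
  then show "\<exists>x y. X = ground x \<and> Y = ground y \<and> z = V.pair x y"
    using XY unfolding ab mem_ground by blast
next
  assume "\<exists>x y. X = ground x \<and> Y = ground y \<and> z = V.pair x y"
  then obtain x y where xy: "X = ground x" "Y = ground y" "V.is_pair z x y" unfolding V.is_pair_iff by blast
  then obtain a b where "V.is_upair a x x" "V.is_upair b x y" "V.is_upair z a b"
    unfolding V.is_pair_def by blast
  then show "VG.is_pair (ground z) X Y"
    unfolding VG.is_pair_def xy using is_upair_ground ground_in_VG by blast
qed

end

subsection \<open>The generated ultrafilter\<close>

context generic_extension
begin

lemma app_ground:
  assumes "X \<in> VG" "Y \<in> VG"
  shows "VG.app (ground f) X Y \<longleftrightarrow> (\<exists>x y. X = ground x \<and> Y = ground y \<and> V.app f x y)"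
proof
  assume "VG.app (ground f) X Y"
  then obtain Z where Z: "memG Z (ground f)" "VG.is_pair Z X Y" unfolding VG.app_def by blast
  then obtain z where z: "z \<epsilon> f" "Z = ground z" unfolding mem_ground by blast
  then obtain x y where "X = ground x" "Y = ground y" "z = V.pair x y"
    using Z(2) is_pair_ground[OF assms] by blast
  then show "\<exists>x y. X = ground x \<and> Y = ground y \<and> V.app f x y" unfolding V.app_iff using z(1) by blast
next
  assume "\<exists>x y. X = ground x \<and> Y = ground y \<and> V.app f x y"
  then obtain x y where xy: "X = ground x" "Y = ground y" "V.pair x y \<epsilon> f" unfolding V.app_iff by blast
  then have "VG.is_pair (ground (V.pair x y)) X Y" using is_pair_ground[OF assms] by blast
  moreover have "memG (ground (V.pair x y)) (ground f)" using xy by simp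
  ultimately show "VG.app (ground f) X Y" unfolding VG.app_def using ground_in_VG by blast
qed

lemma app_ground_ground [simp]: "VG.app (ground f) (ground x) (ground y) \<longleftrightarrow> V.app f x y"
  using app_ground[OF ground_in_VG ground_in_VG] by auto

text \<open>Carries the index sequence found in the ground model to the extension; by
  \<open>app_ground\<close> its arguments and values there are ground sets.\<close>

lemma increasing_ground:
  assumes "V.increasing t b a"
  shows "VG.increasing (ground t) (ground b) (ground a)"
proof -
  have fun_t: "V.fun_on t b" and t_a: "\<And>x y. V.app t x y \<Longrightarrow> y \<epsilon> a"
    using assms unfolding V.increasing_def V.fun_to_def by blast+
  have inc: "m \<epsilon> n" if "x \<epsilon> y" "V.app t x m" "V.app t y n" for x y m n
    using assms that unfolding V.increasing_def by blast
  have "VG.fun_on (ground t) (ground b)"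
    unfolding VG.fun_on_def
  proof (intro conjI ballI impI)
    fix Z assume "memG Z (ground t)"
    then obtain z where z: "z \<epsilon> t" "Z = ground z" unfolding mem_ground by blast
    then obtain x y where xy: "x \<epsilon> b" "z = V.pair x y"
      using fun_t unfolding V.fun_on_def V.is_pair_iff by blast
    then have "VG.is_pair Z (ground x) (ground y)"
      unfolding z(2) is_pair_ground[OF ground_in_VG ground_in_VG] by blast
    moreover have "memG (ground x) (ground b)" using xy by simp
    ultimately show "\<exists>A\<in>VG. \<exists>B\<in>VG. memG A (ground b) \<and> VG.is_pair Z A B" using ground_in_VG by blast
  next
    fix X assume "memG X (ground b)"
    then obtain x where x: "x \<epsilon> b" "X = ground x" unfolding mem_ground by blast
    then obtain y where y: "V.app t x y" "\<And>y'. V.app t x y' \<Longrightarrow> y' = y"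
      using fun_t unfolding V.fun_on_def by blast
    show "\<exists>!Y. Y \<in> VG \<and> VG.app (ground t) X Y"
    proof (rule ex1I[of _ "ground y"])
      show "ground y \<in> VG \<and> VG.app (ground t) X (ground y)" using x y(1) by simp
      fix Y assume Y: "Y \<in> VG \<and> VG.app (ground t) X Y"
      then obtain x' y' where "X = ground x'" "Y = ground y'" "V.app t x' y'"
        using app_ground[of X Y t] x(2) by auto
      then show "Y = ground y" using y(2) x(2) by simp
    qed
  qed
  moreover have "memG Y (ground a)" if "X \<in> VG" "Y \<in> VG" "VG.app (ground t) X Y" for X Y
    using that app_ground[OF that(1,2)] t_a by auto
  moreover have "memG M N" if XY: "X \<in> VG" "Y \<in> VG" "M \<in> VG" "N \<in> VG"
    "memG X Y" "VG.app (ground t) X M" "VG.app (ground t) Y N" for X Y M N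
  proof -
    obtain x m where xm: "X = ground x" "M = ground m" "V.app t x m"
      using XY app_ground[of X M t] by blast
    obtain y n where yn: "Y = ground y" "N = ground n" "V.app t y n"
      using XY app_ground[of Y N t] by blast
    show ?thesis using inc[OF _ xm(3) yn(3)] XY(5) unfolding xm(1,2) yn(1,2) by simp
  qed
  ultimately show ?thesis unfolding VG.increasing_def VG.fun_to_def by blast
qed

text \<open>Separation in the extension for subsets of a ground set: the name consists of the pairs
  of \<open>check i\<close> and \<open>p\<close> such that \<open>p\<close> forces the predicate. It
  is a subset of \<open>check I\<close>, and the ground model has a set of all such names, which
  will bound the name of the filter.\<close>

lemma separation_ground:
  assumes "VG.dfn (\<lambda>e. Q (e 0))"
  shows "\<exists>\<tau>. V.sub \<tau> (check I) \<and> (\<forall>X. memG X (val \<tau>) \<longleftrightarrow> memG X (ground I) \<and> Q X)"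
proof -
  obtain F where F0: "V.dfn (\<lambda>e. F (e 0) (e 1) (e 2))"
    and Q0: "\<forall>x y. Q (val x) \<longleftrightarrow> (\<exists>p\<in>G. F p x y)"
    using forcing_relation[of "\<lambda>X Y. Q X", OF assms] by (elim exE conjE)
  note F = V.dfn_subst3[where Q=F, OF F0] and Q = Q0[rule_format]
  define \<tau> where "\<tau> = V.Sep (check I) (\<lambda>z. \<exists>t p. z = V.pair t p \<and> F p t t)"
  have "V.dfn (\<lambda>e. \<exists>t p. e 0 = V.pair t p \<and> F p t t)" by (intro dfn_intros F)
  note mem = V.mem_Sep[OF this, of _ "check I", folded \<tau>_def]
  have mem': "V.pair t p \<epsilon> \<tau> \<longleftrightarrow> (\<exists>i. i \<epsilon> I \<and> p \<epsilon> P \<and> t = check i) \<and> F p t t" for t p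
    unfolding mem mem_check V.pair_inject by blast
  have "memG X (val \<tau>) \<longleftrightarrow> memG X (ground I) \<and> Q X" for X
  proof
    assume "memG X (val \<tau>)"
    then obtain t p where t: "X = val t" "p \<in> G" "V.pair t p \<epsilon> \<tau>" unfolding memG_val elem_name_iff by blast
    then obtain i where i: "i \<epsilon> I" "t = check i" "F p t t" unfolding mem' by blast
    have "Q X" unfolding t(1) Q[of t t] using i(3) t(2) by blast
    moreover have "X = ground i" unfolding t(1) i(2) ground_def ..
    ultimately show "memG X (ground I) \<and> Q X" using i(1) by simp
  next
    assume *: "memG X (ground I) \<and> Q X"
    then obtain i where i: "i \<epsilon> I" "X = val (check i)" unfolding mem_ground unfolding ground_def by blast
    then have "Q (val (check i))" using * by simp
    then obtain p where p: "p \<in> G" "F p (check i) (check i)" unfolding Q[of "check i" "check i"] by blast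
    then have "V.pair (check i) p \<epsilon> \<tau>" unfolding mem' using i(1) G_P by blast
    then show "memG X (val \<tau>)" unfolding memG_val elem_name_iff using i(2) p(1) by blast
  qed
  moreover have "V.sub \<tau> (check I)" unfolding V.sub_def mem by blast
  ultimately show ?thesis by blast
qed

end

locale extended_ultrafilter = generic_extension E P L G
  for E :: "'v \<Rightarrow> 'v \<Rightarrow> bool" (infix "\<epsilon>" 50) and P L :: 'v and G :: "'v set" +
  fixes U I \<mu> \<pi> :: 'v
  assumes ultra: "V.ultrafilter U I"
    and crit: "V.critical_point U I \<mu>" and card_P: "V.has_card P \<pi>" and \<pi>_\<mu>: "\<pi> \<epsilon> \<mu>"
begin

sublocale V: ground_ultrafilter E U I
  by unfold_locales (rule ultra)

text \<open>Two variables are skipped because \<open>ae\<close> binds both the set \<open>X\<close>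
  and the index \<open>i\<close>, the latter being variable \<open>0\<close>.\<close>

lemma dfn_ae [dfn_intros]:
  assumes "V.dfn (\<lambda>e. \<phi> (e 0) (\<lambda>k. e (Suc (Suc k))))"
  shows "V.dfn (\<lambda>e. V.ae (\<lambda>i. \<phi> i e))"
  unfolding V.ae_def by (intro dfn_intros assms)

section \<open>The generated filter in the extension\<close>

definition generated_filter :: "'v set \<Rightarrow> bool" where
  "generated_filter W \<longleftrightarrow>
     (\<forall>X\<in>VG. memG X W \<longleftrightarrow> VG.sub X (ground I) \<and> V.ae (\<lambda>i. memG (ground i) X))"

text \<open>A member of \<open>ground U\<close> is \<open>ground B\<close> for some \<open>B\<close>
  in \<open>U\<close>, so a witness in the extension is already a witness for
  \<open>ae\<close>.\<close>

lemma ae_ground_iff: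
  assumes "VG.sub X (ground I)"
  shows "(\<exists>Y\<in>VG. memG Y (ground U) \<and> VG.sub Y X) \<longleftrightarrow> V.ae (\<lambda>i. memG (ground i) X)"
proof
  assume "\<exists>Y\<in>VG. memG Y (ground U) \<and> VG.sub Y X"
  then obtain B where B: "B \<epsilon> U" "VG.sub (ground B) X" unfolding mem_ground by blast
  have "i \<epsilon> I \<and> memG (ground i) X" if "i \<epsilon> B" for i
  proof -
    have "memG (ground i) (ground B)" using that by simp
    then have X: "memG (ground i) X" using B(2) ground_in_VG unfolding VG.sub_def by blast
    then have "memG (ground i) (ground I)" using assms ground_in_VG unfolding VG.sub_def by blast
    then show ?thesis using X by simp
  qed
  then show "V.ae (\<lambda>i. memG (ground i) X)" unfolding V.ae_def using B(1) by blast
next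
  assume "V.ae (\<lambda>i. memG (ground i) X)"
  then obtain B where B: "B \<epsilon> U" "\<forall>i. i \<epsilon> B \<longrightarrow> memG (ground i) X" unfolding V.ae_def by blast
  then have "memG (ground B) (ground U)" "VG.sub (ground B) X" unfolding VG.sub_def mem_ground by blast+
  then show "\<exists>Y\<in>VG. memG Y (ground U) \<and> VG.sub Y X" using ground_in_VG by blast
qed

lemma generated_iff: "generated W U I \<longleftrightarrow> generated_filter W"
  unfolding generated_def generated_filter_def using ae_ground_iff by blast

text \<open>The name pairs each \<open>t \<subseteq> check I\<close> with the conditions forcing its
  value into the filter. Bounding it by \<open>V.pow (check I)\<close> loses nothing: by
  \<open>separation_ground\<close> each subset of \<open>ground I\<close> in the extension has a
  name of this form.\<close>

lemma ex_generated: "\<exists>W\<in>VG. generated W U I"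
proof -
  let ?Q = "\<lambda>X. VG.sub X (ground I) \<and> (\<exists>Y\<in>VG. memG Y (ground U) \<and> VG.sub Y X)"
  have "VG.dfn (\<lambda>e. ?Q (e 0))" by (intro dfn_intros ground_in_VG)
  from forcing_relation[of "\<lambda>X Y. ?Q X", OF this]
  obtain F where F0: "V.dfn (\<lambda>e. F (e 0) (e 1) (e 2))"
    and Q0: "\<forall>x y. ?Q (val x) \<longleftrightarrow> (\<exists>p\<in>G. F p x y)"
    by (elim exE conjE)
  note F = V.dfn_subst3[where Q=F, OF F0] and Q = Q0[rule_format]
  define w where "w = V.Sep (V.prod (V.pow (check I)) P) (\<lambda>z. \<exists>t p. z = V.pair t p \<and> F p t t)"
  have "V.dfn (\<lambda>e. \<exists>t p. e 0 = V.pair t p \<and> F p t t)" by (intro dfn_intros F)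
  note mem = V.mem_Sep[OF this, of _ "V.prod (V.pow (check I)) P", folded w_def]
  have mem': "V.pair t p \<epsilon> w \<longleftrightarrow> V.sub t (check I) \<and> p \<epsilon> P \<and> F p t t" for t p
    unfolding mem V.pair_mem_prod V.mem_pow V.pair_inject by blast
  have "memG X (val w) \<longleftrightarrow> ?Q X" if X: "X \<in> VG" for X
  proof
    assume "memG X (val w)"
    then obtain t p where t: "X = val t" "p \<in> G" "V.pair t p \<epsilon> w" unfolding memG_val elem_name_iff by blast
    then have "F p t t" unfolding mem' by blast
    then show "?Q X" unfolding t(1) Q[of t t] using t(2) by blast
  next
    assume *: "?Q X"
    have "VG.dfn (\<lambda>e. memG (e 0) X)" by (intro dfn_intros X)
    from separation_ground[OF this, of I]
    obtain t where t: "V.sub t (check I)" "\<forall>Z. memG Z (val t) \<longleftrightarrow> memG Z (ground I) \<and> memG Z X"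
      by (elim exE conjE)
    have "memG Z (val t) \<longleftrightarrow> memG Z X" for Z
      unfolding t(2)[rule_format] using * memG_in_VG unfolding VG.sub_def by blast
    then have Xt: "X = val t"
      using VG_extensional X val_in_VG[of t] unfolding VG.extensionality_def by blast
    then have "?Q (val t)" using * by blast
    then obtain p where p: "p \<in> G" "F p t t" unfolding Q[of t t] by blast
    then have "V.pair t p \<epsilon> w" unfolding mem' using t(1) G_P by blast
    then show "memG X (val w)" unfolding memG_val elem_name_iff using Xt p(1) by blast
  qed
  then have "generated (val w) U I" unfolding generated_def by blast
  then show ?thesis using val_in_VG by blast
qed

text \<open>The collection of all \<open>i\<close> with \<open>memG (ground i) X\<close> need not be
  a set of the ground model, so \<open>ae_not\<close> does not apply to it. The dichotomy is found
  in the ground model instead, for the two definable ways in which one condition \<open>q\<close>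
  can decide membership.\<close>

lemma ae_decided:
  assumes X: "X \<in> VG"
  shows "V.ae (\<lambda>i. memG (ground i) X) \<or> V.ae (\<lambda>i. \<not> memG (ground i) X)"
proof -
  have "VG.dfn (\<lambda>e. memG (e 0) X)" by (intro dfn_intros X)
  from forcing_relation[of "\<lambda>Y Z. memG Y X", OF this]
  obtain F where F0: "V.dfn (\<lambda>e. F (e 0) (e 1) (e 2))"
    and F_le0: "\<forall>p q x y. F p x y \<longrightarrow> le q p \<longrightarrow> q \<epsilon> P \<longrightarrow> p \<epsilon> P \<longrightarrow> F q x y"
    and truth0: "\<forall>x y. memG (val x) X \<longleftrightarrow> (\<exists>p\<in>G. F p x y)"
    by (elim exE conjE)
  note F = V.dfn_subst3[where Q=F, OF F0] and F_le = F_le0[rule_format] and truth = truth0[rule_format]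
  let ?yes = "\<lambda>q i. F q (check i) (check i)"
  let ?no = "\<lambda>q i. \<forall>r. r \<epsilon> P \<and> le r q \<longrightarrow> \<not> F r (check i) (check i)"
  have "\<exists>q\<in>G. V.ae (?yes q) \<or> V.ae (?no q)"
  proof (rule generic_dense)
    show "V.dfn (\<lambda>e. V.ae (?yes (e 0)) \<or> V.ae (?no (e 0)))" by (intro dfn_intros F)
    fix p assume p: "p \<epsilon> P"
    \<comment> \<open>\<open>le q p\<close> is included in \<open>?R\<close> since the uniform
      condition is otherwise only known to lie in \<open>P\<close>; it is recovered because sets in
      \<open>U\<close> are nonempty.\<close>
    let ?R = "\<lambda>i q. le q p \<and> (?yes q i \<or> ?no q i)"
    have "\<exists>q. q \<epsilon> P \<and> V.ae (\<lambda>i. ?R i q)"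
    proof (rule V.ae_uniform_condition[OF crit card_P \<pi>_\<mu>])
      show "V.dfn (\<lambda>e. ?R (e 0) (e 1))" by (intro dfn_intros F)
      show "\<exists>q. q \<epsilon> P \<and> ?R i q" for i using p le_refl by blast
    qed
    then obtain q where q: "q \<epsilon> P" "V.ae (\<lambda>i. ?R i q)" by blast
    have "le q p" using V.ae_ex[OF q(2)] by blast
    moreover have "V.ae (\<lambda>i. ?yes q i \<or> ?no q i)" by (rule V.ae_mono[OF q(2)]) blast
    moreover have "V.dfn (\<lambda>e. ?yes q (e 0))" by (intro dfn_intros F)
    ultimately show "\<exists>r. r \<epsilon> P \<and> le r p \<and> (V.ae (?yes r) \<or> V.ae (?no r))"
      using V.ae_disj[of "?yes q" "?no q"] q(1) by blast
  qed
  then obtain q where q: "q \<in> G" "V.ae (?yes q) \<or> V.ae (?no q)" by blast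
  have yes: "memG (ground i) X" if "?yes q i" for i
    unfolding ground_def using truth[of "check i" "check i"] that q(1) by blast
  have no: "\<not> memG (ground i) X" if no: "?no q i" for i
  proof
    assume "memG (ground i) X"
    then obtain p where p: "p \<in> G" "F p (check i) (check i)"
      unfolding ground_def using truth[of "check i" "check i"] by blast
    obtain r where r: "r \<in> G" "le r p" "le r q" using G_directed[OF p(1) q(1)] by blast
    then show False using no F_le[OF p(2) r(2)] p(1) G_P by blast
  qed
  show ?thesis
    using q(2)
  proof
    assume "V.ae (?yes q)"
    then have "V.ae (\<lambda>i. memG (ground i) X)" by (rule V.ae_mono) (rule yes)
    then show ?thesis ..
  next
    assume "V.ae (?no q)"
    then have "V.ae (\<lambda>i. \<not> memG (ground i) X)" by (rule V.ae_mono) (rule no)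
    then show ?thesis ..
  qed
qed

text \<open>The clauses translate to properties of \<open>ae\<close>, maximality to
  \<open>ae_decided\<close>; \<open>sep\<close> provides intersections and complements as sets of
  the extension.\<close>

lemma ultrafilter_generated:
  assumes W: "generated W U I"
  shows "VG.ultrafilter W (ground I)"
proof -
  have W: "memG X W \<longleftrightarrow> VG.sub X (ground I) \<and> V.ae (\<lambda>i. memG (ground i) X)" if "X \<in> VG" for X
    using W that unfolding generated_iff generated_filter_def by blast
  have sep: "\<exists>Z\<in>VG. \<forall>i. memG i Z \<longleftrightarrow> memG i (ground I) \<and> Q i" if Q: "VG.dfn (\<lambda>e. Q (e 0))" for Q
  proof -
    obtain t where "\<forall>X. memG X (val t) \<longleftrightarrow> memG X (ground I) \<and> Q X"
      using separation_ground[OF Q, of I] by (elim exE conjE)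
    then show ?thesis using val_in_VG[of t] by blast
  qed
  show ?thesis
    unfolding VG.ultrafilter_def
  proof (intro conjI ballI impI)
    show "VG.sub X (ground I)" if "X \<in> VG" "memG X W" for X using W that by blast
    have "V.ae (\<lambda>i. memG (ground i) (ground I))" by (rule V.ae_mono[OF V.ae_True]) simp
    then show "memG (ground I) W" unfolding W[OF ground_in_VG] VG.sub_def by blast
    show "\<not> VG.is_empty X" if "X \<in> VG" "memG X W" for X
    proof -
      have "\<exists>i. memG (ground i) X" using that W V.ae_ex by blast
      then show ?thesis unfolding VG.is_empty_def using ground_in_VG by blast
    qed
    show "\<exists>Z\<in>VG. memG Z W \<and> (\<forall>i\<in>VG. memG i Z \<longleftrightarrow> memG i X \<and> memG i Y)"
      if X: "X \<in> VG" and Y: "Y \<in> VG" and XY: "memG X W \<and> memG Y W" for X Y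
    proof -
      have "VG.dfn (\<lambda>e. memG (e 0) X \<and> memG (e 0) Y)" by (intro dfn_intros X Y)
      from sep[OF this] obtain Z where Z: "Z \<in> VG"
        "\<forall>i. memG i Z \<longleftrightarrow> memG i (ground I) \<and> memG i X \<and> memG i Y" by blast
      have XI: "VG.sub X (ground I)" "V.ae (\<lambda>i. memG (ground i) X)" "V.ae (\<lambda>i. memG (ground i) Y)"
        using XY W X Y by blast+
      have Z': "memG i Z \<longleftrightarrow> memG i X \<and> memG i Y" for i
        using Z(2) XI(1) memG_in_VG unfolding VG.sub_def by blast
      have "V.ae (\<lambda>i. memG (ground i) Z)" unfolding Z' by (rule V.ae_conj[OF XI(2,3)])
      moreover have "VG.sub Z (ground I)" unfolding VG.sub_def using Z(2) by blast
      ultimately show ?thesis using Z(1) Z' W by blast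
    qed
    show "memG Y W" if "X \<in> VG" "Y \<in> VG" "memG X W \<and> VG.sub X Y \<and> VG.sub Y (ground I)" for X Y
    proof -
      have "V.ae (\<lambda>i. memG (ground i) X)" using that W by blast
      then have "V.ae (\<lambda>i. memG (ground i) Y)"
        by (rule V.ae_mono) (use that ground_in_VG in \<open>unfold VG.sub_def, blast\<close>)
      then show ?thesis using that W by blast
    qed
    show "memG X W \<or> (\<exists>Y\<in>VG. memG Y W \<and> (\<forall>i\<in>VG. memG i Y \<longleftrightarrow> memG i (ground I) \<and> \<not> memG i X))"
      if X: "X \<in> VG" "VG.sub X (ground I)" for X
    proof (cases "memG X W")
      case False
      then have "V.ae (\<lambda>i. \<not> memG (ground i) X)" using ae_decided X W by blast
      have "VG.dfn (\<lambda>e. \<not> memG (e 0) X)" by (intro dfn_intros X)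
      from sep[OF this] obtain Y where Y: "Y \<in> VG"
        "\<forall>i. memG i Y \<longleftrightarrow> memG i (ground I) \<and> \<not> memG i X" by blast
      have "V.ae (\<lambda>i. memG (ground i) Y)"
        by (rule V.ae_mono[OF \<open>V.ae (\<lambda>i. \<not> memG (ground i) X)\<close>]) (use Y(2) in simp)
      moreover have "VG.sub Y (ground I)" unfolding VG.sub_def using Y(2) by blast
      ultimately have "memG Y W" using Y(1) W by blast
      then show ?thesis using Y by blast
    qed blast
  qed
qed

text \<open>The given partition need not belong to the ground model; what is available there is the
  relation that \<open>q\<close> forces \<open>i\<close> into piece \<open>n\<close>. Once a
  \<open>q\<close> in \<open>G\<close> decides a piece for almost every \<open>i\<close>,
  indecomposability applies to this relation, and the selection it yields works in the extension
  since the pieces decided by \<open>q\<close> are the actual ones.\<close>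

lemma indecomposable_generated:
  assumes W: "generated W U I"
    and ind: "V.indecomposable \<delta> \<kappa> U I" and \<kappa>: "V.ordinal \<kappa>"
  shows "VG.indecomposable (ground \<delta>) (ground \<kappa>) W (ground I)"
  unfolding VG.indecomposable_def
proof (intro ballI impI)
  have W: "memG X W \<longleftrightarrow> VG.sub X (ground I) \<and> V.ae (\<lambda>i. memG (ground i) X)" if "X \<in> VG" for X
    using W that unfolding generated_iff generated_filter_def by blast
  fix A S assume "A \<in> VG" and S: "S \<in> VG" and AS: "memG A (ground \<kappa>) \<and> VG.partition S A (ground I)"
  then obtain a where a: "a \<epsilon> \<kappa>" "A = ground a" unfolding mem_ground by blast
  have part: "VG.partition S (ground a) (ground I)" using AS a(2) by blast
  let ?Q = "\<lambda>N i. \<exists>X\<in>VG. VG.app S N X \<and> memG i X"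
  have "VG.dfn (\<lambda>e. ?Q (e 0) (e 1))" by (intro dfn_intros S)
  from forcing_relation[of ?Q, OF this]
  obtain F where F0: "V.dfn (\<lambda>e. F (e 0) (e 1) (e 2))"
    and F_le0: "\<forall>p q x y. F p x y \<longrightarrow> le q p \<longrightarrow> q \<epsilon> P \<longrightarrow> p \<epsilon> P \<longrightarrow> F q x y"
    and truth0: "\<forall>x y. ?Q (val x) (val y) \<longleftrightarrow> (\<exists>p\<in>G. F p x y)"
    by (elim exE conjE)
  note F = V.dfn_subst3[where Q=F, OF F0] and F_le = F_le0[rule_format] and truth = truth0[rule_format]
  let ?F = "\<lambda>q i n. F q (check n) (check i)"
  let ?good = "\<lambda>q. \<exists>b t. b \<epsilon> \<delta> \<and> V.increasing t b a \<and> V.ae (\<lambda>i. \<exists>x n. V.app t x n \<and> ?F q i n)"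
  \<comment> \<open>A condition is bad if it keeps some \<open>i\<close> out of every piece. With
    this alternative the set is dense although an arbitrary condition need not force
    \<open>S\<close> to be a partition; no bad condition is in \<open>G\<close>, since
    \<open>S\<close> covers \<open>ground I\<close>.\<close>
  let ?bad = "\<lambda>q. \<exists>i. i \<epsilon> I \<and> (\<forall>n. n \<epsilon> a \<longrightarrow> (\<forall>r. r \<epsilon> P \<and> le r q \<longrightarrow> \<not> ?F r i n))"
  have "\<exists>q\<in>G. ?good q \<or> ?bad q"
  proof (rule generic_dense)
    show "V.dfn (\<lambda>e. ?good (e 0) \<or> ?bad (e 0))" by (intro dfn_intros F)
    fix p assume p: "p \<epsilon> P"
    show "\<exists>q. q \<epsilon> P \<and> le q p \<and> (?good q \<or> ?bad q)"
    proof (cases "?bad p")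
      case True
      then show ?thesis using p le_refl by blast
    next
      case False
      let ?R = "\<lambda>i q. le q p \<and> (\<exists>n. n \<epsilon> a \<and> ?F q i n)"
      have "\<exists>q. q \<epsilon> P \<and> V.ae (\<lambda>i. ?R i q)"
      proof (rule V.ae_uniform_condition[OF crit card_P \<pi>_\<mu>])
        show "V.dfn (\<lambda>e. ?R (e 0) (e 1))" by (intro dfn_intros F)
        show "\<exists>q. q \<epsilon> P \<and> ?R i q" if "i \<epsilon> I" for i using False that by blast
      qed
      then obtain q where q: "q \<epsilon> P" "V.ae (\<lambda>i. ?R i q)" by blast
      obtain i n where "le q p" "n \<epsilon> a" using V.ae_ex[OF q(2)] by blast
      let ?T = "\<lambda>i n. (\<exists>m. m \<epsilon> a \<and> ?F q i m) \<longrightarrow> ?F q i n"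
      have "\<exists>b t. b \<epsilon> \<delta> \<and> V.increasing t b a \<and> V.ae (\<lambda>i. \<exists>x n. V.app t x n \<and> ?T i n)"
      proof (rule V.indecomposable_ae[OF ind \<kappa> a(1)])
        show "V.dfn (\<lambda>e. ?T (e 0) (e 1))" by (intro dfn_intros F)
        show "\<exists>n. n \<epsilon> a \<and> ?T i n" for i using \<open>n \<epsilon> a\<close> by blast
      qed
      then obtain b t where bt: "b \<epsilon> \<delta>" "V.increasing t b a" "V.ae (\<lambda>i. \<exists>x n. V.app t x n \<and> ?T i n)" by blast
      have "V.ae (\<lambda>i. \<exists>x n. V.app t x n \<and> ?F q i n)"
        by (rule V.ae_mono[OF V.ae_conj[OF q(2) bt(3)]]) blast
      then have "?good q" using bt(1,2) by blast
      then show ?thesis using q(1) \<open>le q p\<close> by blast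
    qed
  qed
  then obtain q where q: "q \<in> G" "?good q \<or> ?bad q" by blast
  have F_Q: "?Q (ground n) (ground i)" if "?F q i n" for i n
    unfolding ground_def truth using that q(1) by blast
  have "\<not> ?bad q"
  proof
    assume "?bad q"
    then obtain i where i: "i \<epsilon> I" and no: "\<forall>n. n \<epsilon> a \<longrightarrow> (\<forall>r. r \<epsilon> P \<and> le r q \<longrightarrow> \<not> ?F r i n)" by blast
    have "memG (ground i) (ground I)" using i by simp
    then obtain N where N: "memG N (ground a)" "?Q N (ground i)"
      using part ground_in_VG unfolding VG.partition_def by blast
    then obtain n where n: "n \<epsilon> a" "N = ground n" unfolding mem_ground by blast
    then obtain p where p: "p \<in> G" "?F p i n" using N(2) truth unfolding ground_def by blast
    obtain r where r: "r \<in> G" "le r p" "le r q" using G_directed[OF p(1) q(1)] by blast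
    then have "?F r i n" using F_le[OF p(2)] G_P p(1) by blast
    then show False using no n(1) r G_P by blast
  qed
  then have "?good q" using q(2) by blast
  then obtain b t where bt: "b \<epsilon> \<delta>" "V.increasing t b a" and ae: "V.ae (\<lambda>i. \<exists>x n. V.app t x n \<and> ?F q i n)"
    by (elim exE conjE)
  let ?Y = "\<lambda>i. \<exists>x\<in>VG. \<exists>n\<in>VG. \<exists>X\<in>VG. VG.app (ground t) x n \<and> VG.app S n X \<and> memG i X"
  have "VG.dfn (\<lambda>e. ?Y (e 0))" by (intro dfn_intros S ground_in_VG)
  from separation_ground[OF this, of I]
  obtain y where Y0: "\<forall>i. memG i (val y) \<longleftrightarrow> memG i (ground I) \<and> ?Y i"
    by (elim exE conjE)
  note Y = Y0[rule_format]
  have Y_I: "memG i (ground I)" if "?Y i" for i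
    using that part memG_in_VG unfolding VG.partition_def VG.sub_def by blast
  have ae_Y: "V.ae (\<lambda>i. memG (ground i) (val y))"
  proof (rule V.ae_mono[OF ae])
    fix i assume i: "i \<epsilon> I" and "\<exists>x n. V.app t x n \<and> ?F q i n"
    then obtain x n where xn: "V.app t x n" "?F q i n" by blast
    then have "VG.app (ground t) (ground x) (ground n)" by simp
    then have "?Y (ground i)" using F_Q[OF xn(2)] ground_in_VG by blast
    then show "memG (ground i) (val y)" unfolding Y using i by simp
  qed
  have Y': "memG i (val y) \<longleftrightarrow> ?Y i" for i
    unfolding Y using Y_I by blast
  have "VG.sub (val y) (ground I)" unfolding VG.sub_def Y by blast
  then have "memG (val y) W" using W[OF val_in_VG] ae_Y by blast
  moreover have "memG (ground b) (ground \<delta>)" using bt(1) by simp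
  moreover have "VG.increasing (ground t) (ground b) A" unfolding a(2) by (rule increasing_ground[OF bt(2)])
  ultimately show "\<exists>B\<in>VG. \<exists>T\<in>VG. memG B (ground \<delta>) \<and> VG.increasing T B A \<and>
    (\<exists>Y\<in>VG. memG Y W \<and> (\<forall>i\<in>VG. memG i Y \<longleftrightarrow>
      (\<exists>x\<in>VG. \<exists>n\<in>VG. \<exists>X\<in>VG. VG.app T x n \<and> VG.app S n X \<and> memG i X)))"
    using Y' by (intro bexI[of _ "ground b"] bexI[of _ "ground t"] bexI[of _ "val y"] conjI ballI)
      (simp_all add: val_in_VG)
qed

end

theorem theorem1p8:
  fixes E :: "'v \<Rightarrow> 'v \<Rightarrow> bool"
    and \<delta> \<kappa> U I P L \<mu> \<pi> :: 'v
    and G :: "'v set"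
  assumes "wfp E" and "eps.ZFC UNIV E"
    and "eps.cardinal UNIV E \<delta>" and "eps.cardinal UNIV E \<kappa>"
    and "eps.two_power_less UNIV E \<delta> \<kappa>"
    and "eps.ultrafilter UNIV E U I"
    and "eps.indecomposable UNIV E \<delta> \<kappa> U I"
    and "forcing.forcing_notion E P L"
    and "eps.critical_point UNIV E U I \<mu>"
    and "eps.has_card UNIV E P \<pi>" and "E \<pi> \<mu>"
    and "forcing.generic E P L G"
  shows "\<exists>W \<in> forcing.VG E G.
    forcing.generated E P G W U I \<and>
    eps.ultrafilter (forcing.VG E G) (forcing.memG E G) W (forcing.ground E P G I) \<and>
    eps.indecomposable (forcing.VG E G) (forcing.memG E G)
      (forcing.ground E P G \<delta>) (forcing.ground E P G \<kappa>) W (forcing.ground E P G I)"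
proof -
  interpret extended_ultrafilter E P L G U I \<mu> \<pi>
    by unfold_locales (use assms in auto)
  have "V.ordinal \<kappa>" using assms(4) unfolding V.cardinal_def by blast
  then show ?thesis
    using ex_generated ultrafilter_generated indecomposable_generated assms(7) by blast
qed

end
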